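(* Let $\Gamma$ be a finite simplicial graph and let $H$ be a finitely generated, non-quasiconvex subgroup of the (possibly non-hyperbolic) right-angled Coxeter group $W_\Gamma$. Then there exist infinitely many finite $\Gamma$-partite graphs $\Delta$ such that $W_\Delta$ is hyperbolic and $2$-dimensional and such that, for every finite set $T$ of words in $V(\Gamma)$ generating $H$, the generalization $\overline H < W_\Delta$ of $H$ with respect to $\Delta$ and $T$ is a finitely generated, non-quasiconvex subgroup of $W_\Delta$. Moreover, if $H$ is torsion-free, then $\overline H$ is torsion-free, and if $H$ is not normal in $W_\Gamma$, then $\overline H$ is not normal in $W_\Delta$.
   Context: Right-angled Coxeter group (RACG): for a simplicial graph $\Gamma$ with vertex set $V(\Gamma)$ and edge set $E(\Gamma)$, $W_\Gamma=\langle s\in V(\Gamma) \mid s^2=1 \text{ for all } s\in V(\Gamma),\ st=ts \text{ for all } (s,t)\in E(\Gamma)\rangle$; $V(\Gamma)$ is its standard generating set. $W_\Gamma$ is called $2$-dimensional if $\Gamma$ contains no $3$-cycle. Quasiconvexity: a subgroup $H$ of a group $G$ with generating set $S$ is quasiconvex (with respect to $S$) if some finite-radius neighborhood of $H$ in the Cayley graph of $(G,S)$ contains every geodesic connecting a pair of vertices in $H$. Quasiconvexity in a RACG is always with respect to the standard generating set. $\Gamma$-partite graphs: let $\Gamma$ have vertex set $\{s_1,\dots,s_n\}$. A simplicial graph $\Delta$ is $\Gamma$-partite if its vertex set can be partitioned into $n$ non-empty disjoint sets $A_1,\dots,A_n$ (the decomposition of $\Delta$) such that (1) no two vertices of $A_i$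 are adjacent; (2) for all $1\le i<j\le n$, the subgraph $\Delta_{ij}$ of $\Delta$ induced by $A_i\cup A_j$ is connected if $s_i$ is adjacent to $s_j$ in $\Gamma$, and otherwise has no edges. Generalization of a subgroup: let $\Delta$ be a finite $\Gamma$-partite graph with decomposition $A_1,\dots,A_n$ and let $H<W_\Gamma$ be generated by a finite set $T=\{w_1,\dots,w_m\}$ of words in $V(\Gamma)$. The rose graph $R$ associated to $T$ is the graph with edges labeled by vertices of $\Gamma$ consisting of a base vertex $B$ together with, for each $i$, a cycle of length $|w_i|$ attached at $B$ with label $w_i$. Let $\overline R$ be the graph with the same vertices as $R$, obtained by replacing each edge of $R$ labeled $s_i$ by $|A_i|$ parallel edges with the same endpoints, whose labels are in bijection with the elements of $A_i$. Choose a finite set of loops in $\overline R$ based at $B$ which generate $\pi_1(\overline R,B)$, and let $\overline T$ be the set of their labels (the label of an edge path is the word of labels of the edges successively traversed, in whichever direction). The generalization $\overline H$ of $H$ with respect to $\Delta$ and $T$ is the subgroup of $W_\Delta$ generated by $\overline T$; it does not depend on the choice of loops. *)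

theory Defs
  imports "HOL-Algebra.Generated_Groups" "Graph_Theory.Graph_Theory"
begin

text \<open>
  A finite simplicial graph is a \<open>pair_pre_digraph\<close> satisfying \<open>pair_graph\<close>: finite, loop-free,
  with a symmetric set of arcs, so that an edge is a pair of opposite arcs.
\<close>

section \<open>Group presentations\<close>

text \<open>
  Words over a set \<open>S\<close> of generators and their formal inverses; \<open>(s, True)\<close> stands for \<open>s\<close> and
  \<open>(s, False)\<close> for its inverse. A relation \<open>u = v\<close> is given as the pair \<open>(u, v)\<close>.
\<close>

type_synonym 'a gword = "('a \<times> bool) list"

definition gwords :: "'a set \<Rightarrow> 'a gword set" where
  "gwords S = lists (S \<times> UNIV)"

inductive pres_eq :: "'a set \<Rightarrow> ('a gword \<times> 'a gword) set \<Rightarrow> 'a gword \<Rightarrow> 'a gword \<Rightarrow> bool"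
  for S :: "'a set" and R :: "('a gword \<times> 'a gword) set" where
  refl: "w \<in> gwords S \<Longrightarrow> pres_eq S R w w"
| sym: "pres_eq S R u v \<Longrightarrow> pres_eq S R v u"
| trans: "pres_eq S R u v \<Longrightarrow> pres_eq S R v w \<Longrightarrow> pres_eq S R u w"
| cong: "pres_eq S R u u' \<Longrightarrow> pres_eq S R v v' \<Longrightarrow> pres_eq S R (u @ v) (u' @ v')"
| cancel: "s \<in> S \<Longrightarrow> pres_eq S R [(s, b), (s, \<not> b)] []"
| relator: "(u, v) \<in> R \<Longrightarrow> u \<in> gwords S \<Longrightarrow> v \<in> gwords S \<Longrightarrow> pres_eq S R u v"

definition pres_class :: "'a set \<Rightarrow> ('a gword \<times> 'a gword) set \<Rightarrow> 'a gword \<Rightarrow> 'a gword set" where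
  "pres_class S R w = {v. pres_eq S R w v}"

definition presented_group :: "'a set \<Rightarrow> ('a gword \<times> 'a gword) set \<Rightarrow> 'a gword set monoid" where
  "presented_group S R =
     \<lparr> carrier = pres_class S R ` gwords S,
       monoid.mult = (\<lambda>X Y. \<Union>u\<in>X. \<Union>v\<in>Y. pres_class S R (u @ v)),
       one = pres_class S R [] \<rparr>"


section \<open>Right-angled Coxeter groups\<close>

definition racg_relations :: "'a pair_pre_digraph \<Rightarrow> ('a gword \<times> 'a gword) set" where
  "racg_relations \<Gamma> =
     {([(s, True), (s, True)], []) | s. s \<in> pverts \<Gamma>} \<union>
     {([(s, True), (t, True)], [(t, True), (s, True)]) | s t. (s, t) \<in> parcs \<Gamma>}"

definition racg :: "'a pair_pre_digraph \<Rightarrow> 'a gword set monoid" where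
  "racg \<Gamma> = presented_group (pverts \<Gamma>) (racg_relations \<Gamma>)"

text \<open>The element of the group represented by a word in the vertices of the graph.\<close>

definition racg_word :: "'a pair_pre_digraph \<Rightarrow> 'a list \<Rightarrow> 'a gword set" where
  "racg_word \<Gamma> w = pres_class (pverts \<Gamma>) (racg_relations \<Gamma>) (map (\<lambda>s. (s, True)) w)"

definition racg_gens :: "'a pair_pre_digraph \<Rightarrow> 'a gword set set" where
  "racg_gens \<Gamma> = (\<lambda>s. racg_word \<Gamma> [s]) ` pverts \<Gamma>"

definition racg_2_dimensional :: "'a pair_pre_digraph \<Rightarrow> bool" where
  "racg_2_dimensional \<Gamma> \<longleftrightarrow>
     \<not> (\<exists>a b c. (a, b) \<in> parcs \<Gamma> \<and> (b, c) \<in> parcs \<Gamma> \<and> (c, a) \<in> parcs \<Gamma>)"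


section \<open>Cayley graphs, quasiconvexity and hyperbolicity\<close>

definition cayley_graph :: "('g, 'm) monoid_scheme \<Rightarrow> 'g set \<Rightarrow> 'g pair_pre_digraph" where
  "cayley_graph G S =
     \<lparr> pverts = carrier G,
       parcs = (let E = {(g, g \<otimes>\<^bsub>G\<^esub> s) | g s. g \<in> carrier G \<and> s \<in> S} in E \<union> E\<inverse>) \<rparr>"

definition vwalk_between :: "'v pair_pre_digraph \<Rightarrow> 'v \<Rightarrow> 'v vwalk \<Rightarrow> 'v \<Rightarrow> bool" where
  "vwalk_between X u p v \<longleftrightarrow> vwalk p (with_proj X) \<and> hd p = u \<and> last p = v"

definition path_dist :: "'v pair_pre_digraph \<Rightarrow> 'v \<Rightarrow> 'v \<Rightarrow> nat" where
  "path_dist X u v = (LEAST n. \<exists>p. vwalk_between X u p v \<and> vwalk_length p = n)"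

definition geodesic_between :: "'v pair_pre_digraph \<Rightarrow> 'v \<Rightarrow> 'v vwalk \<Rightarrow> 'v \<Rightarrow> bool" where
  "geodesic_between X u p v \<longleftrightarrow> vwalk_between X u p v \<and> vwalk_length p = path_dist X u v"

definition quasiconvex :: "('g, 'm) monoid_scheme \<Rightarrow> 'g set \<Rightarrow> 'g set \<Rightarrow> bool" where
  "quasiconvex G S H \<longleftrightarrow>
     (\<exists>r. \<forall>u\<in>H. \<forall>v\<in>H. \<forall>p. geodesic_between (cayley_graph G S) u p v \<longrightarrow>
        (\<forall>x\<in>set p. \<exists>h\<in>H. path_dist (cayley_graph G S) x h \<le> r))"

text \<open>Gromov's four-point condition on a set \<open>X\<close> with metric \<open>d\<close>.\<close>

definition gromov_hyperbolic :: "real \<Rightarrow> 'v set \<Rightarrow> ('v \<Rightarrow> 'v \<Rightarrow> real) \<Rightarrow> bool" where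
  "gromov_hyperbolic \<delta> X d \<longleftrightarrow>
     (\<forall>x\<in>X. \<forall>y\<in>X. \<forall>z\<in>X. \<forall>w\<in>X.
        d x y + d z w \<le> max (d x z + d y w) (d x w + d y z) + 2 * \<delta>)"

definition hyperbolic_group :: "('g, 'm) monoid_scheme \<Rightarrow> bool" where
  "hyperbolic_group G \<longleftrightarrow>
     (\<exists>S \<delta>. finite S \<and> S \<subseteq> carrier G \<and> generate G S = carrier G \<and>
        gromov_hyperbolic \<delta> (carrier G) (\<lambda>x y. real (path_dist (cayley_graph G S) x y)))"


section \<open>Properties of subgroups\<close>

definition finitely_generated :: "('g, 'm) monoid_scheme \<Rightarrow> 'g set \<Rightarrow> bool" where
  "finitely_generated G H \<longleftrightarrow> (\<exists>S. finite S \<and> S \<subseteq> carrier G \<and> generate G S = H)"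

definition torsion_free :: "('g, 'm) monoid_scheme \<Rightarrow> 'g set \<Rightarrow> bool" where
  "torsion_free G H \<longleftrightarrow> (\<forall>x\<in>H. \<forall>n::nat. n > 0 \<longrightarrow> x [^]\<^bsub>G\<^esub> n = \<one>\<^bsub>G\<^esub> \<longrightarrow> x = \<one>\<^bsub>G\<^esub>)"


section \<open>Partite graphs\<close>

text \<open>\<open>A\<close> is the decomposition of \<open>\<Delta>\<close>, indexed by the vertices of \<open>\<Gamma>\<close>.\<close>

definition partite :: "'a pair_pre_digraph \<Rightarrow> 'b pair_pre_digraph \<Rightarrow> ('a \<Rightarrow> 'b set) \<Rightarrow> bool" where
  "partite \<Gamma> \<Delta> A \<longleftrightarrow>
     (\<Union>s\<in>pverts \<Gamma>. A s) = pverts \<Delta> \<and>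
     (\<forall>s\<in>pverts \<Gamma>. A s \<noteq> {}) \<and>
     (\<forall>s\<in>pverts \<Gamma>. \<forall>t\<in>pverts \<Gamma>. s \<noteq> t \<longrightarrow> A s \<inter> A t = {}) \<and>
     (\<forall>s\<in>pverts \<Gamma>. \<forall>a\<in>A s. \<forall>b\<in>A s. (a, b) \<notin> parcs \<Delta>) \<and>
     (\<forall>s\<in>pverts \<Gamma>. \<forall>t\<in>pverts \<Gamma>. s \<noteq> t \<longrightarrow>
        (if (s, t) \<in> parcs \<Gamma> then Digraph_Component.connected (with_proj \<Delta> \<restriction> (A s \<union> A t))
         else arcs (with_proj \<Delta> \<restriction> (A s \<union> A t)) = {}))"


section \<open>Fundamental groups of graphs\<close>

text \<open>
  Here a multigraph is a \<open>pre_digraph\<close> whose arcs are its edges with an arbitrarily chosen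
  orientation. Edge paths traverse edges in either direction, so they are the walks in the following
  digraph: \<open>(e, True)\<close> traverses \<open>e\<close> from tail to head and \<open>(e, False)\<close> from head to tail.
\<close>

definition oriented :: "('v, 'e) pre_digraph \<Rightarrow> ('v, 'e \<times> bool) pre_digraph" where
  "oriented G =
     \<lparr> verts = verts G, arcs = arcs G \<times> UNIV,
       tail = (\<lambda>(e, b). if b then tail G e else head G e),
       head = (\<lambda>(e, b). if b then head G e else tail G e) \<rparr>"

definition loops_at :: "('v, 'e) pre_digraph \<Rightarrow> 'v \<Rightarrow> ('e \<times> bool) list set" where
  "loops_at G x = {p. pre_digraph.awalk (oriented G) x p x}"

inductive homotopic :: "('v, 'e) pre_digraph \<Rightarrow> 'v \<Rightarrow> ('e \<times> bool) list \<Rightarrow> ('e \<times> bool) list \<Rightarrow> bool"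
  for G :: "('v, 'e) pre_digraph" and x :: 'v where
  refl: "p \<in> loops_at G x \<Longrightarrow> homotopic G x p p"
| sym: "homotopic G x p q \<Longrightarrow> homotopic G x q p"
| trans: "homotopic G x p q \<Longrightarrow> homotopic G x q r \<Longrightarrow> homotopic G x p r"
| backtrack: "p @ q \<in> loops_at G x \<Longrightarrow> p @ [(e, b), (e, \<not> b)] @ q \<in> loops_at G x \<Longrightarrow>
    homotopic G x (p @ [(e, b), (e, \<not> b)] @ q) (p @ q)"

definition homotopy_class :: "('v, 'e) pre_digraph \<Rightarrow> 'v \<Rightarrow> ('e \<times> bool) list \<Rightarrow> ('e \<times> bool) list set" where
  "homotopy_class G x p = {q. homotopic G x p q}"

definition fundamental_group :: "('v, 'e) pre_digraph \<Rightarrow> 'v \<Rightarrow> ('e \<times> bool) list set monoid" where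
  "fundamental_group G x =
     \<lparr> carrier = homotopy_class G x ` loops_at G x,
       monoid.mult = (\<lambda>X Y. \<Union>p\<in>X. \<Union>q\<in>Y. homotopy_class G x (p @ q)),
       one = homotopy_class G x [] \<rparr>"


section \<open>Generalizations of subgroups\<close>

text \<open>
  In the rose graph, \<open>None\<close> is the base vertex, \<open>Some (w, k)\<close> with \<open>0 < k < length w\<close> is the \<open>k\<close>-th
  vertex of the cycle labelled \<open>w\<close>, and the edge \<open>(w, k)\<close> from the \<open>k\<close>-th to the \<open>k + 1\<close>-st vertex
  of that cycle has label \<open>w ! k\<close>.
\<close>

definition rose_vertex :: "'a list \<Rightarrow> nat \<Rightarrow> ('a list \<times> nat) option" where
  "rose_vertex w k = (if k = 0 \<or> k = length w then None else Some (w, k))"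

definition rose :: "'a list set \<Rightarrow> (('a list \<times> nat) option, 'a list \<times> nat) pre_digraph" where
  "rose T =
     \<lparr> verts = {None} \<union> {Some (w, k) | w k. w \<in> T \<and> 0 < k \<and> k < length w},
       arcs = {(w, k). w \<in> T \<and> k < length w},
       tail = (\<lambda>(w, k). rose_vertex w k),
       head = (\<lambda>(w, k). rose_vertex w (Suc k)) \<rparr>"

definition rose_label :: "'a list \<times> nat \<Rightarrow> 'a" where
  "rose_label = (\<lambda>(w, k). w ! k)"

text \<open>The edge \<open>(e, a)\<close> is the copy of \<open>e\<close> with label \<open>a\<close>.\<close>

definition multiply_edges ::
  "('v, 'e) pre_digraph \<Rightarrow> ('e \<Rightarrow> 'a) \<Rightarrow> ('a \<Rightarrow> 'b set) \<Rightarrow> ('v, 'e \<times> 'b) pre_digraph" where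
  "multiply_edges G lab A =
     \<lparr> verts = verts G,
       arcs = {(e, a). e \<in> arcs G \<and> a \<in> A (lab e)},
       tail = (\<lambda>(e, a). tail G e),
       head = (\<lambda>(e, a). head G e) \<rparr>"

definition generalized_rose ::
  "'a list set \<Rightarrow> ('a \<Rightarrow> 'b set) \<Rightarrow> (('a list \<times> nat) option, ('a list \<times> nat) \<times> 'b) pre_digraph" where
  "generalized_rose T A = multiply_edges (rose T) rose_label A"

definition loop_label :: "((('a list \<times> nat) \<times> 'b) \<times> bool) list \<Rightarrow> 'b list" where
  "loop_label p = map (\<lambda>((e, a), b). a) p"

text \<open>
  \<open>K\<close> is the generalization, with respect to \<open>\<Delta>\<close> (with decomposition \<open>A\<close>) and \<open>T\<close>, of the subgroup
  generated by \<open>T\<close>. It is stated as a predicate of \<open>K\<close> because of the choice of the set \<open>L\<close> of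
  loops, on which \<open>K\<close> does not depend.
\<close>

definition is_generalization ::
  "'b pair_pre_digraph \<Rightarrow> ('a \<Rightarrow> 'b set) \<Rightarrow> 'a list set \<Rightarrow> 'b gword set set \<Rightarrow> bool" where
  "is_generalization \<Delta> A T K \<longleftrightarrow>
     (\<exists>L. finite L \<and> L \<subseteq> loops_at (generalized_rose T A) None \<and>
        generate (fundamental_group (generalized_rose T A) None)
          (homotopy_class (generalized_rose T A) None ` L)
          = carrier (fundamental_group (generalized_rose T A) None) \<and>
        K = generate (racg \<Delta>) (racg_word \<Delta> ` loop_label ` L))"

end

theory Submission
  imports Defs "HOL-Number_Theory.Cong" "HOL-Library.Nat_Bijection"
begin

text \<open>
  Let \<open>\<phi>\<close> be the homomorphism from \<open>W\<^sub>\<Delta>\<close> to \<open>W\<^sub>\<Gamma>\<close> that sends all vertices of the part \<open>A\<^sub>s\<close> to \<open>s\<close>. It is well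
  defined, surjective and does not increase word lengths, and it maps \<open>K\<close> onto \<open>H\<close>, because the labels
  of loops in the generalized rose project to the labels of loops in the rose
  (\<open>K_words_project\<close>, \<open>H_liftable\<close>). This already shows that \<open>H\<close> is normal if \<open>K\<close> is, and that \<open>K\<close> is
  torsion-free if \<open>H\<close> and the kernel of \<open>\<phi>\<close> are.

  The point of the construction is that \<^emph>\<open>every\<close> lift of a reduced word representing an element of \<open>H\<close>
  represents an element of \<open>K\<close> (\<open>reduced_lifts_in_K\<close>). This holds for products of the words in \<open>T\<close> and
  their inverses, by the definition of \<open>K\<close>. By Tits' solution of the word problem
  (\<open>shortening_steps_reduced\<close>) each reduced word is reached from such a product by deletions \<open>ss \<rightarrow> 1\<close> and swaps
  \<open>st \<rightarrow> ts\<close> alone. Deletions obviously preserve the property, and swaps do so because the subgraph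
  on \<open>A\<^sub>s \<union> A\<^sub>t\<close> is connected (\<open>lifts_in_K_swap\<close>). Consequently geodesics of \<open>W\<^sub>\<Gamma>\<close> between points of \<open>H\<close> lift
  to geodesics of \<open>W\<^sub>\<Delta>\<close> between points of \<open>K\<close>, and if \<open>K\<close> were quasiconvex, \<open>H\<close> would be too
  (\<open>quasiconvex_descends\<close>).

  It remains to find infinitely many \<open>\<Delta>\<close> without triangles for which \<open>W\<^sub>\<Delta>\<close> is hyperbolic. Graphs without cycles
  of length three and four are enough. They are constructed by
  letting each part be the integers modulo \<open>N\<close> and joining two parts by two shifts, all shifts being
  different powers of five (\<open>shift_no_triangle\<close>, \<open>shift_no_square\<close>, \<open>part_connected\<close>). Hyperbolicity is proved
  through the walls of the Cayley graph: the distance of two elements is the number of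
  reflections whose walls separate them, so the four-point condition amounts to a
  bound on families of mutually crossing walls that split four points in two different ways. Two
  walls in each of two such families would produce a closed path of length three or four in \<open>\<Delta>\<close>
  (\<open>no_two_by_two_grid\<close>). The same walls show that an element of the kernel of \<open>\<phi>\<close> has infinite order
  unless it is trivial: after conjugation it translates a half-space properly into itself
  (\<open>skewered_infinite_order\<close>, \<open>kernel_torsion_free\<close>).
\<close>

section \<open>Words modulo the Coxeter relations\<close>

locale racg_words =
  fixes adj :: "'a \<Rightarrow> 'a \<Rightarrow> bool"
  assumes adj_sym: "adj s t \<Longrightarrow> adj t s" and adj_irrefl: "\<not> adj s s"
begin

inductive weq :: "'a list \<Rightarrow> 'a list \<Rightarrow> bool" (infix "\<approx>" 50) where
  refl [simp, intro!]: "w \<approx> w"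
| sym: "u \<approx> v \<Longrightarrow> v \<approx> u"
| trans: "u \<approx> v \<Longrightarrow> v \<approx> w \<Longrightarrow> u \<approx> w"
| app: "u \<approx> u' \<Longrightarrow> v \<approx> v' \<Longrightarrow> u @ v \<approx> u' @ v'"
| square: "[s, s] \<approx> []"
| comm: "adj s t \<Longrightarrow> [s, t] \<approx> [t, s]"

lemmas [trans] = trans

text \<open>
  The hypothesis is an equivalence between words, not an equality, so it cannot be used for
  rewriting; this lemma and the next one replace one side of an equivalence instead.
\<close>

lemma weq_equal_left: "u \<approx> v \<Longrightarrow> (u \<approx> w) = (v \<approx> w)" 
  by (blast intro: sym trans)

lemma weq_equal_right: "u \<approx> v \<Longrightarrow> (w \<approx> u) = (w \<approx> v)" 
  by (blast intro: sym trans)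

lemma weq_commute: "(u \<approx> v) = (v \<approx> u)"
  by (blast intro: sym)

lemma app_left: "v \<approx> v' \<Longrightarrow> u @ v \<approx> u @ v'" 
  by (simp add: app)

lemma app_right: "u \<approx> u' \<Longrightarrow> u @ v \<approx> u' @ v" 
  by (simp add: app)

lemma Cons_weq: "v \<approx> v' \<Longrightarrow> s # v \<approx> s # v'"
  using app_left [of v v' "[s]"] by simp

lemma square_Cons: "s # s # w \<approx> w"
  using app_right [OF square, of s w] by simp

lemma rev_weq: "u \<approx> v \<Longrightarrow> rev u \<approx> rev v"
  by (induction rule: weq.induct)
    (auto intro: sym trans app square comm [THEN sym])

lemma append_rev: "u @ rev u \<approx> []"
proof (induction u)
  case (Cons s u)
  have "[s] @ (u @ rev u) @ [s] \<approx> [s] @ [] @ [s]"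
    by (intro app_left app_right Cons)
  also have "[s] @ [] @ [s] \<approx> []" by (simp add: square)
  finally show ?case by simp
qed simp

lemma rev_append_self: "rev u @ u \<approx> []"
  using append_rev [of "rev u"] by simp

lemma rev_cancel: "rev u @ u @ v \<approx> v"
  using app_right [OF rev_append_self, of u v] by simp

lemma cancel_rev: "u @ rev u @ v \<approx> v"
  using app_right [OF append_rev, of u v] by simp

lemma left_cancel: "(u @ v \<approx> u @ w) = (v \<approx> w)"
proof
  assume "u @ v \<approx> u @ w"
  then have "rev u @ u @ v \<approx> rev u @ u @ w" by (rule app_left)
  then show "v \<approx> w" by (meson rev_cancel sym trans)
qed (rule app_left)

lemma right_cancel: "(v @ u \<approx> w @ u) = (v \<approx> w)"
proof
  assume "v @ u \<approx> w @ u"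
  then have "rev u @ rev v \<approx> rev u @ rev w" using rev_weq by fastforce
  then show "v \<approx> w" using left_cancel rev_weq by fastforce
qed (rule app_right)

lemma Cons_cancel: "(s # v \<approx> s # w) = (v \<approx> w)"
  using left_cancel [of "[s]"] by simp

lemma move_left: "(u @ v \<approx> w) = (v \<approx> rev u @ w)"
  by (metis cancel_rev left_cancel weq_equal_right)

lemma move_right: "(v @ u \<approx> w) = (v \<approx> w @ rev u)"
proof -
  have "w @ rev u @ u \<approx> w" using app_left [OF rev_append_self, of w u] by simp
  then have "(v @ u \<approx> w) = (v @ u \<approx> w @ rev u @ u)" using weq_equal_right by blast
  then show ?thesis using right_cancel [of v u "w @ rev u"] by simp
qed

lemma Cons_move: "(s # v \<approx> w) = (v \<approx> s # w)"
  using move_left [of "[s]"] by simp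

lemma conj_move: "(u @ r @ rev u \<approx> r') = (r \<approx> rev u @ r' @ u)"
  using move_left [of u "r @ rev u" r'] move_right [of r "rev u" "rev u @ r'"] by simp

lemma conj_cancel: "(u @ r @ rev u \<approx> u @ r' @ rev u) = (r \<approx> r')"
  by (simp add: left_cancel right_cancel)

lemma conj_weq: "u \<approx> u' \<Longrightarrow> r \<approx> r' \<Longrightarrow> u @ r @ rev u \<approx> u' @ r' @ rev u'"
  by (simp add: app rev_weq)

lemma conj_weq': "u \<approx> u' \<Longrightarrow> r \<approx> r' \<Longrightarrow> rev u @ r @ u \<approx> rev u' @ r' @ u'"
  by (simp add: app rev_weq)

lemma conj_conj: "rev u @ (u @ r @ rev u) @ u \<approx> r"
  using conj_move by (metis refl sym)

lemma conj_conj': "u @ (rev u @ r @ u) @ rev u \<approx> r"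
  by (metis conj_conj rev_rev_ident)

text \<open>
  Both kinds of relations, \<open>ss = 1\<close> and \<open>st = ts\<close>, preserve the parity of the number of letters of
  each sort. In particular a reflection determines the letter of which it is a conjugate.
\<close>

lemma count_parity:
  assumes "u \<approx> v" shows "even (length (filter P u)) = even (length (filter P v))"
  using assms by (induction rule: weq.induct) auto

lemma length_parity: "u \<approx> v \<Longrightarrow> even (length u) = even (length v)"
  using count_parity [of u v "\<lambda>_. True"] by simp

lemma conj_letter:
  assumes "u @ [s] @ rev u \<approx> v @ [t] @ rev v" shows "s = t"
  using count_parity [OF assms, of "\<lambda>x. x = s"] by (auto split: if_splits simp: rev_filter [symmetric])

lemma letter_eq: "[s] \<approx> [t] \<longleftrightarrow> s = t"
  using conj_letter [of "[]" s "[]" t] by auto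

text \<open>
  Mapping some of the generators to the identity respects the relations, so deleting letters is a
  homomorphism.
\<close>

lemma filter_weq: "u \<approx> v \<Longrightarrow> filter P u \<approx> filter P v"
  by (induction rule: weq.induct)
    (auto intro: sym trans app square comm)

section \<open>Walls and reduced words\<close>

text \<open>
  The path from \<open>1\<close> to \<open>w = s\<^sub>1 \<dots> s\<^sub>n\<close> crosses the walls of the reflections
  \<open>s\<^sub>1 \<dots> s\<^sub>i\<^sub>-\<^sub>1 s\<^sub>i s\<^sub>i\<^sub>-\<^sub>1 \<dots> s\<^sub>1\<close>, and \<open>sep w r\<close> says that the wall of \<open>r\<close> is crossed an odd number of times,
  that is, that it separates \<open>w\<close> from \<open>1\<close>. This parity depends only on the element that \<open>w\<close>
  represents, because it is unchanged by each relation; so half-spaces exist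
  before anything is known about reduced words, and everything about lengths is derived from them.
\<close>

fun sep :: "'a list \<Rightarrow> 'a list \<Rightarrow> bool" where
  "sep [] r = False"
| "sep (s # w) r = (([s] \<approx> r) \<noteq> sep w ([s] @ r @ [s]))"

lemma sep_cong_wall: "r \<approx> r' \<Longrightarrow> sep w r = sep w r'"
proof (induction w arbitrary: r r')
  case (Cons s w)
  have "[s] @ r @ [s] \<approx> [s] @ r' @ [s]" using Cons.prems by (intro app_left app_right)
  then show ?case using Cons.IH Cons.prems weq_equal_right
    by (metis sep.simps(2))
qed simp

lemma sep_append: "sep (u @ v) r = (sep u r \<noteq> sep v (rev u @ r @ u))"
  by (induction u arbitrary: r) auto

lemma sep_cong: "u \<approx> v \<Longrightarrow> sep u r = sep v r"
proof (induction arbitrary: r rule: weq.induct)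
  case (app u u' v v')
  have "rev u @ r @ u \<approx> rev u' @ r @ u'" using app.hyps by (intro conj_weq') auto
  then show ?case using app.IH sep_append sep_cong_wall by metis
next
  case (square s)
  have "[s] \<approx> s # r @ [s] \<longleftrightarrow> [s] \<approx> r"
    using conj_move [of "[s]" r "[s]"] square_Cons[of s "[s]"] 
    by (simp) (metis trans sym)
  then show ?case by simp
next
  case (comm s t)
  have *: "[a] \<approx> b # r @ [b] \<longleftrightarrow> [a] \<approx> r" if "adj a b" for a b
  proof -
    have "[b, a, b] \<approx> [a]"
      using that adj_sym comm Cons_weq square_Cons by (metis trans weq.comm)
    then show ?thesis using conj_move [of "[b]" r "[a]"]
      by simp (metis trans sym)
  qed
  have "sep [s,t] r = (([s] \<approx> r) \<noteq> ([t] \<approx> r))" using * [of t s] comm adj_sym by simp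
  moreover have "sep [t,s] r = (([t] \<approx> r) \<noteq> ([s] \<approx> r))" using * [of s t] comm by simp
  ultimately show ?case by blast
qed auto

lemma sep_rev: "sep (rev u) r = sep u (u @ r @ rev u)"
proof -
  have "\<not> sep (u @ rev u) (u @ r @ rev u)" using sep_cong [OF append_rev] by simp
  then have "sep u (u @ r @ rev u) = sep (rev u) (rev u @ (u @ r @ rev u) @ u)"
    using sep_append by blast
  also have "\<dots> = sep (rev u) r" by (rule sep_cong_wall [OF conj_conj])
  finally show ?thesis by simp
qed

lemma sep_translate: "sep (u @ v) (u @ r @ rev u) = (sep (rev u) r \<noteq> sep v r)"
  using sep_append [of u v "u @ r @ rev u"] sep_rev sep_cong_wall [OF conj_conj] by metis

lemma sep_split:
  assumes "sep w r" obtains u s v where "w = u @ s # v" "r \<approx> u @ [s] @ rev u"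
  using assms
proof (induction w arbitrary: r thesis)
  case (Cons s w)
  show ?case
  proof (cases "[s] \<approx> r")
    case True
    then show ?thesis using Cons.prems(1) [of "[]" s w] sym by simp
  next
    case False
    then have "sep w ([s] @ r @ [s])" using Cons.prems by simp
    then obtain u t v where w: "w = u @ t # v" and r: "[s] @ r @ [s] \<approx> u @ [t] @ rev u"
      using Cons.IH by blast
    have "r \<approx> [s] @ (u @ [t] @ rev u) @ [s]" using r conj_move [of "[s]"] by simp
    then show ?thesis using Cons.prems(1) [of "s # u" t v] w by simp
  qed
qed simp

text \<open>
  The exchange condition: multiplying by a reflection whose wall is crossed deletes the letter at
  which the crossing happens.
\<close>

lemma sep_exchange:
  assumes "sep w r" obtains w' where "r @ w \<approx> w'" "length w = Suc (length w')"
proof -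
  obtain u s v where w: "w = u @ s # v" and r: "r \<approx> u @ [s] @ rev u" using sep_split assms by metis
  have "r @ w \<approx> (u @ [s] @ rev u) @ w" by (rule app_right [OF r])
  also have "\<dots> \<approx> (u @ [s]) @ [s] @ v" 
    unfolding w using app_left [OF rev_cancel [of u "s # v"], of "u @ [s]"] by simp
  also have "\<dots> \<approx> u @ v" by (simp add: app_left square_Cons)
  finally show ?thesis using that [of "u @ v"] w by simp
qed

lemma sep_self: "sep (u @ [s]) (u @ [s] @ rev u) \<noteq> sep u (u @ [s] @ rev u)"
  using sep_append[of u "[s]"] sep_cong_wall [OF conj_conj, of "[s]" u "[s]"] by auto

lemma sep_snoc: "sep (u @ [s]) r = (sep u r \<noteq> (u @ [s] @ rev u \<approx> r))"
  using sep_append[of u "[s]" r] conj_move[of u "[s]" r] by simp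

definition reduced :: "'a list \<Rightarrow> bool" where
  "reduced w \<longleftrightarrow> (\<forall>v. v \<approx> w \<longrightarrow> length w \<le> length v)"

definition wlen :: "'a list \<Rightarrow> nat" where
  "wlen w = (LEAST n. \<exists>v. v \<approx> w \<and> length v = n)"

lemma ex_reduced: obtains v where "v \<approx> w" "reduced v"  "length v = wlen w"
proof -
  have "\<exists>v. v \<approx> w \<and> length v = wlen w"
    unfolding wlen_def by (rule LeastI [of _ "length w"]) auto
  then obtain v where v: "v \<approx> w" "length v = wlen w" by blast
  moreover have "reduced v" unfolding reduced_def v wlen_def
    by (metis (mono_tags, lifting) Least_le trans v(1))
  ultimately show ?thesis using that by blast
qed

lemma wlen_cong: "u \<approx> v \<Longrightarrow> wlen u = wlen v"
  unfolding wlen_def using weq_equal_right by metis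

lemma wlen_le: "wlen w \<le> length w"
  unfolding wlen_def by (rule Least_le) auto

lemma reduced_wlen: "reduced w \<longleftrightarrow> wlen w = length w"
  by (metis ex_reduced le_antisym reduced_def refl wlen_cong wlen_le)

lemma reduced_weq_length: "reduced u \<Longrightarrow> reduced v \<Longrightarrow> u \<approx> v \<Longrightarrow> length u = length v"
  by (metis reduced_wlen wlen_cong)

lemma reduced_appD:
  assumes "reduced (u @ v)" shows "reduced u" "reduced v"
proof -
  show "reduced u" unfolding reduced_def
  proof (intro allI impI)
    fix x assume "x \<approx> u"
    then have "length (u @ v) \<le> length (x @ v)" using assms app_right reduced_def by blast
    then show "length u \<le> length x" by simp
  qed
  show "reduced v" unfolding reduced_def
  proof (intro allI impI)
    fix x assume "x \<approx> v"
    then have "length (u @ v) \<le> length (u @ x)" using assms app_left reduced_def by blast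
    then show "length v \<le> length x" by simp
  qed
qed

lemma sep_Cons_self: "sep (s # v) [s] = (\<not> sep v [s])"
  using sep_cong_wall [OF square_Cons [of s "[s]"]] by simp

lemma reduced_ConsD:
  assumes "reduced (s # w)" shows "reduced w" "\<not> sep w [s]"
proof -
  show "reduced w" using assms reduced_appD(2) [of "[s]" w] by simp
  show "\<not> sep w [s]"
  proof
    assume "sep w [s]"
    then obtain w' where "[s] @ w \<approx> w'" "length w = Suc (length w')" by (rule sep_exchange)
    then show False using assms unfolding reduced_def using sym by fastforce
  qed
qed

text \<open>
  If \<open>s w\<close> could be shortened, then by parity by at least two letters, so a shortest \<open>v\<close> for
  \<open>s w\<close> would make \<open>s v\<close> a reduced word for \<open>w\<close> that starts with \<open>s\<close>.
\<close>

lemma reduced_Cons: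
  "reduced (s # w) \<longleftrightarrow> reduced w \<and> \<not> sep w [s]"
proof (intro iffI)
  assume r: "reduced w \<and> \<not> sep w [s]"
  show "reduced (s # w)"
  proof (rule ccontr)
    assume nr: "\<not> reduced (s # w)"
    obtain v where v: "v \<approx> s # w" "reduced v"  "length v = wlen (s # w)" by (rule ex_reduced)
    have "length v < Suc (length w)" using nr v wlen_le [of "s # w"] reduced_wlen by (simp add: le_less)
    moreover have "even (length v) = even (Suc (length w))" using length_parity [OF v(1)] by simp
    ultimately have lv: "length v < length w" by (metis even_Suc less_SucE)
    have sv: "s # v \<approx> w" using v(1) Cons_move sym by blast
    then have "length w \<le> length (s # v)" using r reduced_def by blast
    then have "wlen w = length (s # v)" using lv r reduced_wlen by fastforce
    then have "reduced (s # v)" using wlen_cong [OF sv] reduced_wlen by simp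
    then have "\<not> sep v [s]" by (rule reduced_ConsD)
    moreover have "sep (s # v) [s] = sep w [s]" by (rule sep_cong [OF sv])
    ultimately show False using r sep_Cons_self by blast
  qed
qed (blast dest: reduced_ConsD)

lemma first_letter:
  assumes "sep w [s]" obtains v where "w \<approx> s # v" "length w = Suc (length v)"
  by (metis Cons_move append_Cons append_Nil assms sep_exchange)

text \<open>
  A geodesic crosses no wall twice: exchanging at both crossings would delete two letters.
\<close>

lemma reduced_prefix_sep:
  assumes "reduced (u @ v)" "sep u r" shows "sep (u @ v) r"
proof (rule ccontr)
  assume n: "\<not> sep (u @ v) r"
  then have "sep v (rev u @ r @ u)" using assms sep_append by blast
  then obtain v' where v': "(rev u @ r @ u) @ v \<approx> v'" "length v = Suc (length v')" by (rule sep_exchange)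
  obtain x s y where u: "u = x @ s # y" and r: "r \<approx> x @ [s] @ rev x" using sep_split assms by metis
  have rr: "r @ r \<approx> []"
  proof -
    have "r @ r \<approx> (x @ [s] @ rev x) @ rev (x @ [s] @ rev x)" using app [OF r r] by simp
    also have "\<dots> \<approx> []" by (rule append_rev)
    finally show ?thesis .
  qed
  obtain u' where u': "r @ u \<approx> u'" "length u = Suc (length u')" using assms sep_exchange by blast
  have "u @ v \<approx> (r @ r) @ u @ v" using app_right [OF rr, of "u @ v"] sym by simp
  also have "(r @ r) @ u @ v \<approx> r @ u @ rev u @ r @ u @ v"
    using app_left [OF cancel_rev [of u "r @ u @ v"], of r] sym by simp
  also have "r @ u @ rev u @ r @ u @ v \<approx> u' @ v'" using app [OF u'(1) v'(1)] by simp
  finally have "length (u @ v) \<le> length (u' @ v')" using assms(1) reduced_def sym by blast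
  then show False using u' v' by simp
qed

section \<open>First letters and centralizers\<close>

text \<open>
  Alternating words and the action of two non-adjacent generators \<open>s\<close>, \<open>t\<close> on the integers as the
  reflections in \<open>0\<close> and \<open>1/2\<close> (all other generators acting trivially) show that the subgroup
  generated by \<open>s\<close> and \<open>t\<close> is infinite dihedral.
\<close>

fun alternating :: "nat \<Rightarrow> 'a \<Rightarrow> 'a \<Rightarrow> 'a list" where
  "alternating 0 s t = []"
| "alternating (Suc n) s t = s # alternating n t s"

definition dihedral_letter :: "'a \<Rightarrow> 'a \<Rightarrow> 'a \<Rightarrow> int \<Rightarrow> int" where
  "dihedral_letter s t a = (if a = s then (\<lambda>x. - x) else if a = t then (\<lambda>x. 1 - x) else id)"

definition dihedral :: "'a \<Rightarrow> 'a \<Rightarrow> 'a list \<Rightarrow> int \<Rightarrow> int" where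
  "dihedral s t w = foldr (\<lambda>a f. dihedral_letter s t a \<circ> f) w id"

lemma dihedral_simps [simp]:
  "dihedral s t [] = id"
  "dihedral s t (a # w) = dihedral_letter s t a \<circ> dihedral s t w"
  by (simp_all add: dihedral_def)

lemma dihedral_append: "dihedral s t (u @ v) = dihedral s t u \<circ> dihedral s t v"
  by (induction u) (auto simp: comp_assoc)

lemma dihedral_cong:
  assumes "u \<approx> v" "\<not> adj s t" shows "dihedral s t u = dihedral s t v"
  using assms
proof (induction rule: weq.induct)
  case (comm a b)
  then show ?case using adj_sym adj_irrefl by (auto simp: dihedral_letter_def fun_eq_iff)
qed (auto simp: dihedral_append dihedral_letter_def fun_eq_iff)

text \<open>
  The reflections crossed by an alternating word that starts with \<open>s\<close> have their centres on one
  side of the centre of \<open>t\<close>, and conversely. The number \<open>k\<close> is twice the centre; both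
  statements are needed at once because the recursion exchanges \<open>s\<close> and \<open>t\<close>.
\<close>

lemma alternating_not_sep:
  assumes "s \<noteq> t" "\<not> adj s t" "dihedral s t r = (\<lambda>x. k - x)"
  shows "(k \<ge> 1 \<longrightarrow> \<not> sep (alternating n s t) r) \<and> (k \<le> 0 \<longrightarrow> \<not> sep (alternating n t s) r)"
  using assms(3)
proof (induction n arbitrary: r k)
  case (Suc n)
  have ds: "dihedral s t ([s] @ r @ [s]) = (\<lambda>x. - k - x)"
    using Suc.prems by (simp add: dihedral_append dihedral_letter_def fun_eq_iff)
  have dt: "dihedral s t ([t] @ r @ [t]) = (\<lambda>x. (2 - k) - x)"
    using Suc.prems assms(1) by (simp add: dihedral_append dihedral_letter_def fun_eq_iff)
  have "\<not> [s] \<approx> r" if "k \<ge> 1"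
  proof
    assume "[s] \<approx> r"
    then have "(\<lambda>x. - x) = (\<lambda>x. k - x)" using dihedral_cong [OF _ assms(2)] Suc.prems
      by (fastforce simp: dihedral_letter_def)
    then show False using fun_cong [of _ _ 0] that by fastforce
  qed
  moreover have "\<not> [t] \<approx> r" if "k \<le> 0"
  proof
    assume "[t] \<approx> r"
    then have "(\<lambda>x. 1 - x) = (\<lambda>x. k - x)" using dihedral_cong [OF _ assms(2)] Suc.prems assms(1)
      by (fastforce simp: dihedral_letter_def)
    then show False using fun_cong [of _ _ 0] that by fastforce
  qed
  ultimately show ?case using Suc.IH [OF ds] Suc.IH [OF dt] by auto
qed simp

text \<open>
  If \<open>s\<close> and \<open>t\<close> are not adjacent, then the exchange condition, applied alternately to \<open>s\<close> and \<open>t\<close>,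
  pulls longer and longer alternating words to the front of \<open>g\<close>: the letter that is deleted never
  lies in the alternating prefix. This is impossible once the prefix is longer than \<open>g\<close>.
\<close>

lemma first_letters_adj:
  assumes "sep g [s]" "sep g [t]" "s \<noteq> t" shows "adj s t"
proof (rule ccontr)
  assume na: "\<not> adj s t"
  then have na': "\<not> adj t s" using adj_sym by blast
  have ns: "\<not> sep (alternating n t s) [s]" for n
    using alternating_not_sep [OF assms(3) na, of "[s]" 0 n] by (simp add: dihedral_letter_def)
  have nt: "\<not> sep (alternating n s t) [t]" for n
    using alternating_not_sep [OF assms(3) na, of "[t]" 1 n] assms(3) by (simp add: dihedral_letter_def)
  have step: "\<exists>u'. g \<approx> (a # alt) @ u' \<and> length u = Suc (length u')"
    if g: "g \<approx> alt @ u" and "sep g [a]" "\<not> sep alt [a]" for alt u a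
  proof -
    have "sep u (rev alt @ [a] @ alt)" using that sep_cong [OF g] sep_append by blast
    then obtain u' where u': "(rev alt @ [a] @ alt) @ u \<approx> u'" "length u = Suc (length u')" by (rule sep_exchange)
    have "[a] @ g \<approx> [a] @ alt @ u" by (rule app_left [OF g])
    also have "\<dots> \<approx> alt @ (rev alt @ [a] @ alt) @ u"
      using cancel_rev [of alt "[a] @ alt @ u"] sym by simp
    also have "\<dots> \<approx> alt @ u'" by (rule app_left [OF u'(1)])
    finally have "g \<approx> (a # alt) @ u'" using Cons_move sym by (metis append_Cons append_Nil)
    then show ?thesis using u' by blast
  qed
  have "(\<exists>u. g \<approx> alternating n s t @ u \<and> length u + n = length g) \<and>
        (\<exists>u. g \<approx> alternating n t s @ u \<and> length u + n = length g)" for n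
  proof (induction n)
    case (Suc n)
    obtain u where u: "g \<approx> alternating n s t @ u" "length u + n = length g" using Suc by blast
    obtain v where v: "g \<approx> alternating n t s @ v" "length v + n = length g" using Suc by blast
    show ?case using step [OF u(1) assms(2) nt] step [OF v(1) assms(1) ns] u(2) v(2) by fastforce
  qed auto
  from this [of "Suc (length g)"] show False by auto
qed

lemma letters_commute_iff: "[s, t] \<approx> [t, s] \<longleftrightarrow> s = t \<or> adj s t"
proof
  assume eq: "[s, t] \<approx> [t, s]"
  show "s = t \<or> adj s t"
  proof (rule ccontr)
    assume n: "\<not> (s = t \<or> adj s t)"
    then have "dihedral s t [s,t] 0 = dihedral s t [t,s] 0" using dihedral_cong [OF eq] by simp
    then show False using n by (auto simp: dihedral_letter_def)
  qed
qed (auto intro: comm)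

lemma commute_Cons:
  assumes "(s # v) @ r \<approx> r @ s # v" "s # r \<approx> r @ [s]"
  shows "v @ r \<approx> r @ v"
proof -
  have "s # v @ r \<approx> (r @ [s]) @ v" using assms(1) by simp
  also have "\<dots> \<approx> (s # r) @ v" by (rule app_right [OF sym [OF assms(2)]])
  finally show ?thesis using Cons_cancel by simp
qed

text \<open>
  If the reduced word \<open>v\<close> does not start with \<open>t\<close>, then \<open>t v = v t\<close> starts both with \<open>t\<close> and with the
  first letter of \<open>v\<close>, so these two letters are adjacent; remove that letter and continue.
\<close>

lemma centralizer_letter:
  assumes "v @ [t] \<approx> t # v"
  obtains c where "c \<approx> v" "\<forall>a \<in> set c. a = t \<or> adj a t"
  using assms
proof (induction "length v" arbitrary: v thesis rule: less_induct)
  case less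
  obtain v' where v': "v' \<approx> v" "reduced v'" "length v' = wlen v" by (rule ex_reduced)
  then have len: "length v' \<le> length v" using wlen_le by simp
  have comm': "v' @ [t] \<approx> t # v'"
    using less.prems(2) v'(1) app_right Cons_weq by (meson sym trans)
  show ?case
  proof (cases v')
    case Nil
    then show ?thesis using less.prems(1) [of "[]"] v'(1) by simp
  next
    case (Cons c v1)
    have "c = t \<or> adj c t"
    proof (cases "sep v' [t]")
      case True
      moreover have "sep v' [c]" using v'(2) Cons reduced_ConsD sep_Cons_self by blast
      ultimately show ?thesis using first_letters_adj by blast
    next
      case False
      then have r: "reduced (t # v')" using v'(2) reduced_Cons by simp
      then have "reduced (v' @ [t])"
        using reduced_wlen wlen_cong [OF comm'] by simp
      then have "sep (v' @ [t]) [c]" using Cons reduced_ConsD sep_Cons_self by (metis append_Cons)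
      then have "sep (t # v') [c]" using sep_cong [OF comm'] by simp
      moreover have "sep (t # v') [t]" using False sep_Cons_self by blast
      ultimately show ?thesis using first_letters_adj by blast
    qed
    then have ct: "[c, t] \<approx> [t, c]" using letters_commute_iff by blast
    have "v1 @ [t] \<approx> t # v1" using commute_Cons [of c v1 "[t]"] comm' ct Cons by simp
    then obtain d where "d \<approx> v1" "\<forall>a \<in> set d. a = t \<or> adj a t"
      using less.hyps [of v1] len Cons by auto
    then show ?thesis using less.prems(1) [of "c # d"] \<open>c = t \<or> adj c t\<close> v'(1) Cons
      by (metis Cons_weq trans set_ConsD)
  qed
qed

lemma commute_word: 
  assumes "\<forall>a \<in> set c. a = t \<or> adj a t" shows "c @ [t] \<approx> t # c"
  using assms
proof (induction c)
  case (Cons a c)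
  have "(a # c) @ [t] \<approx> a # t # c" using Cons Cons_weq by simp
  also have "a # t # c \<approx> t # a # c"
    using Cons app_right [of "[a,t]" "[t,a]" c] letters_commute_iff [of a t] by simp
  finally show ?case .
qed simp

section \<open>Crossing walls\<close>

definition reflection :: "'a list \<Rightarrow> bool" where
  "reflection r \<longleftrightarrow> (\<exists>u s. r \<approx> u @ [s] @ rev u)"

lemma sep_reflection: "sep w r \<Longrightarrow> reflection r"
  unfolding reflection_def using sep_split by metis

text \<open>
  Half-spaces are convex: a geodesic from \<open>a\<close> to \<open>b\<close> stays on the side of the wall of \<open>q\<close> on which
  both of its ends lie, and somewhere it crosses the wall of \<open>r\<close>.
\<close>

lemma sep_diff_edge:
  assumes "sep a r \<noteq> sep b r" "sep a q = sep b q"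
  obtains h t where "r \<approx> h @ [t] @ rev h" "sep h q = sep a q"
proof -
  obtain w where w: "w \<approx> rev a @ b" "reduced w" by (rule ex_reduced)
  have aw: "a @ w \<approx> b" using w(1) move_left by simp
  then have "sep a r \<noteq> sep (a @ w) r" using assms sep_cong by blast
  then have "sep w (rev a @ r @ a)" using sep_append by blast
  then obtain u t v where w': "w = u @ t # v" and r: "rev a @ r @ a \<approx> u @ [t] @ rev u" 
    by (rule sep_split)
  have "r \<approx> (a @ u) @ [t] @ rev (a @ u)"
    using r conj_move [of "rev a" r] by simp
  moreover have "sep (a @ u) q = sep a q"
  proof (rule ccontr)
    assume "sep (a @ u) q \<noteq> sep a q"
    then have "sep u (rev a @ q @ a)" using sep_append by blast
    then have "sep w (rev a @ q @ a)" using reduced_prefix_sep w(2) w' by blast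
    then have "sep (a @ w) q \<noteq> sep a q" using sep_append by blast
    then show False using aw assms(2) sep_cong by blast
  qed
  ultimately show ?thesis using that by blast
qed

text \<open>
  The wall of \<open>r\<close> has an edge on either side of the wall of \<open>q\<close>. Both edges have the same label \<open>t\<close>,
  so the element leading from one to the other centralizes \<open>t\<close> and is a product of letters that
  commute with \<open>t\<close>. The path that it spells follows the wall of \<open>r\<close> and crosses the wall of \<open>q\<close> at
  some letter \<open>s\<close>; at that place \<open>r\<close> and \<open>q\<close> are the reflections in \<open>t\<close> and \<open>s\<close>, which commute.
\<close>

lemma crossing_commute:
  assumes "\<not> sep a r" "\<not> sep a q" "\<not> sep b r" "sep b q"
    "sep c r" "\<not> sep c q" "sep d r" "sep d q"
  shows "r @ q \<approx> q @ r"
proof -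
  obtain h t where h: "r \<approx> h @ [t] @ rev h" "sep h q = sep a q"
    using assms sep_diff_edge [of a r c q] by blast
  obtain h' t' where h': "r \<approx> h' @ [t'] @ rev h'" "sep h' q = sep b q"
    using assms sep_diff_edge [of b r d q] by blast
  have hh: "h @ [t] @ rev h \<approx> h' @ [t'] @ rev h'" using h h' sym trans by blast
  then have [simp]: "t' = t" using conj_letter by metis
  have "[t] @ rev h \<approx> (rev h @ h' @ [t]) @ rev h'" using hh move_left by simp
  then have "([t] @ rev h) @ h' \<approx> rev h @ h' @ [t]" using move_right [of "[t] @ rev h" "h'"] by simp
  then have "(rev h @ h') @ [t] \<approx> t # rev h @ h'" by (simp add: weq_commute)
  then obtain c where c: "c \<approx> rev h @ h'" "\<forall>a \<in> set c. a = t \<or> adj a t" by (rule centralizer_letter)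
  have "h @ c \<approx> h'" using c(1) move_left by simp
  then have "sep h q \<noteq> sep (h @ c) q" using h h' assms sep_cong by metis
  then have "sep c (rev h @ q @ h)" using sep_append by blast
  then obtain u s v where c': "c = u @ s # v" and q: "rev h @ q @ h \<approx> u @ [s] @ rev u" by (rule sep_split)
  define k where "k = h @ u"
  have q': "q \<approx> k @ [s] @ rev k" using q conj_move [of "rev h" q] by (simp add: k_def)
  have "[t] @ u \<approx> u @ [t]" using commute_word [of u t] c(2) c' sym by simp
  then have "[t] \<approx> u @ [t] @ rev u" using move_right [of "[t]" u "u @ [t]"] by simp
  then have "h @ [t] @ rev h \<approx> h @ (u @ [t] @ rev u) @ rev h" by (intro app_left app_right)
  with h(1) have r': "r \<approx> k @ [t] @ rev k" unfolding k_def by (simp) (rule trans)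
  have st: "[t, s] \<approx> [s, t]" using c(2) c' letters_commute_iff adj_sym by auto
  have prod: "x @ y \<approx> k @ [a, b] @ rev k" if "x \<approx> k @ [a] @ rev k" "y \<approx> k @ [b] @ rev k" for x y a b
  proof -
    have "x @ y \<approx> (k @ [a] @ rev k) @ k @ [b] @ rev k" using app that by blast
    also have "\<dots> \<approx> (k @ [a]) @ [b] @ rev k" using app_left [OF rev_cancel, of "k @ [a]" k] by simp
    finally show ?thesis by simp
  qed
  have "r @ q \<approx> k @ [t, s] @ rev k" by (rule prod [OF r' q'])
  also have "\<dots> \<approx> k @ [s, t] @ rev k" by (rule app_left [OF app_right [OF st]])
  also have "\<dots> \<approx> q @ r" by (rule sym [OF prod [OF q' r']])
  finally show ?thesis .
qed

text \<open>
  Take an edge of the wall of \<open>r\<close> that is closest to \<open>1\<close>, and the first letter \<open>t\<close> of a geodesic to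
  it. If \<open>r\<close> and \<open>t\<close> commuted, reflecting that edge in \<open>t\<close> would bring it closer. So the two walls
  do not cross, and the half-space beyond \<open>r\<close> lies in the one beyond \<open>t\<close>.
\<close>

lemma simple_wall_below:
  assumes "reflection r"
  obtains t where "\<And>g. sep g r \<Longrightarrow> sep g [t]"
proof -
  let ?P = "\<lambda>n. \<exists>g s. r \<approx> g @ [s] @ rev g \<and> length g = n"
  have "\<exists>n. ?P n" using assms unfolding reflection_def by blast
  then have "?P (LEAST n. ?P n)" by (rule LeastI_ex)
  then obtain g s where r: "r \<approx> g @ [s] @ rev g" and lg: "length g = (LEAST n. ?P n)" by blast
  have min: "length g \<le> length h" if "r \<approx> h @ [a] @ rev h" for h a
    unfolding lg using that by (intro Least_le) blast
  have red: "reduced g" unfolding reduced_def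
  proof (intro allI impI)
    fix h assume "h \<approx> g"
    then have "r \<approx> h @ [s] @ rev h" using conj_weq r by (meson refl sym trans)
    then show "length g \<le> length h" by (rule min)
  qed
  show ?thesis
  proof (cases g)
    case Nil
    then show ?thesis using that r sep_cong_wall by fastforce
  next
    case (Cons t g')
    have nr: "\<not> sep g r"
    proof
      assume "sep g r"
      then obtain h where h: "r @ g \<approx> h" "length g = Suc (length h)" by (rule sep_exchange)
      have "h \<approx> (g @ [s] @ rev g) @ g" using h(1) app_right [OF r, of g] sym trans by blast
      also have "\<dots> \<approx> g @ [s]" using app_left [OF rev_append_self[of g], of "g @ [s]"] by simp
      finally have "h @ [s] @ rev h \<approx> (g @ [s]) @ [s] @ rev (g @ [s])" by (intro conj_weq) auto
      also have "\<dots> \<approx> g @ [s] @ rev g"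
        using app_left [OF square_Cons[of s "[s] @ rev g"], of g] by simp
      finally have "r \<approx> h @ [s] @ rev h" using r sym trans by blast
      then show False using min [of h s] h(2) by simp
    qed
    have nc: "\<not> [t] @ r \<approx> r @ [t]"
    proof
      assume "[t] @ r \<approx> r @ [t]"
      then have "r \<approx> [t] @ r @ [t]" using Cons_move [of t r] by simp
      also have "\<dots> \<approx> [t] @ ([t] @ (g' @ [s] @ rev g') @ [t]) @ [t]"
        using r Cons by (intro app_left app_right) simp
      also have "\<dots> \<approx> g' @ [s] @ rev g'" using conj_conj [of "[t]" "g' @ [s] @ rev g'"] by simp
      finally have "length g \<le> length g'" by (rule min)
      then show False using Cons by simp
    qed
    have tr: "\<not> [t] \<approx> r"
    proof
      assume "[t] \<approx> r"
      then have "[t] @ r \<approx> [t] @ [t]" "r @ [t] \<approx> [t] @ [t]"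
        using app_left [OF sym, of "[t]" r "[t]"] app_right [OF sym, of "[t]" r "[t]"] by blast+
      then show False using nc sym trans by blast
    qed
    have gt: "sep g [t]" using red Cons reduced_ConsD sep_Cons_self by blast
    have gsr: "sep (g @ [s]) r" using nr r sep_snoc sym by blast
    have "\<not> g @ [s] @ rev g \<approx> [t]" using tr weq_equal_left [OF r] weq_commute by blast
    then have gst: "sep (g @ [s]) [t]" using gt sep_snoc [of g s "[t]"] by blast
    have "sep h [t]" if "sep h r" for h
    proof (rule ccontr)
      assume "\<not> sep h [t]"
      then have "[t] @ r \<approx> r @ [t]"
        using crossing_commute [of "[]" "[t]" r h "[t]" "g @ [s]"] that tr gst gsr by simp
      then show False using nc by simp
    qed
    then show ?thesis using that by blast
  qed
qed

section \<open>Walls separating four points\<close>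

lemma sep_Cons_conj: "sep (k # y) ([k] @ q @ [k]) = (([k] \<approx> q) \<noteq> sep y q)"
  using sep_translate [of "[k]" y q] by simp

lemma reflection_conj: "reflection r \<Longrightarrow> reflection (u @ r @ rev u)"
  unfolding reflection_def
proof (elim exE)
  fix v s assume "r \<approx> v @ [s] @ rev v"
  then have "u @ r @ rev u \<approx> u @ (v @ [s] @ rev v) @ rev u" by (intro app_left app_right)
  then have "u @ r @ rev u \<approx> (u @ v) @ [s] @ rev (u @ v)" by simp
  then show "\<exists>w s. u @ r @ rev u \<approx> w @ [s] @ rev w" by blast
qed

lemma commute_conj_letter:
  assumes "[t] @ ([s] @ [k] @ [s]) \<approx> ([s] @ [k] @ [s]) @ [t]" "adj s t"
  shows "t = k \<or> adj t k"
proof -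
  have st: "[s, t] \<approx> [t, s]" using assms(2) by (rule comm)
  have "[s] @ [t, k] @ [s] \<approx> [t, s] @ [k, s]" using app_right [OF st, of "[k,s]"] by simp
  also have "\<dots> \<approx> [s, k] @ [s, t]" using assms(1) by simp
  also have "\<dots> \<approx> [s] @ [k, t] @ [s]" using app_left [OF st, of "[s,k]"] by simp
  finally have "[t, k] \<approx> [k, t]" using left_cancel right_cancel by blast
  then show ?thesis using letters_commute_iff by blast
qed

text \<open>
  The core of hyperbolicity. Call a wall of type \<open>Q\<close> if it separates \<open>{1, z}\<close> from \<open>{y, w}\<close>, and of
  type \<open>R\<close> if it separates \<open>{1, w}\<close> from \<open>{y, z}\<close>. Every wall of type \<open>Q\<close> crosses every wall of
  type \<open>R\<close>. After moving the base point as close as possible to the other three points, the walls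
  of both types nearest to it belong to generators \<open>s\<close> and \<open>t\<close>. Looking from \<open>s\<close>, a second wall of type
  \<open>Q\<close> yields one of the form \<open>s k s\<close>; as there are no triangles, \<open>k\<close> is not adjacent to \<open>s\<close>. In the same
  way there is a wall \<open>t m t\<close> of type \<open>R\<close>. Since all these walls cross, \<open>s, t, k, m\<close> is a
  closed path of length four in the graph.
\<close>

lemma no_two_by_two_grid:
  assumes no_triangle: "\<And>a b c. adj a b \<Longrightarrow> adj b c \<Longrightarrow> adj c a \<Longrightarrow> False"
    and no_square: "\<And>a b c d. adj a b \<Longrightarrow> adj b c \<Longrightarrow> adj c d \<Longrightarrow> adj d a \<Longrightarrow> a = c \<or> b = d"
    and Q: "sep y q1" "\<not> sep z q1" "sep w q1" "sep y q2" "\<not> sep z q2" "sep w q2" "\<not> q1 \<approx> q2"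
    and R: "sep y r1" "sep z r1" "\<not> sep w r1" "sep y r2" "sep z r2" "\<not> sep w r2" "\<not> r1 \<approx> r2"
  shows False
  using Q R
proof (induction "length y + length z + length w" arbitrary: y z w q1 q2 r1 r2 rule: less_induct)
  case less
  show ?case
  proof (cases "\<exists>k. sep y [k] \<and> sep z [k] \<and> sep w [k]")
    case True
    then obtain k where k: "sep y [k]" "sep z [k]" "sep w [k]" by blast
    obtain y' where y': "y \<approx> k # y'" "length y = Suc (length y')" using k first_letter by blast
    obtain z' where z': "z \<approx> k # z'" "length z = Suc (length z')" using k first_letter by blast
    obtain w' where w': "w \<approx> k # w'" "length w = Suc (length w')" using k first_letter by blast
    have base: "sep v' ([k] @ q @ [k]) = sep v q" if "v \<approx> k # v'" "\<not> [k] \<approx> q" for v v' q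
    proof -
      have "v' \<approx> k # v" using that(1) Cons_move sym by blast
      then show ?thesis using sep_Cons_conj [of k v q] that(2) sep_cong by blast
    qed
    have nk: "\<not> [k] \<approx> q1" "\<not> [k] \<approx> q2" "\<not> [k] \<approx> r1" "\<not> [k] \<approx> r2"
      using k less.prems sep_cong_wall by blast+
    have ne: "\<not> [k] @ q1 @ [k] \<approx> [k] @ q2 @ [k]" "\<not> [k] @ r1 @ [k] \<approx> [k] @ r2 @ [k]"
      using less.prems conj_cancel [of "[k]"] by auto
    note b = base [OF y'(1)] base [OF z'(1)] base [OF w'(1)]
    have "length y' + length z' + length w' < length y + length z + length w"
      using y'(2) z'(2) w'(2) by simp
    then show False
    proof (rule less.hyps)
      show "sep y' ([k] @ q1 @ [k])" "\<not> sep z' ([k] @ q1 @ [k])" "sep w' ([k] @ q1 @ [k])"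
        "sep y' ([k] @ q2 @ [k])" "\<not> sep z' ([k] @ q2 @ [k])" "sep w' ([k] @ q2 @ [k])"
        using b(1-3) [OF nk(1)] b(1-3) [OF nk(2)] less.prems by blast+
      show "sep y' ([k] @ r1 @ [k])" "sep z' ([k] @ r1 @ [k])" "\<not> sep w' ([k] @ r1 @ [k])"
        "sep y' ([k] @ r2 @ [k])" "sep z' ([k] @ r2 @ [k])" "\<not> sep w' ([k] @ r2 @ [k])"
        using b(1-3) [OF nk(3)] b(1-3) [OF nk(4)] less.prems by blast+
    qed (rule ne)+
  next
    case False
    have cross: "r @ q \<approx> q @ r"
      if "sep y q" "\<not> sep z q" "sep w q" "sep y r" "sep z r" "\<not> sep w r" for q r
      using crossing_commute [of "[]" r q w z y] that by simp
    have second: "\<exists>s k. sep y [s] \<and> \<not> sep z [s] \<and> sep w [s] \<and> \<not> adj k s \<and> k \<noteq> s \<and>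
        sep y ([s] @ [k] @ [s]) \<and> \<not> sep z ([s] @ [k] @ [s]) \<and> sep w ([s] @ [k] @ [s])"
      if q: "sep y q1" "\<not> sep z q1" "sep w q1" "sep y q2" "\<not> sep z q2" "sep w q2" "\<not> q1 \<approx> q2"
        and r: "sep y r" "sep z r" "\<not> sep w r"
        and no: "\<not> (\<exists>k. sep y [k] \<and> sep z [k] \<and> sep w [k])"
        and cr: "\<And>q r. sep y q \<Longrightarrow> \<not> sep z q \<Longrightarrow> sep w q \<Longrightarrow> sep y r \<Longrightarrow> sep z r \<Longrightarrow> \<not> sep w r \<Longrightarrow> r @ q \<approx> q @ r"
      for y z w q1 q2 r
    proof -
      obtain s where s: "\<And>g. sep g q1 \<Longrightarrow> sep g [s]" using simple_wall_below sep_reflection q(1) by blast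
      have sQ: "sep y [s]" "sep w [s]" "\<not> sep z [s]" using s q no by blast+
      obtain t where t: "\<And>g. sep g r \<Longrightarrow> sep g [t]" using simple_wall_below sep_reflection r(1) by blast
      have tR: "sep y [t]" "sep z [t]" "\<not> sep w [t]" using t r no by blast+
      \<comment> \<open>one of the two walls differs from that of \<open>s\<close>; from the base point \<open>s\<close> it lies beyond a letter \<open>k\<close>\<close>
      obtain q where qq: "sep y q" "\<not> sep z q" "sep w q" "\<not> [s] \<approx> q"
        using q by (metis sym trans)
      obtain k where k: "\<And>g. sep g ([s] @ q @ [s]) \<Longrightarrow> sep g [k]"
        using simple_wall_below reflection_conj [of q "[s]"] sep_reflection [OF qq(1)] by auto
      have k': "sep (s # g) [k]" if "sep g q" for g using k sep_Cons_conj [of s g q] that qq by blast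
      have ks: "k \<noteq> s" using k' [OF qq(1)] sep_Cons_self [of s y] sQ by blast
      have sepk: "sep (s # g) [k] = sep g ([s] @ [k] @ [s])" for g
        using ks letter_eq by auto
      have ky: "sep y ([s] @ [k] @ [s])" "sep w ([s] @ [k] @ [s])" using k' qq sepk by blast+
      have nkQ: False if "sep y [k]" "\<not> sep z [k]" "sep w [k]" "adj k s"
      proof -
        have "adj k t" using cr [of "[k]" "[t]"] that tR letters_commute_iff [of k t] 
          by (metis append_Cons append_Nil weq_commute)
        moreover have "adj s t" using cr [of "[s]" "[t]"] sQ tR letters_commute_iff [of s t]
          by (metis append_Cons append_Nil weq_commute)
        ultimately show False using no_triangle that adj_sym by blast
      qed
      have adjD: "sep g ([s] @ [k] @ [s]) = sep g [k]" if "adj k s" for g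
      proof -
        have "[s, k] \<approx> [k, s]" using that comm adj_sym by blast
        then have "[s] @ [k] @ [s] \<approx> [k]" using move_right [of "[s,k]" "[s]" "[k]"] by simp
        then show ?thesis by (rule sep_cong_wall)
      qed
      \<comment> \<open>otherwise \<open>s k s\<close> and \<open>s\<close> cross, and \<open>k\<close> separates the base point from all three points\<close>
      have nz: "\<not> sep z ([s] @ [k] @ [s])"
      proof
        assume z: "sep z ([s] @ [k] @ [s])"
        have "\<not> [s] \<approx> [s] @ [k] @ [s]" using conj_cancel [of "[s]" "[s]" "[k]"] ks letter_eq [of s k]
            square_Cons [of s "[s]"] weq_equal_left by fastforce
        then have "[s] @ ([s] @ [k] @ [s]) \<approx> ([s] @ [k] @ [s]) @ [s]"
          using crossing_commute [of "[]" "[s]" "[s] @ [k] @ [s]" z "[s]" y] z sQ ky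
          by (simp)
        then have "[k] @ [s] \<approx> [s] @ [k]"
          using weq_equal_left [OF square_Cons] weq_equal_right [OF app_left [OF square [of s], of "[s,k]"]]
          by simp
        then have "adj k s" using letters_commute_iff ks by simp
        then show False using adjD z ky no by blast
      qed
      have "\<not> adj k s" using nkQ adjD nz ky by blast
      then show ?thesis using sQ ks ky nz by blast
    qed
    obtain s k where s: "sep y [s]" "\<not> sep z [s]" "sep w [s]" "\<not> adj k s" "k \<noteq> s"
      "sep y ([s] @ [k] @ [s])" "\<not> sep z ([s] @ [k] @ [s])" "sep w ([s] @ [k] @ [s])"
      using second [of y q1 z w q2 r1] less.prems False cross by blast
    obtain t m where t: "sep y [t]" "sep z [t]" "\<not> sep w [t]" "\<not> adj m t" "m \<noteq> t"
      "sep y ([t] @ [m] @ [t])" "sep z ([t] @ [m] @ [t])" "\<not> sep w ([t] @ [m] @ [t])"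
      using second [of y r1 w z r2 q1] less.prems False cross sym by blast
    have "adj t s \<or> t = s" using cross [of "[s]" "[t]"] s t letters_commute_iff [of t s] by auto
    then have ts: "adj t s" "adj s t" using s t adj_sym by blast+
    have "t = k \<or> adj t k" using commute_conj_letter cross s t ts by blast
    then have tk: "adj t k" using ts s by blast
    have "s = m \<or> adj s m" using commute_conj_letter cross s t ts sym by blast
    then have sm: "adj m s" using ts t adj_sym by blast
    have km: "[s] @ ([t] @ [m] @ [t]) @ [s] \<approx> [t] @ [m] @ [t]"
    proof -
      have "[s] @ ([t] @ [m] @ [t]) \<approx> ([t] @ [m] @ [t]) @ [s]" using cross s t sym by blast
      then show ?thesis using move_right [of "[s] @ ([t] @ [m] @ [t])" "[s]" "[t] @ [m] @ [t]"] by simp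
    qed
    have c1: "([t] @ [m] @ [t]) @ ([s] @ [k] @ [s]) \<approx> ([s] @ [k] @ [s]) @ ([t] @ [m] @ [t])"
      using cross s t by blast
    have "[k] @ ([t] @ [m] @ [t]) \<approx> ([t] @ [m] @ [t]) @ [k]"
    proof -
      let ?u = "[t] @ [m] @ [t]"
      have us: "?u @ [s] \<approx> [s] @ ?u" using cross s t by blast
      have "[s] @ (?u @ [k]) @ [s] \<approx> (?u @ [s]) @ [k] @ [s]" using app_right [OF sym [OF us], of "[k] @ [s]"] by simp
      also have "\<dots> \<approx> ([s] @ [k]) @ [s] @ ?u" using c1 by simp
      also have "\<dots> \<approx> ([s] @ [k]) @ ?u @ [s]" by (rule app_left [OF sym [OF us]])
      finally have "[s] @ (?u @ [k]) @ [s] \<approx> [s] @ ([k] @ ?u) @ [s]" by simp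
      then show ?thesis using left_cancel right_cancel sym by blast
    qed
    then have "k = m \<or> adj k m" using commute_conj_letter tk by blast
    moreover have "k \<noteq> m" using s sm by blast
    ultimately have "adj k m" by blast
    then show False using no_square [of s t k m] ts tk sm s t adj_sym by blast
  qed
qed

text \<open>
  Walls are represented by the classes of words representing the reflection.
\<close>

definition separating :: "'a list \<Rightarrow> 'a list \<Rightarrow> 'a list set set" where
  "separating u v = {{r'. r' \<approx> r} | r. sep u r \<noteq> sep v r}"

lemma weq_class_eq: "{r'. r' \<approx> r} = {r'. r' \<approx> q} \<longleftrightarrow> r \<approx> q"
  using weq_equal_right by blast

lemma in_separating: "{r'. r' \<approx> r} \<in> separating u v \<longleftrightarrow> sep u r \<noteq> sep v r"
  unfolding separating_def using weq_class_eq sep_cong_wall by auto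

lemma separating_cong: "v \<approx> v' \<Longrightarrow> separating u v = separating u v'"
  unfolding separating_def using sep_cong by blast

lemma card_separating_reduced:
  assumes "reduced w"
  shows "finite (separating u (u @ w)) \<and> card (separating u (u @ w)) = length w"
  using assms
proof (induction w rule: rev_induct)
  case Nil
  then show ?case by (simp add: separating_def)
next
  case (snoc s w)
  let ?R = "(u @ w) @ [s] @ rev (u @ w)"
  have sepR: "sep (u @ w @ [s]) r = (sep (u @ w) r \<noteq> (?R \<approx> r))" for r
    using sep_snoc [of "u @ w" s r] by simp
  have "\<not> sep w (w @ [s] @ rev w)"
    using reduced_prefix_sep [OF snoc.prems] sep_self by blast
  moreover have "rev u @ ?R @ u \<approx> w @ [s] @ rev w" using conj_conj [of u "w @ [s] @ rev w"] by simp
  ultimately have R: "sep u ?R = sep (u @ w) ?R" using sep_append sep_cong_wall by blast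
  have "separating u (u @ w @ [s]) = insert {r'. r' \<approx> ?R} (separating u (u @ w))"
  proof (rule Set.set_eqI)
    fix c
    show "c \<in> separating u (u @ w @ [s]) \<longleftrightarrow> c \<in> insert {r'. r' \<approx> ?R} (separating u (u @ w))"
    proof (cases "\<exists>r. c = {r'. r' \<approx> r}")
      case True
      then obtain r where c: "c = {r'. r' \<approx> r}" by blast
      show ?thesis
      proof (cases "?R \<approx> r")
        case True
        then have "sep u r = sep (u @ w) r" using R sep_cong_wall by blast
        then show ?thesis using True sepR [of r] unfolding c in_separating insert_iff weq_class_eq
          by (simp add: weq_commute)
      next
        case False
        then show ?thesis using sepR [of r] unfolding c in_separating insert_iff weq_class_eq
          by (simp add: weq_commute)
      qed
    next
      case False
      then show ?thesis unfolding separating_def by blast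
    qed
  qed
  moreover have "{r'. r' \<approx> ?R} \<notin> separating u (u @ w)" using R in_separating by blast
  ultimately show ?case using snoc.IH reduced_appD(1) [OF snoc.prems] by simp
qed

lemma card_separating: "finite (separating u v)" "card (separating u v) = wlen (rev u @ v)"
proof -
  obtain w where w: "w \<approx> rev u @ v" "reduced w"  "length w = wlen (rev u @ v)" by (rule ex_reduced)
  have "u @ w \<approx> v" using w(1) move_left by simp
  then show "finite (separating u v)" "card (separating u v) = wlen (rev u @ v)"
    using card_separating_reduced [OF w(2), of u] separating_cong w(3) by auto
qed

definition wdist :: "'a list \<Rightarrow> 'a list \<Rightarrow> nat" where
  "wdist u v = wlen (rev u @ v)"

definition pair_separating :: "'a list \<Rightarrow> 'a list \<Rightarrow> 'a list \<Rightarrow> 'a list \<Rightarrow> 'a list set set" where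
  "pair_separating x z y w = {{r'. r' \<approx> r} | r. sep x r = sep z r \<and> sep y r = sep w r \<and> sep x r \<noteq> sep y r}"

text \<open>
  Counting walls: one that contributes more to the left side than to the two distances on the right
  must separate \<open>{x, z}\<close> from \<open>{y, w}\<close>, and then the excess is two.
\<close>

lemma four_point_pair_separating:
  "wdist x y + wdist z w \<le> wdist x z + wdist y w + 2 * card (pair_separating x z y w)"
proof -
  define U where "U = separating x y \<union> separating z w \<union> separating x z \<union> separating y w"
  have fin: "finite U" unfolding U_def using card_separating(1) by blast
  have c: "wdist u v = (\<Sum>c\<in>U. if c \<in> separating u v then 1 else 0)" if "separating u v \<subseteq> U" for u v
    unfolding wdist_def card_separating(2) [symmetric] using fin that
    by (simp add: sum.If_cases Int_absorb1)
  have sub: "separating x y \<subseteq> U" "separating z w \<subseteq> U" "separating x z \<subseteq> U" "separating y w \<subseteq> U"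
    unfolding U_def by blast+
  have qU: "pair_separating x z y w \<subseteq> U" unfolding pair_separating_def U_def separating_def by blast
  have cq: "card (pair_separating x z y w) = (\<Sum>c\<in>U. if c \<in> pair_separating x z y w then 1 else 0)"
    using fin qU by (simp add: sum.If_cases Int_absorb1)
  have inq: "{r'. r' \<approx> r} \<in> pair_separating x z y w \<longleftrightarrow> sep x r = sep z r \<and> sep y r = sep w r \<and> sep x r \<noteq> sep y r" for r
    unfolding pair_separating_def using weq_class_eq sep_cong_wall by auto
  have "wdist x y + wdist z w =
     (\<Sum>c\<in>U. (if c \<in> separating x y then 1 else 0) + (if c \<in> separating z w then 1 else 0))"
    by (simp add: c sub sum.distrib)
  also have "\<dots> \<le> (\<Sum>c\<in>U. (if c \<in> separating x z then 1 else 0) + (if c \<in> separating y w then 1 else 0)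
      + 2 * (if c \<in> pair_separating x z y w then 1 else 0))"
  proof (rule sum_mono)
    fix c assume "c \<in> U"
    then obtain r where r: "c = {r'. r' \<approx> r}" unfolding U_def separating_def by blast
    show "(if c \<in> separating x y then 1 else 0) + (if c \<in> separating z w then 1 else 0)
      \<le> (if c \<in> separating x z then 1 else 0) + (if c \<in> separating y w then 1 else 0)
      + 2 * (if c \<in> pair_separating x z y w then 1 else (0::nat))"
      unfolding r in_separating inq by auto
  qed
  also have "\<dots> = wdist x z + wdist y w + 2 * card (pair_separating x z y w)"
    by (simp add: c sub cq sum.distrib sum_distrib_left)
  finally show ?thesis .
qed

lemma finite_pair_separating: "finite (pair_separating x z y w)"
  by (rule finite_subset [OF _ card_separating(1) [of x y]]) (auto simp: pair_separating_def separating_def)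

lemma pair_separating_small:
  assumes no_triangle: "\<And>a b c. adj a b \<Longrightarrow> adj b c \<Longrightarrow> adj c a \<Longrightarrow> False"
    and no_square: "\<And>a b c d. adj a b \<Longrightarrow> adj b c \<Longrightarrow> adj c d \<Longrightarrow> adj d a \<Longrightarrow> a = c \<or> b = d"
  shows "card (pair_separating x z y w) \<le> 1 \<or> card (pair_separating x w y z) \<le> 1"
proof (rule ccontr)
  assume "\<not> ?thesis"
  then have c: "\<not> card (pair_separating x z y w) \<le> 1" "\<not> card (pair_separating x w y z) \<le> 1" by auto
  have two: "\<exists>q1 q2. \<not> q1 \<approx> q2 \<and> sep x q1 = sep z q1 \<and> sep y q1 = sep w q1 \<and> sep x q1 \<noteq> sep y q1
    \<and> sep x q2 = sep z q2 \<and> sep y q2 = sep w q2 \<and> sep x q2 \<noteq> sep y q2"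
    if "\<not> card (pair_separating x z y w) \<le> 1" for x z y w
  proof -
    have "\<exists>c1 \<in> pair_separating x z y w. \<exists>c2 \<in> pair_separating x z y w. c1 \<noteq> c2"
      using that card_le_Suc0_iff_eq [OF finite_pair_separating] by auto
    then show ?thesis unfolding pair_separating_def using weq_class_eq by auto
  qed
  have tr: "sep (rev x @ v) (rev x @ r @ x) = (sep x r \<noteq> sep v r)" for v r
    using sep_translate [of "rev x" v r] by simp
  have ne: "\<not> rev x @ q1 @ x \<approx> rev x @ q2 @ x" if "\<not> q1 \<approx> q2" for q1 q2
    using that conj_cancel [of "rev x"] by simp
  obtain q1 q2 where q: "\<not> q1 \<approx> q2" "sep x q1 = sep z q1" "sep y q1 = sep w q1" "sep x q1 \<noteq> sep y q1"
    "sep x q2 = sep z q2" "sep y q2 = sep w q2" "sep x q2 \<noteq> sep y q2" using two [OF c(1)] by blast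
  obtain r1 r2 where r: "\<not> r1 \<approx> r2" "sep x r1 = sep w r1" "sep y r1 = sep z r1" "sep x r1 \<noteq> sep y r1"
    "sep x r2 = sep w r2" "sep y r2 = sep z r2" "sep x r2 \<noteq> sep y r2" using two [OF c(2)] by blast
  show False
  proof (rule no_two_by_two_grid [OF no_triangle no_square])
    show "\<not> rev x @ q1 @ x \<approx> rev x @ q2 @ x" "\<not> rev x @ r1 @ x \<approx> rev x @ r2 @ x"
      using ne q(1) r(1) by blast+
    show "sep (rev x @ y) (rev x @ q1 @ x)" "\<not> sep (rev x @ z) (rev x @ q1 @ x)"
      "sep (rev x @ w) (rev x @ q1 @ x)" "sep (rev x @ y) (rev x @ q2 @ x)"
      "\<not> sep (rev x @ z) (rev x @ q2 @ x)" "sep (rev x @ w) (rev x @ q2 @ x)"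
      unfolding tr using q by blast+
    show "sep (rev x @ y) (rev x @ r1 @ x)" "sep (rev x @ z) (rev x @ r1 @ x)"
      "\<not> sep (rev x @ w) (rev x @ r1 @ x)" "sep (rev x @ y) (rev x @ r2 @ x)"
      "sep (rev x @ z) (rev x @ r2 @ x)" "\<not> sep (rev x @ w) (rev x @ r2 @ x)"
      unfolding tr using r by blast+
  qed
qed

lemma wdist_commute: "wdist u v = wdist v u"
proof -
  have "separating u v = separating v u" unfolding separating_def by blast
  then show ?thesis unfolding wdist_def card_separating(2) [symmetric] by simp
qed

text \<open>
  The first sum of distances exceeds either of the others by at most twice the number of walls of one
  of two types, and one of these numbers is at most one.
\<close>

lemma four_point:
  assumes "\<And>a b c. adj a b \<Longrightarrow> adj b c \<Longrightarrow> adj c a \<Longrightarrow> False"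
    and "\<And>a b c d. adj a b \<Longrightarrow> adj b c \<Longrightarrow> adj c d \<Longrightarrow> adj d a \<Longrightarrow> a = c \<or> b = d"
  shows "wdist x y + wdist z w \<le> max (wdist x z + wdist y w) (wdist x w + wdist y z) + 2"
proof -
  have "wdist x y + wdist z w \<le> wdist x z + wdist y w + 2 * card (pair_separating x z y w)"
    by (rule four_point_pair_separating)
  moreover have "wdist x y + wdist w z \<le> wdist x w + wdist y z + 2 * card (pair_separating x w y z)"
    by (rule four_point_pair_separating)
  moreover have "card (pair_separating x z y w) \<le> 1 \<or> card (pair_separating x w y z) \<le> 1"
    by (rule pair_separating_small [OF assms])
  ultimately show ?thesis using wdist_commute [of z w] by linarith
qed

section \<open>Reduction of words\<close>

text \<open>
  Tits' solution of the word problem: a reduced word can be reached from every equivalent word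
  without ever lengthening it.
\<close>

inductive shortening_step :: "'a list \<Rightarrow> 'a list \<Rightarrow> bool" where
  swap: "adj s t \<Longrightarrow> shortening_step (u @ [s, t] @ v) (u @ [t, s] @ v)"
| delete: "shortening_step (u @ [s, s] @ v) (u @ v)"

lemma shortening_step_Cons: "shortening_step u v \<Longrightarrow> shortening_step (c # u) (c # v)"
  by (induction rule: shortening_step.induct) (metis append_Cons shortening_step.intros)+

lemma shortening_steps_Cons: "shortening_step\<^sup>*\<^sup>* u v \<Longrightarrow> shortening_step\<^sup>*\<^sup>* (c # u) (c # v)"
  by (induction rule: rtranclp_induct) (auto intro: rtranclp.rtrancl_into_rtrancl shortening_step_Cons)

lemma shortening_step_weq: "shortening_step u v \<Longrightarrow> u \<approx> v"
proof (induction rule: shortening_step.induct)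
  case (swap s t u v)
  then show ?case by (intro app_left app_right comm)
next
  case (delete u s v)
  have "[s, s] @ v \<approx> [] @ v" by (rule app_right [OF square])
  then show ?case by (simp add: app_left)
qed

lemma shortening_steps_weq: "shortening_step\<^sup>*\<^sup>* u v \<Longrightarrow> u \<approx> v"
  by (induction rule: rtranclp_induct) (auto dest: shortening_step_weq intro: trans)

lemma shortening_steps_length: "shortening_step\<^sup>*\<^sup>* u v \<Longrightarrow> length v \<le> length u"
  by (induction rule: rtranclp_induct) (auto elim!: shortening_step.cases)

lemma shortening_steps_first:
  assumes "reduced u" "sep u [s]" obtains u' where "shortening_step\<^sup>*\<^sup>* u (s # u')"
  using assms
proof (induction u arbitrary: thesis)
  case (Cons c u)
  show ?case
  proof (cases "c = s")
    case True
    then show ?thesis using Cons.prems(1) by blast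
  next
    case False
    have "sep (c # u) [c]" using Cons.prems(2) reduced_ConsD sep_Cons_self by blast
    then have cs: "adj c s" using Cons.prems(3) first_letters_adj False by blast
    have "[c] @ [s] @ [c] \<approx> [s]" using comm [OF cs] move_right [of "[c,s]" "[c]" "[s]"] by simp
    then have "sep u ([c] @ [s] @ [c]) = sep u [s]" by (rule sep_cong_wall)
    then have "sep u [s]" using Cons.prems(3) False letter_eq by simp
    then obtain u' where "shortening_step\<^sup>*\<^sup>* u (s # u')"
      using Cons.IH Cons.prems(2) reduced_ConsD by blast
    then have "shortening_step\<^sup>*\<^sup>* (c # u) (c # s # u')" by (rule shortening_steps_Cons)
    moreover have "shortening_step (c # s # u') (s # c # u')" using swap [OF cs, of "[]"] by simp
    ultimately show ?thesis using Cons.prems(1) by (meson rtranclp.rtrancl_into_rtrancl)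
  qed
qed simp

lemma shortening_steps_to_reduced: "\<exists>v. reduced v \<and> shortening_step\<^sup>*\<^sup>* u v"
proof (induction "length u" arbitrary: u rule: less_induct)
  case less
  show ?case
  proof (cases u)
    case Nil
    then show ?thesis by (intro exI [of _ "[]"]) (auto simp: reduced_def)
  next
    case (Cons c u1)
    then obtain v where v: "reduced v" "shortening_step\<^sup>*\<^sup>* u1 v" using less by fastforce
    show ?thesis
    proof (cases "sep v [c]")
      case False
      then show ?thesis using v reduced_Cons shortening_steps_Cons Cons by blast
    next
      case True
      then obtain v' where v': "shortening_step\<^sup>*\<^sup>* v (c # v')" using shortening_steps_first v by blast
      then have "shortening_step\<^sup>*\<^sup>* u (c # c # v')" using v shortening_steps_Cons Cons by (meson rtranclp_trans)
      moreover have "shortening_step (c # c # v') v'" using delete [of "[]"] by simp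
      ultimately have uv: "shortening_step\<^sup>*\<^sup>* u v'" by (meson rtranclp.rtrancl_into_rtrancl)
      have "length v' < length u" using shortening_steps_length [OF v'] shortening_steps_length [OF v(2)] Cons by simp
      then show ?thesis using less uv by (meson rtranclp_trans)
    qed
  qed
qed

lemma shortening_steps_reduced_unique:
  assumes "reduced u" "reduced w" "u \<approx> w" shows "shortening_step\<^sup>*\<^sup>* u w"
  using assms
proof (induction w arbitrary: u)
  case Nil
  then show ?case using reduced_weq_length by fastforce
next
  case (Cons s w)
  have "sep u [s]" using sep_cong [OF Cons.prems(3)] Cons.prems(2) reduced_ConsD sep_Cons_self by blast
  then obtain u' where u': "shortening_step\<^sup>*\<^sup>* u (s # u')" using shortening_steps_first Cons.prems by blast
  have su: "u \<approx> s # u'" using shortening_steps_weq u' by blast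
  have "wlen (s # u') = length u" using Cons.prems(1) su reduced_wlen wlen_cong by fastforce
  then have "reduced (s # u')" using shortening_steps_length [OF u'] wlen_le [of "s # u'"] reduced_wlen by simp
  moreover have "u' \<approx> w" using su Cons.prems(3) Cons_cancel sym trans by blast
  ultimately have "shortening_step\<^sup>*\<^sup>* u' w" using Cons.IH Cons.prems(2) reduced_ConsD by blast
  then show ?case using u' shortening_steps_Cons by (meson rtranclp_trans)
qed

theorem shortening_steps_reduced:
  assumes "u \<approx> w" "reduced w" shows "shortening_step\<^sup>*\<^sup>* u w"
proof -
  obtain v where v: "reduced v" "shortening_step\<^sup>*\<^sup>* u v" using shortening_steps_to_reduced by blast
  then have "v \<approx> w" using shortening_steps_weq assms sym trans by blast
  then show ?thesis using shortening_steps_reduced_unique v assms by (meson rtranclp_trans)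
qed

section \<open>Elements of finite order\<close>

definition wpow :: "'a list \<Rightarrow> nat \<Rightarrow> 'a list" where
  "wpow w n = concat (replicate n w)"

lemma wpow_simps [simp]: "wpow w 0 = []" "wpow w (Suc n) = w @ wpow w n"
  by (simp_all add: wpow_def)

lemma wpow_cong: "u \<approx> v \<Longrightarrow> wpow u n \<approx> wpow v n"
  by (induction n) (auto intro: app)

lemma wpow_conj: "wpow (u @ w @ rev u) n \<approx> u @ wpow w n @ rev u"
proof (induction n)
  case 0
  show ?case using append_rev sym by simp
next
  case (Suc n)
  have "wpow (u @ w @ rev u) (Suc n) \<approx> (u @ w @ rev u) @ (u @ wpow w n @ rev u)"
    using app_left [OF Suc, of "u @ w @ rev u"] by simp
  also have "\<dots> \<approx> (u @ w) @ wpow w n @ rev u"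
    using app_left [OF rev_cancel, of "u @ w" u "wpow w n @ rev u"] by simp
  finally show ?case by simp
qed

text \<open>
  The letter \<open>s\<close> commutes with all letters of the word, so its occurrences can be collected in front
  and cancelled in pairs.
\<close>

lemma star_word:
  assumes "\<forall>a \<in> set c. a = s \<or> adj a s"
  shows "c \<approx> (if even (length (filter (\<lambda>a. a = s) c)) then [] else [s]) @ filter (\<lambda>a. a \<noteq> s) c"
  using assms
proof (induction c)
  case (Cons a c)
  let ?p = "\<lambda>c. if even (length (filter (\<lambda>a. a = s) c)) then [] else [s]"
  let ?f = "filter (\<lambda>a. a \<noteq> s)"
  have IH: "a # c \<approx> a # ?p c @ ?f c" using Cons by (intro Cons_weq) auto
  show ?case
  proof (cases "a = s")
    case True
    have "a # ?p c @ ?f c \<approx> ?p (a # c) @ ?f (a # c)" using square_Cons True by auto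
    with IH show ?thesis by (rule trans)
  next
    case False
    then have "[a, s] \<approx> [s, a]" using Cons.prems letters_commute_iff by auto
    then have "a # ?p c @ ?f c \<approx> ?p (a # c) @ ?f (a # c)"
      using app_right [of "[a, s]" "[s, a]" "?f c"] False by auto
    with IH show ?thesis by (rule trans)
  qed
qed simp

text \<open>
  A conjugate \<open>r\<close> of \<open>s\<close> that commutes with \<open>s\<close> is a product of letters equal or adjacent to \<open>s\<close>.
  Deleting the letter \<open>s\<close> is a homomorphism that kills \<open>r\<close>, so only the occurrences of \<open>s\<close> matter, and
  their number is odd.
\<close>

lemma commuting_same_label:
  assumes "r \<approx> v @ [s] @ rev v" "r @ [s] \<approx> [s] @ r" shows "r \<approx> [s]"
proof -
  obtain c where c: "c \<approx> r" "\<forall>a \<in> set c. a = s \<or> adj a s"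
    using centralizer_letter [of r s] assms(2) by auto
  have cv: "c \<approx> v @ [s] @ rev v" using c(1) assms(1) trans by blast
  have "filter (\<lambda>a. a \<noteq> s) c \<approx> filter (\<lambda>a. a \<noteq> s) v @ rev (filter (\<lambda>a. a \<noteq> s) v)"
    using filter_weq [OF cv, of "\<lambda>a. a \<noteq> s"] by (simp add: rev_filter)
  also have "\<dots> \<approx> []" by (rule append_rev)
  finally have f: "filter (\<lambda>a. a \<noteq> s) c \<approx> []" .
  have "odd (length (filter (\<lambda>a. a = s) c))"
    using count_parity [OF cv, of "\<lambda>a. a = s"] by (simp add: rev_filter [symmetric])
  then have "c \<approx> [s] @ filter (\<lambda>a. a \<noteq> s) c" using star_word [OF c(2)] by simp
  also have "\<dots> \<approx> [s] @ []" by (rule app_left [OF f])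
  finally show ?thesis using weq_equal_left [OF c(1)] by simp
qed

text \<open>
  The walls of \<open>s\<close> and of \<open>v s v\<^sup>-\<^sup>1\<close> have the same label, so they do not cross, and \<open>v\<close> maps the
  half-space beyond \<open>s\<close> into itself. Hence no power of \<open>v\<close> returns to \<open>1\<close>.
\<close>

lemma skewered_infinite_order:
  assumes "sep v [s]" "\<not> sep (rev v) [s]" "n > 0" shows "\<not> wpow v n \<approx> []"
proof -
  define r where "r = v @ [s] @ rev v"
  have nvr: "\<not> sep v r" using assms(2) sep_rev r_def by simp
  have nr: "\<not> r \<approx> [s]" using nvr assms(1) sep_cong_wall by blast
  then have nc: "\<not> [s] @ r \<approx> r @ [s]" using commuting_same_label [of r v s] r_def sym by blast
  have v1: "sep (v @ [s]) [s]" using sep_snoc [of v s "[s]"] assms(1) nr r_def by simp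
  have v2: "sep (v @ [s]) r" using sep_snoc [of v s r] nvr r_def by simp
  have nest: "sep h [s]" if "sep h r" for h
    using crossing_commute [of "[]" "[s]" r h v "v @ [s]"] that nvr nc v1 v2 assms(1) by auto
  have step: "sep (v @ h) [s]" if "sep h [s]" for h
    using nest [of "v @ h"] sep_translate [of v h "[s]"] that assms(2) r_def by simp
  have "sep (wpow v (Suc k)) [s]" for k
    by (induction k) (use assms(1) step in auto)
  then have "sep (wpow v n) [s]" using assms(3) gr0_implies_Suc by blast
  then show ?thesis using sep_cong by fastforce
qed

text \<open>
  Let \<open>v = s v'\<close> be reduced. By the previous lemma \<open>v\<close> can have finite order only if it also ends with
  \<open>s\<close>. Either \<open>s v s\<close> is shorter, or \<open>s\<close> commutes with \<open>v\<close>, so that all other letters are adjacent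
  to \<open>s\<close> and have a different colour; the number of letters \<open>s\<close> is then even, by the
  hypothesis on colours, and they cancel, contradicting that \<open>v\<close> starts with \<open>s\<close>.
\<close>

theorem torsion_trivial:
  fixes col :: "'a \<Rightarrow> 'c"
  assumes col: "\<And>a b. adj a b \<Longrightarrow> col a \<noteq> col b"
    and "wpow w n \<approx> []" "n > 0" "\<And>c. even (length (filter (\<lambda>a. col a = c) w))"
  shows "w \<approx> []"
  using assms(2-)
proof (induction "length w" arbitrary: w rule: less_induct)
  case less
  obtain v where v: "v \<approx> w" "reduced v" "length v = wlen w" by (rule ex_reduced)
  have lv: "length v \<le> length w" using v wlen_le by simp
  have pv: "wpow v n \<approx> []" using wpow_cong [OF v(1)] less.prems(1) trans by blast
  have ev: "even (length (filter (\<lambda>a. col a = c) v))" for c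
    using count_parity [OF v(1)] less.prems(3) by blast
  have "v \<approx> []"
  proof (cases v)
    case (Cons s v')
    define r where "r = v @ [s] @ rev v"
    have vs: "sep v [s]" using v(2) Cons reduced_ConsD sep_Cons_self by blast
    then have "sep (rev v) [s]" using skewered_infinite_order pv less.prems(2) by blast
    then have vr: "sep v r" using sep_rev r_def by simp
    show ?thesis
    proof (cases "r \<approx> [s]")
      case True
      then have "v @ [s] \<approx> [s] @ v" using move_right [of "v @ [s]" "rev v" "[s]"] by (simp add: r_def)
      then obtain c where c: "c \<approx> v" "\<forall>a \<in> set c. a = s \<or> adj a s"
        using centralizer_letter [of v s] by auto
      have "filter (\<lambda>a. col a = col s) c = filter (\<lambda>a. a = s) c"
        using c(2) col by (intro filter_cong) auto
      then have "even (length (filter (\<lambda>a. a = s) c))"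
        using count_parity [OF c(1), of "\<lambda>a. col a = col s"] ev by simp
      then have "c \<approx> filter (\<lambda>a. a \<noteq> s) c" using star_word [OF c(2)] by simp
      then have "sep (filter (\<lambda>a. a \<noteq> s) c) [s]" using vs c(1) sep_cong by blast
      then obtain x a y where xay: "filter (\<lambda>a. a \<noteq> s) c = x @ a # y" and "[s] \<approx> x @ [a] @ rev x"
        by (rule sep_split)
      then have "a = s" using conj_letter [of "[]" s x a] by simp
      moreover have "a \<in> set (filter (\<lambda>a. a \<noteq> s) c)" unfolding xay by simp
      ultimately show ?thesis by simp
    next
      case False
      then have "sep v' ([s] @ r @ [s])" using vr sym Cons by auto
      moreover have "[s] @ r @ [s] \<approx> v' @ [s] @ rev v'"
        using conj_conj [of "[s]" "v' @ [s] @ rev v'"] by (simp add: r_def Cons)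
      ultimately have "sep (rev v') [s]" using sep_rev sep_cong_wall by blast
      then obtain x where x: "rev v' \<approx> s # x" "length v' = Suc (length x)"
        using first_letter by (metis length_rev)
      have vx: "v \<approx> [s] @ rev x @ rev [s]" using rev_weq [OF x(1)] Cons_weq Cons by simp
      have "[s] @ wpow (rev x) n @ rev [s] \<approx> []"
        using wpow_conj wpow_cong [OF vx] pv sym trans by blast
      then have "wpow (rev x) n \<approx> [s, s]" using conj_move [of "[s]" "wpow (rev x) n" "[]"] by simp
      then have "wpow (rev x) n \<approx> []" using trans [OF _ square] by blast
      moreover have "even (length (filter (\<lambda>a. col a = c) (rev x)))" for c
        using count_parity [OF vx, of "\<lambda>a. col a = c"] ev [of c] by (auto split: if_splits)
      ultimately have "rev x \<approx> []" using less.hyps [of "rev x"] x(2) lv Cons less.prems(2) by simp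
      then have "[s] @ rev x @ rev [s] \<approx> [s] @ [] @ rev [s]" by (intro app_left app_right)
      from trans [OF vx this] show ?thesis using trans [OF _ square] by simp
    qed
  qed simp
  then show ?case using v(1) sym trans by blast
qed

end

text \<open>
  Sending each vertex to its colour induces a homomorphism from the group of words over the coloured
  graph to the group of words over the graph of colours.
\<close>

locale coloured_words = \<Gamma>: racg_words adj\<^sub>\<Gamma> + \<Delta>: racg_words adj\<^sub>\<Delta>
  for adj\<^sub>\<Gamma> :: "'a \<Rightarrow> 'a \<Rightarrow> bool" and adj\<^sub>\<Delta> :: "'b \<Rightarrow> 'b \<Rightarrow> bool" +
  fixes col :: "'b \<Rightarrow> 'a"
  assumes col_adj: "adj\<^sub>\<Delta> a b \<Longrightarrow> adj\<^sub>\<Gamma> (col a) (col b)"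
begin

lemma map_col_weq: "\<Delta>.weq u v \<Longrightarrow> \<Gamma>.weq (map col u) (map col v)"
  by (induction rule: \<Delta>.weq.induct)
    (auto intro: \<Gamma>.sym \<Gamma>.trans \<Gamma>.app \<Gamma>.square \<Gamma>.comm col_adj)

text \<open>
  An element that maps to \<open>1\<close> has an even number of letters of each colour.
\<close>

lemma kernel_torsion_free:
  assumes "\<Delta>.weq (\<Delta>.wpow w n) []" "n > 0" "\<Gamma>.weq (map col w) []"
  shows "\<Delta>.weq w []"
proof (rule \<Delta>.torsion_trivial [OF _ assms(1,2), of col])
  show "col a \<noteq> col b" if "adj\<^sub>\<Delta> a b" for a b using col_adj [OF that] \<Gamma>.adj_irrefl by metis
  show "even (length (filter (\<lambda>a. col a = c) w))" for c
    using \<Gamma>.count_parity [OF assms(3), of "\<lambda>a. a = c"] by (simp add: filter_map o_def)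
qed

lemma wlen_map_col_le: "\<Gamma>.wlen (map col w) \<le> \<Delta>.wlen w"
proof -
  obtain v where v: "\<Delta>.weq v w" "length v = \<Delta>.wlen w" using \<Delta>.ex_reduced by metis
  then show ?thesis using \<Gamma>.wlen_cong [OF map_col_weq [OF v(1)]] \<Gamma>.wlen_le [of "map col v"] by simp
qed

lemma lift_reduced: "\<Gamma>.reduced (map col w) \<Longrightarrow> \<Delta>.reduced w"
  using wlen_map_col_le [of w] \<Delta>.wlen_le [of w] by (simp add: \<Gamma>.reduced_wlen \<Delta>.reduced_wlen)

end

section \<open>The presented group and its Cayley graph\<close>

definition positive :: "'a list \<Rightarrow> 'a gword" where
  "positive w = map (\<lambda>s. (s, True)) w"

lemma positive_simps [simp]:
  "positive [] = []" "positive (s # w) = (s, True) # positive w"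
  "positive (u @ v) = positive u @ positive v" "map fst (positive w) = w"
  by (simp_all add: positive_def o_def)

lemma gwords_simps [simp]:
  "[] \<in> gwords S" "(x # w) \<in> gwords S \<longleftrightarrow> fst x \<in> S \<and> w \<in> gwords S"
  "u @ v \<in> gwords S \<longleftrightarrow> u \<in> gwords S \<and> v \<in> gwords S" 
  by (auto simp: gwords_def mem_Times_iff)

lemma positive_gwords [simp]: "positive w \<in> gwords S \<longleftrightarrow> w \<in> lists S"
  by (induction w) auto

locale racg_graph =
  fixes \<Gamma> :: "'a pair_pre_digraph"
  assumes graph: "pair_graph \<Gamma>"
begin

lemma arcD: "(s, t) \<in> parcs \<Gamma> \<Longrightarrow> s \<in> pverts \<Gamma> \<and> t \<in> pverts \<Gamma> \<and> s \<noteq> t \<and> (t, s) \<in> parcs \<Gamma>"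
proof -
  assume st: "(s, t) \<in> parcs \<Gamma>"
  interpret pair_graph \<Gamma> by (rule graph)
  show ?thesis using st arc_fst_in_verts [OF st] arc_snd_in_verts [OF st] pair_no_loops [OF st] 
      pair_sym_arcs by (auto simp: symmetric_def sym_def)
qed

sublocale racg_words "\<lambda>s t. (s, t) \<in> parcs \<Gamma>"
  by unfold_locales (use arcD in blast)+

notation weq (infix "\<approx>" 50)

abbreviation "V \<equiv> pverts \<Gamma>"
abbreviation "pe \<equiv> pres_eq (pverts \<Gamma>) (racg_relations \<Gamma>)"
abbreviation "G \<equiv> racg \<Gamma>"

lemma pe_gwords: "pe u v \<Longrightarrow> u \<in> gwords V \<and> v \<in> gwords V"
  by (induction rule: pres_eq.induct) auto

lemma pe_weq: "pe u v \<Longrightarrow> map fst u \<approx> map fst v"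
proof (induction rule: pres_eq.induct)
  case (relator u v)
  then show ?case unfolding racg_relations_def by (auto intro: square comm)
qed (auto intro: sym trans app square)

lemma pe_square: "s \<in> V \<Longrightarrow> pe [(s, True), (s, True)] []"
  by (rule pres_eq.relator) (auto simp: racg_relations_def)

text \<open>
  Since \<open>s\<^sup>2 = 1\<close>, the formal inverses of generators can be replaced by the generators.
\<close>

lemma pe_positive: "w \<in> gwords V \<Longrightarrow> pe w (positive (map fst w))"
proof (induction w)
  case Nil
  then show ?case by (simp add: pres_eq.refl)
next
  case (Cons x w)
  obtain s b where x: "x = (s, b)" by fastforce
  then have s: "s \<in> V" using Cons.prems by simp
  have "pe [(s, False)] [(s, True)]"
  proof -
    have r: "pe [(s, c)] [(s, c)]" for c using s by (intro pres_eq.refl) simp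
    have "pe ([(s, False)] @ []) ([(s, False)] @ [(s, True), (s, True)])"
      by (intro pres_eq.cong r pres_eq.sym [OF pe_square] s)
    moreover have "pe ([(s, False), (s, True)] @ [(s, True)]) ([] @ [(s, True)])"
      using pres_eq.cancel [of s V _ False] s by (intro pres_eq.cong r) auto
    ultimately show ?thesis using pres_eq.trans by fastforce
  qed
  then have "pe [x] [(s, True)]" using x s by (cases b) (auto intro: pres_eq.refl)
  then have "pe ([x] @ w) ([(s, True)] @ positive (map fst w))"
    using Cons by (intro pres_eq.cong) auto
  then show ?case using x by simp
qed

text \<open>
  The relation \<open>\<approx>\<close> admits words with letters outside the graph; deleting these letters retracts it
  onto the presentation.
\<close>

lemma weq_pe: "u \<approx> v \<Longrightarrow> pe (positive (filter (\<lambda>a. a \<in> V) u)) (positive (filter (\<lambda>a. a \<in> V) v))"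
proof (induction rule: weq.induct)
  case (refl w)
  show ?case by (rule pres_eq.refl) auto
next
  case (comm s t)
  have "([(s, True), (t, True)], [(t, True), (s, True)]) \<in> racg_relations \<Gamma>"
    using comm unfolding racg_relations_def by auto
  then show ?case using arcD [OF comm] by (auto intro: pres_eq.relator)
qed (auto intro: pres_eq.refl pres_eq.sym pres_eq.trans pres_eq.cong pe_square)

lemma weq_pe_iff:
  assumes "u \<in> lists V" "v \<in> lists V" shows "pe (positive u) (positive v) \<longleftrightarrow> u \<approx> v"
proof
  show "pe (positive u) (positive v) \<Longrightarrow> u \<approx> v" using pe_weq by fastforce
  have "filter (\<lambda>a. a \<in> V) u = u" "filter (\<lambda>a. a \<in> V) v = v" using assms by (auto simp: filter_id_conv)
  then show "u \<approx> v \<Longrightarrow> pe (positive u) (positive v)" using weq_pe [of u v] by simp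
qed

abbreviation "rw \<equiv> racg_word \<Gamma>"

lemma rw_def: "rw w = {v. pe (positive w) v}"
  unfolding racg_word_def pres_class_def positive_def ..

lemma class_eq_iff:
  assumes "u \<in> gwords V" shows "pres_class V (racg_relations \<Gamma>) u = pres_class V (racg_relations \<Gamma>) v \<longleftrightarrow> pe u v"
proof
  assume "pres_class V (racg_relations \<Gamma>) u = pres_class V (racg_relations \<Gamma>) v"
  moreover have "u \<in> pres_class V (racg_relations \<Gamma>) u"
    using assms by (simp add: pres_class_def pres_eq.refl)
  ultimately show "pe u v" using pres_eq.sym unfolding pres_class_def by blast
next
  assume "pe u v"
  then show "pres_class V (racg_relations \<Gamma>) u = pres_class V (racg_relations \<Gamma>) v"
    unfolding pres_class_def using pres_eq.sym pres_eq.trans by blast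
qed

lemma rw_eq_iff:
  assumes "u \<in> lists V" "v \<in> lists V" shows "rw u = rw v \<longleftrightarrow> u \<approx> v"
  using class_eq_iff [of "positive u" "positive v"] weq_pe_iff assms
  unfolding racg_word_def positive_def [symmetric] by simp

lemma carrier_racg: "carrier G = rw ` lists V"
proof -
  have "pres_class V (racg_relations \<Gamma>) w \<in> rw ` lists V" if "w \<in> gwords V" for w
  proof (rule image_eqI)
    show "pres_class V (racg_relations \<Gamma>) w = rw (map fst w)"
      unfolding racg_word_def positive_def [symmetric]
      using class_eq_iff [OF that] pe_positive [OF that] by blast
    show "map fst w \<in> lists V" using that by (fastforce simp: gwords_def)
  qed
  then show ?thesis unfolding racg_def presented_group_def racg_word_def positive_def [symmetric] by auto
qed

lemma rw_closed: "w \<in> lists V \<Longrightarrow> rw w \<in> carrier G"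
  using carrier_racg by blast

lemma rw_mult:
  assumes "u \<in> lists V" "v \<in> lists V" shows "rw u \<otimes>\<^bsub>G\<^esub> rw v = rw (u @ v)"
proof -
  have "rw u \<otimes>\<^bsub>G\<^esub> rw v = (\<Union>x\<in>rw u. \<Union>y\<in>rw v. pres_class V (racg_relations \<Gamma>) (x @ y))"
    by (simp add: racg_def presented_group_def)
  also have "\<dots> = rw (u @ v)"
  proof -
    have "pres_class V (racg_relations \<Gamma>) (x @ y) = rw (u @ v)" if "x \<in> rw u" "y \<in> rw v" for x y
    proof -
      have "pe (positive u @ positive v) (x @ y)" using that unfolding rw_def by (auto intro: pres_eq.cong)
      then show ?thesis unfolding racg_word_def positive_def [symmetric]
        using class_eq_iff pe_gwords by (metis positive_simps(3))
    qed
    moreover have "positive u \<in> rw u" "positive v \<in> rw v" unfolding rw_def using assms by (auto intro: pres_eq.refl)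
    ultimately show ?thesis by blast
  qed
  finally show ?thesis .
qed

lemma rw_one: "\<one>\<^bsub>G\<^esub> = rw []"
  by (simp add: racg_def presented_group_def racg_word_def)

lemma carrierE:
  assumes "x \<in> carrier G" obtains u where "x = rw u" "u \<in> lists V"
  using assms unfolding carrier_racg by blast

lemma group_racg: "group G"
proof (rule groupI)
  fix x y assume "x \<in> carrier G" "y \<in> carrier G"
  then obtain u v where "x = rw u" "u \<in> lists V" "y = rw v" "v \<in> lists V" by (elim carrierE)
  then show "x \<otimes>\<^bsub>G\<^esub> y \<in> carrier G" using rw_mult [of u v] rw_closed [of "u @ v"] by simp
next
  show "\<one>\<^bsub>G\<^esub> \<in> carrier G" unfolding rw_one by (rule rw_closed) simp
next
  fix x y z assume "x \<in> carrier G" "y \<in> carrier G" "z \<in> carrier G"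
  then show "x \<otimes>\<^bsub>G\<^esub> y \<otimes>\<^bsub>G\<^esub> z = x \<otimes>\<^bsub>G\<^esub> (y \<otimes>\<^bsub>G\<^esub> z)"
    by (elim carrierE) (simp add: rw_mult)
next
  fix x assume x: "x \<in> carrier G"
  then show "\<one>\<^bsub>G\<^esub> \<otimes>\<^bsub>G\<^esub> x = x"
    by (elim carrierE) (simp add: rw_mult rw_one)
  from x obtain u where u: "x = rw u" "u \<in> lists V" by (rule carrierE)
  have "rev u \<in> lists V" using u by auto
  moreover from this have "rw (rev u) \<otimes>\<^bsub>G\<^esub> x = \<one>\<^bsub>G\<^esub>"
    using u rw_mult [of "rev u" u] rw_eq_iff [of "rev u @ u" "[]"] rev_append_self [of u] rw_one by simp
  ultimately show "\<exists>y\<in>carrier G. y \<otimes>\<^bsub>G\<^esub> x = \<one>\<^bsub>G\<^esub>" using rw_closed by blast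
qed

sublocale racg: group "racg \<Gamma>" by (rule group_racg)

lemma rev_lists: "u \<in> lists V \<Longrightarrow> rev u \<in> lists V"
  by (auto simp: in_lists_conv_set)

lemma rw_inv: assumes "u \<in> lists V" shows "inv\<^bsub>G\<^esub> (rw u) = rw (rev u)"
proof (rule racg.inv_equality)
  show "rw (rev u) \<otimes>\<^bsub>G\<^esub> rw u = \<one>\<^bsub>G\<^esub>"
    using assms rev_lists rw_mult [of "rev u" u] rw_eq_iff [of "rev u @ u" "[]"] rev_append_self rw_one
    by simp
qed (use assms rev_lists rw_closed in auto)

lemma wpow_lists: "w \<in> lists V \<Longrightarrow> wpow w n \<in> lists V"
  by (induction n) auto

lemma rw_pow: assumes "w \<in> lists V" shows "rw w [^]\<^bsub>G\<^esub> n = rw (wpow w n)"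
proof (induction n)
  case (Suc n)
  have "rw w [^]\<^bsub>G\<^esub> Suc n = rw w \<otimes>\<^bsub>G\<^esub> rw w [^]\<^bsub>G\<^esub> n"
    by (rule racg.nat_pow_Suc2 [OF rw_closed [OF assms]])
  then show ?case using Suc rw_mult assms wpow_lists by simp
qed (simp add: rw_one)

lemma rw_generate: "w \<in> lists V \<Longrightarrow> rw w \<in> generate G (racg_gens \<Gamma>)"
proof (induction w)
  case Nil
  then show ?case using generate.one [of G] rw_one by simp
next
  case (Cons s w)
  then have "rw [s] \<in> racg_gens \<Gamma>" "rw w \<in> generate G (racg_gens \<Gamma>)" by (auto simp: racg_gens_def)
  then have "rw [s] \<otimes>\<^bsub>G\<^esub> rw w \<in> generate G (racg_gens \<Gamma>)"
    by (intro generate.eng [OF generate.incl])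
  then show ?case using rw_mult [of "[s]" w] Cons.prems by simp
qed

abbreviation "C \<equiv> cayley_graph G (racg_gens \<Gamma>)"

lemma cayley_arc_iff:
  assumes "u \<in> lists V" "v \<in> lists V"
  shows "(rw u, rw v) \<in> parcs C \<longleftrightarrow> (\<exists>s\<in>V. rw v = rw (u @ [s]))"
proof -
  define E where "E = {(g, g \<otimes>\<^bsub>G\<^esub> s) | g s. g \<in> carrier G \<and> s \<in> racg_gens \<Gamma>}"
  have E: "(rw u, rw v) \<in> E \<longleftrightarrow> (\<exists>s\<in>V. rw v = rw (u @ [s]))" if "u \<in> lists V" for u v
  proof -
    have "rw u \<otimes>\<^bsub>G\<^esub> rw [s] = rw (u @ [s])" if "s \<in> V" for s
      using that \<open>u \<in> lists V\<close> by (intro rw_mult) auto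
    then show ?thesis unfolding E_def racg_gens_def using rw_closed [OF that] by fastforce
  qed
  have "rw u = rw (v @ [s])" if "rw v = rw (u @ [s])" "s \<in> V" for s
  proof -
    have "v \<approx> u @ [s]" using that rw_eq_iff assms by simp
    then have "v @ [s] \<approx> u" using move_right [of v "[s]" u] by simp
    then show ?thesis using rw_eq_iff assms that sym by simp
  qed
  moreover have "rw v = rw (u @ [s])" if "rw u = rw (v @ [s])" "s \<in> V" for s
  proof -
    have "u \<approx> v @ [s]" using that rw_eq_iff assms by simp
    then have "u @ [s] \<approx> v" using move_right [of u "[s]" v] by simp
    then show ?thesis using rw_eq_iff assms that sym by simp
  qed
  moreover have "parcs C = E \<union> E\<inverse>" unfolding cayley_graph_def E_def Let_def by simp
  then have "(rw u, rw v) \<in> parcs C \<longleftrightarrow> (rw u, rw v) \<in> E \<or> (rw v, rw u) \<in> E" by simp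
  ultimately show ?thesis unfolding E [OF assms(1)] E [OF assms(2)] by metis
qed

lemma pverts_cayley: "pverts C = carrier G"
  by (simp add: cayley_graph_def)

lemma parcs_cayley_carrier: "(g, h) \<in> parcs C \<Longrightarrow> g \<in> carrier G \<and> h \<in> carrier G"
  unfolding cayley_graph_def Let_def racg_gens_def using rw_closed by (auto intro!: racg.m_closed)

text \<open>
  The vertex path in the Cayley graph that starts at \<open>u\<close> and reads the word \<open>w\<close>. All paths have this
  form, because the generators are involutions.
\<close>

fun word_path :: "'a list \<Rightarrow> 'a list \<Rightarrow> 'a gword set list" where
  "word_path u [] = [rw u]"
| "word_path u (s # w) = rw u # word_path (u @ [s]) w"

lemma word_path_props:
  assumes "u \<in> lists V" "w \<in> lists V"
  shows "vwalk_between C (rw u) (word_path u w) (rw (u @ w))" "length (word_path u w) = Suc (length w)"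
proof -
  have *: "vwalk (word_path u w) (with_proj C) \<and> hd (word_path u w) = rw u \<and>
      last (word_path u w) = rw (u @ w) \<and> length (word_path u w) = Suc (length w)"
    using assms
  proof (induction w arbitrary: u)
    case Nil
    then show ?case using rw_closed by (auto simp: vwalk_def pverts_cayley)
  next
    case (Cons s w)
    have IH: "vwalk (word_path (u @ [s]) w) (with_proj C)" "hd (word_path (u @ [s]) w) = rw (u @ [s])"
      "last (word_path (u @ [s]) w) = rw (u @ s # w)" "length (word_path (u @ [s]) w) = Suc (length w)"
      using Cons.IH [of "u @ [s]"] Cons.prems by auto
    have "(rw u, rw (u @ [s])) \<in> parcs C" using cayley_arc_iff Cons.prems by auto
    then have "vwalk (rw u # word_path (u @ [s]) w) (with_proj C)"
      using IH rw_closed Cons.prems by (intro vwalk_consI) (auto simp: pverts_cayley)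
    moreover have "word_path (u @ [s]) w \<noteq> []" using IH(4) by auto
    ultimately show ?case using IH by simp
  qed
  then show "vwalk_between C (rw u) (word_path u w) (rw (u @ w))" "length (word_path u w) = Suc (length w)"
    unfolding vwalk_between_def by auto
qed

lemma word_path_exists:
  assumes "vwalk p (with_proj C)" "hd p = rw u" "u \<in> lists V"
  shows "\<exists>w \<in> lists V. p = word_path u w"
  using assms
proof (induction p arbitrary: u rule: list.induct)
  case Nil
  then show ?case by (simp add: vwalk_def)
next
  case (Cons g p)
  show ?case
  proof (cases p)
    case Nil
    then show ?thesis using Cons.prems by (intro bexI [of _ "[]"]) auto
  next
    case (Cons h q)
    have arc: "(g, h) \<in> parcs C" and walk: "vwalk p (with_proj C)"
      using Cons.prems(1) unfolding vwalk_def Cons by auto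
    obtain v where "h = rw v" "v \<in> lists V" using parcs_cayley_carrier [OF arc] carrier_racg by blast
    then obtain s where s: "s \<in> V" "h = rw (u @ [s])"
      using arc cayley_arc_iff [of u v] Cons.prems by auto
    then obtain w where "w \<in> lists V" "p = word_path (u @ [s]) w"
      using Cons.IH [OF walk, of "u @ [s]"] Cons.prems(3) Cons by auto
    then show ?thesis using s Cons.prems by (intro bexI [of _ "s # w"]) auto
  qed
qed

lemma set_word_path: "set (word_path u w) = {rw (u @ x) | x y. w = x @ y}"
proof (induction w arbitrary: u)
  case (Cons s w)
  show ?case
  proof (intro equalityI subsetI)
    fix g assume "g \<in> set (word_path u (s # w))"
    then consider "g = rw u" | x y where "g = rw ((u @ [s]) @ x)" "w = x @ y" using Cons by auto
    then show "g \<in> {rw (u @ x) | x y. s # w = x @ y}"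
    proof cases
      case 1
      then show ?thesis by (intro CollectI exI [of _ "[]"] exI [of _ "s # w"]) simp
    next
      case 2
      then show ?thesis by (intro CollectI exI [of _ "s # x"] exI [of _ y]) simp
    qed
  next
    fix g assume "g \<in> {rw (u @ x) | x y. s # w = x @ y}"
    then obtain x y where g: "g = rw (u @ x)" "s # w = x @ y" by blast
    then show "g \<in> set (word_path u (s # w))"
      using Cons [of "u @ [s]"] by (cases x) auto
  qed
qed auto

lemma ex_reduced_lists:
  assumes "w \<in> lists V" obtains v where "v \<approx> w" "reduced v" "v \<in> lists V"
proof -
  obtain v where v: "v \<approx> w" "reduced v" "length v = wlen w" by (rule ex_reduced)
  let ?v = "filter (\<lambda>a. a \<in> V) v"
  have "filter (\<lambda>a. a \<in> V) w = w" using assms by (auto simp: filter_id_conv)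
  then have fv: "?v \<approx> w" using filter_weq [OF v(1), of "\<lambda>a. a \<in> V"] by simp
  have "wlen w \<le> length ?v" using wlen_le [of ?v] wlen_cong [OF fv] by simp
  then have "length ?v = wlen w" using v(3) length_filter_le [of _ v] by (simp add: le_antisym)
  then have "reduced ?v" using reduced_wlen wlen_cong [OF fv] by simp
  moreover have "?v \<in> lists V" by auto
  ultimately show ?thesis using that fv by blast
qed

lemma path_dist_words:
  assumes "u \<in> lists V" "v \<in> lists V"
  shows "path_dist C (rw u) (rw v) = wdist u v"
  unfolding path_dist_def
proof (rule Least_equality)
  obtain w where w: "w \<approx> rev u @ v" "reduced w" "w \<in> lists V"
    using ex_reduced_lists [of "rev u @ v"] assms rev_lists by auto
  have "u @ w \<approx> v" using w(1) move_left by simp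
  then have "rw (u @ w) = rw v" using rw_eq_iff assms w by simp
  moreover have "length w = wdist u v"
    unfolding wdist_def using w(2) reduced_wlen wlen_cong [OF w(1)] by simp
  ultimately show "\<exists>p. vwalk_between C (rw u) p (rw v) \<and> vwalk_length p = wdist u v"
    using word_path_props [OF assms(1) w(3)] by (intro exI [of _ "word_path u w"]) auto
next
  fix n assume "\<exists>p. vwalk_between C (rw u) p (rw v) \<and> vwalk_length p = n"
  then obtain p where p: "vwalk p (with_proj C)" "hd p = rw u" "last p = rw v" "length p - 1 = n"
    unfolding vwalk_between_def by auto
  then obtain w where w: "w \<in> lists V" "p = word_path u w" using word_path_exists assms(1) by blast
  then have "rw (u @ w) = rw v" "length w = n"
    using word_path_props [OF assms(1) w(1)] p unfolding vwalk_between_def by auto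
  then have "w \<approx> rev u @ v" using rw_eq_iff assms w move_left by simp
  then show "wdist u v \<le> n"
    unfolding wdist_def using wlen_cong [of w "rev u @ v"] wlen_le [of w] \<open>length w = n\<close> by simp
qed

lemma geodesic_word_path:
  assumes "u \<in> lists V" "w \<in> lists V" "reduced w"
  shows "geodesic_between C (rw u) (word_path u w) (rw (u @ w))"
proof -
  have "rev u @ u @ w \<approx> w" by (rule rev_cancel)
  then have "path_dist C (rw u) (rw (u @ w)) = length w"
    using path_dist_words assms wdist_def wlen_cong reduced_wlen by simp
  then show ?thesis using word_path_props [OF assms(1,2)] unfolding geodesic_between_def by simp
qed

lemma geodesic_obtain_word:
  assumes "u \<in> lists V" "geodesic_between C (rw u) p h"
  obtains w where "w \<in> lists V" "reduced w" "p = word_path u w" "h = rw (u @ w)"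
proof -
  obtain w where w: "w \<in> lists V" "p = word_path u w"
    using word_path_exists assms unfolding geodesic_between_def vwalk_between_def by blast
  have h: "h = rw (u @ w)" using word_path_props [OF assms(1) w(1)] assms(2) w(2)
    unfolding geodesic_between_def vwalk_between_def by simp
  have "wdist u (u @ w) = length w"
    using assms(2) w word_path_props(2) [OF assms(1) w(1)] path_dist_words [of u "u @ w"] assms(1) h
    unfolding geodesic_between_def by simp
  then have "wlen w = length w" unfolding wdist_def using wlen_cong [OF rev_cancel [of u w]] by simp
  then show ?thesis using that w h reduced_wlen by blast
qed

lemma hyperbolic_racg:
  assumes "racg_2_dimensional \<Gamma>"
    and "\<And>a b c d. (a, b) \<in> parcs \<Gamma> \<Longrightarrow> (b, c) \<in> parcs \<Gamma> \<Longrightarrow> (c, d) \<in> parcs \<Gamma> \<Longrightarrow> (d, a) \<in> parcs \<Gamma> \<Longrightarrow> a = c \<or> b = d"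
  shows "hyperbolic_group G"
  unfolding hyperbolic_group_def
proof (intro exI conjI)
  interpret pair_graph \<Gamma> by (rule graph)
  have no_triangle: False if "(a, b) \<in> parcs \<Gamma>" "(b, c) \<in> parcs \<Gamma>" "(c, a) \<in> parcs \<Gamma>" for a b c
    using assms(1) that unfolding racg_2_dimensional_def by blast
  show "finite (racg_gens \<Gamma>)" unfolding racg_gens_def using pair_finite_verts by simp
  show sub: "racg_gens \<Gamma> \<subseteq> carrier G" unfolding racg_gens_def using rw_closed by auto
  show "generate G (racg_gens \<Gamma>) = carrier G"
  proof (rule equalityI [OF racg.generate_incl [OF sub]])
    show "carrier G \<subseteq> generate G (racg_gens \<Gamma>)" unfolding carrier_racg using rw_generate by auto
  qed
  show "gromov_hyperbolic 1 (carrier G) (\<lambda>x y. real (path_dist C x y))"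
    unfolding gromov_hyperbolic_def
  proof (intro ballI)
    fix x y z w assume "x \<in> carrier G" "y \<in> carrier G" "z \<in> carrier G" "w \<in> carrier G"
    moreover have "\<exists>u. g = rw u \<and> u \<in> lists V" if "g \<in> carrier G" for g
      using that unfolding carrier_racg by auto
    ultimately obtain x' y' z' w' where *: "x = rw x'" "x' \<in> lists V" "y = rw y'" "y' \<in> lists V"
      "z = rw z'" "z' \<in> lists V" "w = rw w'" "w' \<in> lists V" by metis
    have "wdist x' y' + wdist z' w' \<le> max (wdist x' z' + wdist y' w') (wdist x' w' + wdist y' z') + 2"
      by (rule four_point [OF no_triangle assms(2)])
    then have "path_dist C x y + path_dist C z w
      \<le> max (path_dist C x z + path_dist C y w) (path_dist C x w + path_dist C y z) + 2"
      using * path_dist_words by simp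
    then show "real (path_dist C x y) + real (path_dist C z w)
      \<le> max (real (path_dist C x z) + real (path_dist C y w)) (real (path_dist C x w) + real (path_dist C y z)) + 2 * 1"
      by linarith
  qed
qed

end

section \<open>Fundamental groups and labels of loops\<close>

lemma cas_oriented_simps [simp]:
  "pre_digraph.cas (oriented G) u [] v \<longleftrightarrow> u = v"
  "pre_digraph.cas (oriented G) u ((e, b) # p) v \<longleftrightarrow>
     (if b then tail G e else head G e) = u \<and>
     pre_digraph.cas (oriented G) (if b then head G e else tail G e) p v"
  by (simp_all add: pre_digraph.cas.simps oriented_def)

lemma cas_oriented_append:
  "pre_digraph.cas (oriented G) u (p @ q) v \<longleftrightarrow>
    (\<exists>w. pre_digraph.cas (oriented G) u p w \<and> pre_digraph.cas (oriented G) w q v)"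
proof (induction p arbitrary: u)
  case (Cons a p)
  obtain e b where "a = (e, b)" by fastforce
  then show ?case using Cons.IH by (cases b) auto
qed simp

definition inverse_path :: "('e \<times> bool) list \<Rightarrow> ('e \<times> bool) list" where
  "inverse_path p = rev (map (\<lambda>(e, b). (e, \<not> b)) p)"

lemma inverse_path_simps [simp]:
  "inverse_path [] = []" "inverse_path ((e, b) # p) = inverse_path p @ [(e, \<not> b)]"
  by (simp_all add: inverse_path_def)

lemma cas_inverse_path:
  "pre_digraph.cas (oriented G) u p v \<Longrightarrow> pre_digraph.cas (oriented G) v (inverse_path p) u"
proof (induction p arbitrary: u)
  case (Cons x p)
  then show ?case by (cases x) (auto simp: cas_oriented_append)
qed simp

lemma loops_at_iff:
  "p \<in> loops_at G x \<longleftrightarrow> x \<in> verts G \<and> fst ` set p \<subseteq> arcs G \<and> pre_digraph.cas (oriented G) x p x"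
proof -
  have "arcs (oriented G) = arcs G \<times> UNIV" "verts (oriented G) = verts G"
    by (simp_all add: oriented_def)
  then show ?thesis unfolding loops_at_def pre_digraph.awalk_def by force
qed

lemma loops_at_append: "p \<in> loops_at G x \<Longrightarrow> q \<in> loops_at G x \<Longrightarrow> p @ q \<in> loops_at G x"
  unfolding loops_at_iff by (auto simp: cas_oriented_append)

lemma set_inverse_path: "fst ` set (inverse_path p) = fst ` set p"
  unfolding inverse_path_def by (force simp: image_iff)

lemma loops_at_inverse: "p \<in> loops_at G x \<Longrightarrow> inverse_path p \<in> loops_at G x"
  unfolding loops_at_iff using cas_inverse_path set_inverse_path by metis

lemma homotopic_loops: "homotopic G x p q \<Longrightarrow> p \<in> loops_at G x \<and> q \<in> loops_at G x"
  by (induction rule: homotopic.induct) auto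

lemma homotopic_append_right:
  "homotopic G x p p' \<Longrightarrow> q \<in> loops_at G x \<Longrightarrow> homotopic G x (p @ q) (p' @ q)"
proof (induction rule: homotopic.induct)
  case (backtrack p r e b)
  have "(p @ r) @ q \<in> loops_at G x" "(p @ [(e, b), (e, \<not> b)] @ r) @ q \<in> loops_at G x"
    by (rule loops_at_append [OF backtrack.hyps(1) backtrack.prems] loops_at_append [OF backtrack.hyps(2) backtrack.prems])+
  then show ?case using homotopic.backtrack [of p "r @ q" G x e b] by simp
next
  case (refl p)
  show ?case by (rule homotopic.refl [OF loops_at_append]) (use refl in simp_all)
next
  case (sym p p')
  from sym.IH [OF sym.prems] show ?case by (rule homotopic.sym)
next
  case (trans p p' p'')
  from trans.IH(1) [OF trans.prems] trans.IH(2) [OF trans.prems] show ?case by (rule homotopic.trans)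
qed

lemma homotopic_append_left:
  "homotopic G x p p' \<Longrightarrow> q \<in> loops_at G x \<Longrightarrow> homotopic G x (q @ p) (q @ p')"
proof (induction rule: homotopic.induct)
  case (backtrack p r e b)
  have "q @ p @ r \<in> loops_at G x" "q @ p @ [(e, b), (e, \<not> b)] @ r \<in> loops_at G x"
    by (rule loops_at_append [OF backtrack.prems backtrack.hyps(1)] loops_at_append [OF backtrack.prems backtrack.hyps(2)])+
  then show ?case using homotopic.backtrack [of "q @ p" r G x e b] by simp
next
  case (refl p)
  show ?case by (rule homotopic.refl [OF loops_at_append]) (use refl in simp_all)
next
  case (sym p p')
  from sym.IH [OF sym.prems] show ?case by (rule homotopic.sym)
next
  case (trans p p' p'')
  from trans.IH(1) [OF trans.prems] trans.IH(2) [OF trans.prems] show ?case by (rule homotopic.trans)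
qed

lemma homotopic_append:
  assumes "homotopic G x p p'" "homotopic G x q q'"
  shows "homotopic G x (p @ q) (p' @ q')"
  using homotopic_append_right [OF assms(1)] homotopic_append_left [OF assms(2)]
    homotopic_loops [OF assms(1)] homotopic_loops [OF assms(2)] homotopic.trans by metis

text \<open>
  The path \<open>p\<close> need not be closed: the induction removes its first edge.
\<close>

lemma homotopic_inverse:
  assumes "x \<in> verts G" "fst ` set p \<subseteq> arcs G" "pre_digraph.cas (oriented G) y p x"
  shows "homotopic G x (inverse_path p @ p) []"
  using assms(2,3)
proof (induction p arbitrary: y)
  case Nil
  then show ?case using assms(1) by (auto intro!: homotopic.refl simp: loops_at_iff)
next
  case (Cons a p)
  obtain e b where a: "a = (e, b)" by fastforce
  have p: "fst ` set p \<subseteq> arcs G" "pre_digraph.cas (oriented G) (if b then head G e else tail G e) p x"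
    "e \<in> arcs G" using Cons.prems a by auto
  note IH = Cons.IH [OF p(1,2)]
  have "inverse_path p @ [(e, \<not> b), (e, \<not> \<not> b)] @ p \<in> loops_at G x"
    using p assms(1) cas_inverse_path [OF p(2)] set_inverse_path [of p]
    unfolding loops_at_iff set_append image_Un by (cases b) (auto simp: cas_oriented_append)
  then have "homotopic G x (inverse_path p @ [(e, \<not> b), (e, \<not> \<not> b)] @ p) (inverse_path p @ p)"
    using homotopic_loops [OF IH] by (intro homotopic.backtrack) auto
  then show ?case using IH a homotopic.trans by fastforce
qed

lemma homotopy_class_eqI:
  assumes h: "homotopic G x p q" shows "homotopy_class G x p = homotopy_class G x q"
  unfolding homotopy_class_def
  using homotopic.trans [OF h] homotopic.trans [OF homotopic.sym [OF h]] by auto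

lemma homotopy_class_eq_iff:
  assumes "p \<in> loops_at G x"
  shows "homotopy_class G x p = homotopy_class G x q \<longleftrightarrow> homotopic G x p q"
proof
  assume "homotopy_class G x p = homotopy_class G x q"
  moreover have "p \<in> homotopy_class G x p"
    using homotopic.refl [OF assms] by (simp add: homotopy_class_def)
  ultimately have "homotopic G x q p" by (simp add: homotopy_class_def)
  then show "homotopic G x p q" by (rule homotopic.sym)
qed (rule homotopy_class_eqI)

lemma fundamental_group_mult:
  assumes "p \<in> loops_at G x" "q \<in> loops_at G x"
  shows "homotopy_class G x p \<otimes>\<^bsub>fundamental_group G x\<^esub> homotopy_class G x q = homotopy_class G x (p @ q)"
proof -
  have "homotopy_class G x (p' @ q') = homotopy_class G x (p @ q)"
    if "p' \<in> homotopy_class G x p" "q' \<in> homotopy_class G x q" for p' q'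
  proof -
    have "homotopic G x p p'" "homotopic G x q q'" using that by (simp_all add: homotopy_class_def)
    then have "homotopic G x (p @ q) (p' @ q')" by (rule homotopic_append)
    then show ?thesis by (rule homotopy_class_eqI [symmetric])
  qed
  moreover have "p \<in> homotopy_class G x p" "q \<in> homotopy_class G x q"
    using homotopic.refl assms by (simp_all add: homotopy_class_def)
  ultimately have "(\<Union>p\<in>homotopy_class G x p. \<Union>q\<in>homotopy_class G x q. homotopy_class G x (p @ q))
    = homotopy_class G x (p @ q)" by blast
  then show ?thesis by (simp add: fundamental_group_def)
qed

lemma fundamental_group_carrier:
  "carrier (fundamental_group G x) = homotopy_class G x ` loops_at G x"
  "\<one>\<^bsub>fundamental_group G x\<^esub> = homotopy_class G x []"
  by (simp_all add: fundamental_group_def)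

lemma fundamental_group_inverse:
  assumes "x \<in> verts G" "p \<in> loops_at G x"
  shows "homotopy_class G x (inverse_path p) \<otimes>\<^bsub>fundamental_group G x\<^esub> homotopy_class G x p = \<one>\<^bsub>fundamental_group G x\<^esub>"
proof -
  have "homotopic G x (inverse_path p @ p) []"
    using homotopic_inverse assms unfolding loops_at_iff by metis
  then show ?thesis
    unfolding fundamental_group_mult [OF loops_at_inverse [OF assms(2)] assms(2)] fundamental_group_carrier
    by (rule homotopy_class_eqI)
qed

lemma group_fundamental_group:
  assumes "x \<in> verts G" shows "group (fundamental_group G x)"
proof (rule groupI)
  let ?\<pi> = "fundamental_group G x"
  have nil: "[] \<in> loops_at G x" using assms by (simp add: loops_at_iff)
  show "\<one>\<^bsub>?\<pi>\<^esub> \<in> carrier ?\<pi>" unfolding fundamental_group_carrier using nil by blast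
  fix X assume X: "X \<in> carrier ?\<pi>"
  then obtain p where p: "X = homotopy_class G x p" "p \<in> loops_at G x" unfolding fundamental_group_carrier by blast
  show "\<one>\<^bsub>?\<pi>\<^esub> \<otimes>\<^bsub>?\<pi>\<^esub> X = X"
    unfolding fundamental_group_carrier(2) p(1) using fundamental_group_mult [OF nil p(2)] by simp
  show "\<exists>Y\<in>carrier ?\<pi>. Y \<otimes>\<^bsub>?\<pi>\<^esub> X = \<one>\<^bsub>?\<pi>\<^esub>"
    using fundamental_group_inverse [OF assms p(2)] loops_at_inverse [OF p(2)] p(1)
    unfolding fundamental_group_carrier(1) by blast
  fix Y assume "Y \<in> carrier ?\<pi>"
  then obtain q where q: "Y = homotopy_class G x q" "q \<in> loops_at G x" unfolding fundamental_group_carrier by blast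
  show "X \<otimes>\<^bsub>?\<pi>\<^esub> Y \<in> carrier ?\<pi>"
    unfolding p(1) q(1) fundamental_group_mult [OF p(2) q(2)] fundamental_group_carrier(1)
    using loops_at_append [OF p(2) q(2)] by blast
  fix Z assume "Z \<in> carrier ?\<pi>"
  then obtain r where r: "Z = homotopy_class G x r" "r \<in> loops_at G x" unfolding fundamental_group_carrier by blast
  show "X \<otimes>\<^bsub>?\<pi>\<^esub> Y \<otimes>\<^bsub>?\<pi>\<^esub> Z = X \<otimes>\<^bsub>?\<pi>\<^esub> (Y \<otimes>\<^bsub>?\<pi>\<^esub> Z)"
    unfolding p(1) q(1) r(1) fundamental_group_mult [OF p(2) q(2)] fundamental_group_mult [OF q(2) r(2)]
      fundamental_group_mult [OF p(2) loops_at_append [OF q(2) r(2)]]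
      fundamental_group_mult [OF loops_at_append [OF p(2) q(2)] r(2)] by simp
qed

lemma fundamental_group_inv:
  assumes "x \<in> verts G" "p \<in> loops_at G x"
  shows "inv\<^bsub>fundamental_group G x\<^esub> (homotopy_class G x p) = homotopy_class G x (inverse_path p)"
  by (rule group.inv_equality [OF group_fundamental_group [OF assms(1)] fundamental_group_inverse [OF assms]])
    (use assms(2) loops_at_inverse [OF assms(2)] in \<open>auto simp: fundamental_group_carrier\<close>)

lemma generalized_rose_simps [simp]:
  "None \<in> verts (generalized_rose T A)"
  "((w, k), a) \<in> arcs (generalized_rose T A) \<longleftrightarrow> w \<in> T \<and> k < length w \<and> a \<in> A (w ! k)"
  "tail (generalized_rose T A) ((w, k), a) = rose_vertex w k"
  "head (generalized_rose T A) ((w, k), a) = rose_vertex w (Suc k)"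
  by (auto simp: generalized_rose_def multiply_edges_def rose_def rose_label_def)

lemma loop_label_simps [simp]:
  "loop_label [] = []" "loop_label (((e, a), b) # p) = a # loop_label p"
  "loop_label (p @ q) = loop_label p @ loop_label q"
  by (simp_all add: loop_label_def)

lemma loop_label_inverse [simp]: "loop_label (inverse_path p) = rev (loop_label p)"
  unfolding loop_label_def inverse_path_def by (induction p) auto

text \<open>
  A lift of the word of a petal is the label of a loop, since the copy of each edge of the petal can
  be chosen independently.
\<close>

lemma petal_loop:
  assumes "w \<in> T" "length l = length w" "\<And>k. k < length w \<Longrightarrow> l ! k \<in> A (w ! k)"
  obtains p where "p \<in> loops_at (generalized_rose T A) None" "loop_label p = l"
proof
  define q where "q j = map (\<lambda>k. (((w, k), l ! k), True)) [j..<length w]" for j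
  have "pre_digraph.cas (oriented (generalized_rose T A)) (rose_vertex w j) (q j) None" if "j \<le> length w" for j
    using that
  proof (induction j rule: inc_induct)
    case base
    show ?case by (simp add: q_def rose_vertex_def)
  next
    case (step j)
    then have "q j = (((w, j), l ! j), True) # q (Suc j)" by (simp add: q_def upt_conv_Cons)
    then show ?case using step.IH by simp
  qed
  from this [of 0] show "q 0 \<in> loops_at (generalized_rose T A) None"
    using assms unfolding loops_at_iff by (auto simp: q_def rose_vertex_def)
  have "loop_label (q 0) = map ((!) l) [0..<length w]" by (simp add: q_def loop_label_def)
  then show "loop_label (q 0) = l" using assms(2) map_nth [of l] by simp
qed

section \<open>Generalized subgroups\<close>

lemma (in racg_graph) rw_conj:
  assumes "u \<in> lists (pverts \<Gamma>)" "w \<in> lists (pverts \<Gamma>)"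
  shows "racg_word \<Gamma> u \<otimes>\<^bsub>racg \<Gamma>\<^esub> racg_word \<Gamma> w \<otimes>\<^bsub>racg \<Gamma>\<^esub> inv\<^bsub>racg \<Gamma>\<^esub> (racg_word \<Gamma> u) = racg_word \<Gamma> (u @ w @ rev u)"
  using assms rw_inv [of u] rw_mult [of u w] rw_mult [of "u @ w" "rev u"] rev_lists [of u] by simp

text \<open>
  The properties of a \<open>\<Gamma>\<close>-partite graph on which the comparison of the two groups rests. The last
  assumption is the connectedness of the subgraph on two parts, in the form in which it is used: a nonempty set
  of vertices of one part is everything if it is closed under having a common neighbour in the other.
\<close>

locale coloured_racg = \<Gamma>: racg_graph \<Gamma> + \<Delta>: racg_graph \<Delta>
  for \<Gamma> :: "'a pair_pre_digraph" and \<Delta> :: "'b pair_pre_digraph" +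
  fixes A :: "'a \<Rightarrow> 'b set" and col :: "'b \<Rightarrow> 'a"
  assumes parts: "(\<Union>s\<in>pverts \<Gamma>. A s) = pverts \<Delta>"
    and part_nonempty: "s \<in> pverts \<Gamma> \<Longrightarrow> A s \<noteq> {}"
    and col: "s \<in> pverts \<Gamma> \<Longrightarrow> a \<in> A s \<Longrightarrow> col a = s"
    and col_arc: "(a, b) \<in> parcs \<Delta> \<Longrightarrow> (col a, col b) \<in> parcs \<Gamma>"
    and neighbour: "(s, t) \<in> parcs \<Gamma> \<Longrightarrow> b \<in> A t \<Longrightarrow> \<exists>a\<in>A s. (a, b) \<in> parcs \<Delta>"
    and part_connected: "(s, t) \<in> parcs \<Gamma> \<Longrightarrow> X \<subseteq> A s \<Longrightarrow> X \<noteq> {} \<Longrightarrow>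
      (\<And>a a' b. a \<in> X \<Longrightarrow> a' \<in> A s \<Longrightarrow> b \<in> A t \<Longrightarrow>
        (a, b) \<in> parcs \<Delta> \<Longrightarrow> (a', b) \<in> parcs \<Delta> \<Longrightarrow> a' \<in> X) \<Longrightarrow> X = A s"
begin

sublocale coloured_words "\<lambda>s t. (s, t) \<in> parcs \<Gamma>" "\<lambda>a b. (a, b) \<in> parcs \<Delta>" col
  by unfold_locales (rule col_arc)

lemma A_iff: "s \<in> pverts \<Gamma> \<Longrightarrow> a \<in> A s \<longleftrightarrow> a \<in> pverts \<Delta> \<and> col a = s"
  using parts col by blast

lemma col_pverts: "a \<in> pverts \<Delta> \<Longrightarrow> col a \<in> pverts \<Gamma>"
  using parts col by blast

lemma map_col_lists: "l \<in> lists (pverts \<Delta>) \<Longrightarrow> map col l \<in> lists (pverts \<Gamma>)"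
  using col_pverts by auto

lemma ex_colour:
  assumes "s \<in> pverts \<Gamma>" obtains a where "a \<in> pverts \<Delta>" "col a = s"
  using part_nonempty [OF assms] A_iff [OF assms] by blast

lemma ex_lift: "w \<in> lists (pverts \<Gamma>) \<Longrightarrow> \<exists>l\<in>lists (pverts \<Delta>). map col l = w"
proof (induction w)
  case (Cons s w)
  then obtain l where "l \<in> lists (pverts \<Delta>)" "map col l = w" by auto
  moreover obtain a where "a \<in> pverts \<Delta>" "col a = s" using Cons.prems ex_colour [of s] by auto
  ultimately show ?case by (intro bexI [of _ "a # l"]) auto
qed auto

end

locale generalization = coloured_racg \<Gamma> \<Delta> A col
  for \<Gamma> :: "'a pair_pre_digraph" and \<Delta> :: "'b pair_pre_digraph" and A col +
  fixes T :: "'a list set" and H :: "'a gword set set" and K :: "'b gword set set"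
  assumes T: "T \<subseteq> lists (pverts \<Gamma>)" and H: "generate (racg \<Gamma>) (racg_word \<Gamma> ` T) = H"
    and K: "is_generalization \<Delta> A T K"
begin

abbreviation "X \<equiv> generalized_rose T A"

lemma subgroup_H: "subgroup H (racg \<Gamma>)"
  unfolding H [symmetric] using T \<Gamma>.rw_closed by (intro \<Gamma>.racg.generate_is_subgroup) blast

lemma rose_edge:
  assumes "((w, k), a) \<in> arcs X"
  shows "w \<in> T" "k < length w" "a \<in> pverts \<Delta>" "col a = w ! k"
proof -
  show w: "w \<in> T" "k < length w" using assms by simp_all
  then have "w ! k \<in> pverts \<Gamma>" using T by auto
  then show "a \<in> pverts \<Delta>" "col a = w ! k" using assms A_iff by auto
qed

lemma path_label_lists: "fst ` set p \<subseteq> arcs X \<Longrightarrow> loop_label p \<in> lists (pverts \<Delta>)"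
proof (induction p)
  case (Cons x p)
  obtain w k a b where x: "x = (((w, k), a), b)" by (metis surj_pair)
  have "((w, k), a) \<in> arcs X" "fst ` set p \<subseteq> arcs X" using Cons.prems unfolding x by auto
  then have "a \<in> pverts \<Delta>" "loop_label p \<in> lists (pverts \<Delta>)" using rose_edge(3) Cons.IH by blast+
  then show ?case unfolding x by simp
qed simp

lemma loop_label_lists: "p \<in> loops_at X None \<Longrightarrow> loop_label p \<in> lists (pverts \<Delta>)"
  unfolding loops_at_iff using path_label_lists by blast

lemma homotopic_label: "homotopic X None p q \<Longrightarrow> \<Delta>.weq (loop_label p) (loop_label q)"
proof (induction rule: homotopic.induct)
  case (backtrack p q e b)
  obtain e' a where "e = (e', a)" by fastforce
  then show ?case using \<Delta>.app_left [OF \<Delta>.square_Cons] by simp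
qed (auto intro: \<Delta>.sym \<Delta>.trans)

lemma generators:
  obtains L where "finite L" "L \<subseteq> loops_at X None"
    "generate (fundamental_group X None) (homotopy_class X None ` L) = homotopy_class X None ` loops_at X None"
    "K = generate (racg \<Delta>) (racg_word \<Delta> ` loop_label ` L)"
    "racg_word \<Delta> ` loop_label ` L \<subseteq> carrier (racg \<Delta>)"
proof -
  obtain L where L: "finite L" "L \<subseteq> loops_at X None"
    "generate (fundamental_group X None) (homotopy_class X None ` L) = homotopy_class X None ` loops_at X None"
    "K = generate (racg \<Delta>) (racg_word \<Delta> ` loop_label ` L)"
    using K unfolding is_generalization_def fundamental_group_carrier by blast
  moreover have "racg_word \<Delta> ` loop_label ` L \<subseteq> carrier (racg \<Delta>)"
    using L(2) loop_label_lists \<Delta>.rw_closed by blast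
  ultimately show ?thesis using that by blast
qed

lemma subgroup_K: "subgroup K (racg \<Delta>)"
  using generators \<Delta>.racg.generate_is_subgroup by metis

lemma finitely_generated_K: "finitely_generated (racg \<Delta>) K"
  unfolding finitely_generated_def using generators by (metis finite_imageI)

text \<open>
  Labels of homotopic loops represent the same element, so the labels of generating loops generate the
  labels of all loops.
\<close>

lemma loop_label_K:
  assumes "p \<in> loops_at X None" shows "racg_word \<Delta> (loop_label p) \<in> K"
proof -
  obtain L where L: "L \<subseteq> loops_at X None"
    "generate (fundamental_group X None) (homotopy_class X None ` L) = homotopy_class X None ` loops_at X None"
    "K = generate (racg \<Delta>) (racg_word \<Delta> ` loop_label ` L)" using generators by metis
  have none: "None \<in> verts X" by simp
  have "\<exists>q\<in>loops_at X None. c = homotopy_class X None q \<and> racg_word \<Delta> (loop_label q) \<in> K"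
    if "c \<in> generate (fundamental_group X None) (homotopy_class X None ` L)" for c
    using that
  proof (induction rule: generate.induct)
    case one
    have "[] \<in> loops_at X None" by (simp add: loops_at_iff)
    moreover have "racg_word \<Delta> [] \<in> K" using subgroup.one_closed [OF subgroup_K] \<Delta>.rw_one by simp
    ultimately show ?case unfolding fundamental_group_carrier by (intro bexI [of _ "[]"]) auto
  next
    case (incl h)
    then obtain q where q: "q \<in> L" "h = homotopy_class X None q" by blast
    moreover have "racg_word \<Delta> (loop_label q) \<in> K" unfolding L(3) using q by (intro generate.incl) blast
    ultimately show ?case using L(1) by blast
  next
    case (inv h)
    then obtain q where q: "q \<in> L" "h = homotopy_class X None q" by blast
    then have ql: "q \<in> loops_at X None" using L(1) by blast
    have "racg_word \<Delta> (loop_label q) \<in> K" unfolding L(3) using q by (intro generate.incl) blast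
    then have "racg_word \<Delta> (loop_label (inverse_path q)) \<in> K"
      using subgroup.m_inv_closed [OF subgroup_K] \<Delta>.rw_inv [OF loop_label_lists [OF ql]] by fastforce
    then show ?case using q fundamental_group_inv [OF none ql] loops_at_inverse [OF ql] by blast
  next
    case (eng h1 h2)
    then obtain q1 q2 where q: "q1 \<in> loops_at X None" "h1 = homotopy_class X None q1" "racg_word \<Delta> (loop_label q1) \<in> K"
      "q2 \<in> loops_at X None" "h2 = homotopy_class X None q2" "racg_word \<Delta> (loop_label q2) \<in> K" by blast
    have "racg_word \<Delta> (loop_label (q1 @ q2)) \<in> K"
      using subgroup.m_closed [OF subgroup_K q(3,6)] \<Delta>.rw_mult loop_label_lists q(1,4) by simp
    then show ?case using fundamental_group_mult [OF q(1,4)] q(2,5) loops_at_append [OF q(1,4)] by blast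
  qed
  from this [of "homotopy_class X None p"] obtain q where q: "q \<in> loops_at X None"
    "homotopy_class X None p = homotopy_class X None q" "racg_word \<Delta> (loop_label q) \<in> K"
    using L(2) assms by blast
  then have "\<Delta>.weq (loop_label p) (loop_label q)"
    using homotopy_class_eq_iff [OF assms] homotopic_label by blast
  then have "racg_word \<Delta> (loop_label p) = racg_word \<Delta> (loop_label q)"
    using \<Delta>.rw_eq_iff loop_label_lists assms q(1) by blast
  then show ?thesis using q(3) by simp
qed

definition K_words :: "'b list set" where
  "K_words = {l \<in> lists (pverts \<Delta>). racg_word \<Delta> l \<in> K}"

definition H_words :: "'a list set" where
  "H_words = {w \<in> lists (pverts \<Gamma>). racg_word \<Gamma> w \<in> H}"

lemma K_words_append: "u \<in> K_words \<Longrightarrow> v \<in> K_words \<Longrightarrow> u @ v \<in> K_words"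
  using subgroup.m_closed [OF subgroup_K] \<Delta>.rw_mult [of u v] unfolding K_words_def by fastforce

lemma H_words_append: "u \<in> H_words \<Longrightarrow> v \<in> H_words \<Longrightarrow> u @ v \<in> H_words"
  using subgroup.m_closed [OF subgroup_H] \<Gamma>.rw_mult [of u v] unfolding H_words_def by fastforce

lemma K_words_rev: "u \<in> K_words \<Longrightarrow> rev u \<in> K_words"
  using subgroup.m_inv_closed [OF subgroup_K] \<Delta>.rw_inv [of u] unfolding K_words_def by fastforce

lemma H_words_rev: "u \<in> H_words \<Longrightarrow> rev u \<in> H_words"
  using subgroup.m_inv_closed [OF subgroup_H] \<Gamma>.rw_inv [of u] unfolding H_words_def by fastforce

lemma K_words_cong: "u \<in> K_words \<Longrightarrow> v \<in> lists (pverts \<Delta>) \<Longrightarrow> \<Delta>.weq u v \<Longrightarrow> v \<in> K_words"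
  unfolding K_words_def using \<Delta>.rw_eq_iff [of u v] by simp

lemma H_words_cong: "u \<in> H_words \<Longrightarrow> v \<in> lists (pverts \<Gamma>) \<Longrightarrow> \<Gamma>.weq u v \<Longrightarrow> v \<in> H_words"
  unfolding H_words_def using \<Gamma>.rw_eq_iff [of u v] by simp

lemma H_words_Nil: "[] \<in> H_words"
  unfolding H_words_def using subgroup.one_closed [OF subgroup_H] \<Gamma>.rw_one by simp

lemma T_H_words: "T \<subseteq> H_words"
proof
  fix w assume w: "w \<in> T"
  have "racg_word \<Gamma> w \<in> H" unfolding H [symmetric] using w by (intro generate.incl) blast
  then show "w \<in> H_words" using w T by (auto simp: H_words_def)
qed

text \<open>
  A word that leads in the rose from the base vertex to a given vertex. Closing up an arbitrary path by these
  words makes it possible to prove by induction along the path that labels of loops project into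
  \<open>H\<close>: each edge then contributes \<open>1\<close> or, if it is the last of its petal, a generator or its inverse.
\<close>

fun approach :: "('a list \<times> nat) option \<Rightarrow> 'a list" where
  "approach None = []"
| "approach (Some (w, k)) = take k w"

lemma edge_H:
  assumes "w \<in> T" "k < length w"
  shows "approach (rose_vertex w k) @ [w ! k] @ rev (approach (rose_vertex w (Suc k))) \<in> H_words"
proof -
  have w: "w \<in> lists (pverts \<Gamma>)" using assms T by blast
  have k: "approach (rose_vertex w k) = take k w" using assms by (simp add: rose_vertex_def)
  show ?thesis
  proof (cases "Suc k = length w")
    case True
    then have "take k w @ [w ! k] = w" using take_Suc_conv_app_nth [OF assms(2)] by simp
    then show ?thesis using k True T_H_words assms(1) by (auto simp: rose_vertex_def)
  next
    case False
    then have "approach (rose_vertex w (Suc k)) = take k w @ [w ! k]"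
      using take_Suc_conv_app_nth [OF assms(2)] by (simp add: rose_vertex_def)
    then have eq: "approach (rose_vertex w k) @ [w ! k] @ rev (approach (rose_vertex w (Suc k)))
      = (take k w @ [w ! k]) @ rev (take k w @ [w ! k])" using k by simp
    have "set (take k w) \<subseteq> pverts \<Gamma>" "w ! k \<in> pverts \<Gamma>" using w assms(2) set_take_subset [of k w] by auto
    then have "(take k w @ [w ! k]) @ rev (take k w @ [w ! k]) \<in> lists (pverts \<Gamma>)" by auto
    then show ?thesis unfolding eq
      by (rule H_words_cong [OF H_words_Nil _ \<Gamma>.sym [OF \<Gamma>.append_rev]])
  qed
qed

lemma path_label_H:
  assumes "fst ` set p \<subseteq> arcs X" "pre_digraph.cas (oriented X) u p v" "approach u \<in> lists (pverts \<Gamma>)"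
  shows "approach u @ map col (loop_label p) @ rev (approach v) \<in> H_words"
  using assms
proof (induction p arbitrary: u)
  case Nil
  then have "approach u @ rev (approach u) \<in> lists (pverts \<Gamma>)" by auto
  then show ?case
    using Nil H_words_cong [OF H_words_Nil _ \<Gamma>.sym [OF \<Gamma>.append_rev]] by simp
next
  case (Cons x p)
  obtain w k a b where x: "x = (((w, k), a), b)" by (metis surj_pair)
  define u' where "u' = (if b then rose_vertex w (Suc k) else rose_vertex w k)"
  have "((w, k), a) \<in> arcs X" using Cons.prems(1) unfolding x by auto
  then have e: "w \<in> T" "k < length w" "col a = w ! k" by (rule rose_edge)+
  have u: "u = (if b then rose_vertex w k else rose_vertex w (Suc k))"
    using Cons.prems(2) unfolding x by (cases b) auto
  have tk: "take j w \<in> lists (pverts \<Gamma>)" for j using e(1) T set_take_subset [of j w] by auto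
  have "approach (rose_vertex w j) \<in> lists (pverts \<Gamma>)" for j
    using tk by (cases "j = 0 \<or> j = length w") (simp_all add: rose_vertex_def)
  then have u'l: "approach u' \<in> lists (pverts \<Gamma>)" by (simp add: u'_def)
  have IH: "approach u' @ map col (loop_label p) @ rev (approach v) \<in> H_words"
  proof (rule Cons.IH [OF _ _ u'l])
    show "fst ` set p \<subseteq> arcs X" using Cons.prems(1) by simp
    show "pre_digraph.cas (oriented X) u' p v" using Cons.prems(2) unfolding x u'_def by (cases b) simp_all
  qed
  have edge: "approach u @ [col a] @ rev (approach u') \<in> H_words"
    using edge_H [OF e(1,2)] H_words_rev [OF edge_H [OF e(1,2)]] e(3) unfolding u u'_def by (cases b) simp_all
  have cat: "(approach u @ [col a] @ rev (approach u')) @ approach u' @ map col (loop_label p) @ rev (approach v) \<in> H_words"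
    by (rule H_words_append [OF edge IH])
  have "\<Gamma>.weq ((approach u @ [col a]) @ rev (approach u') @ approach u' @ map col (loop_label p) @ rev (approach v))
    ((approach u @ [col a]) @ map col (loop_label p) @ rev (approach v))"
    by (rule \<Gamma>.app_left [OF \<Gamma>.rev_cancel])
  moreover have "(approach u @ [col a]) @ map col (loop_label p) @ rev (approach v) \<in> lists (pverts \<Gamma>)"
    using cat unfolding H_words_def by auto
  ultimately show ?case using H_words_cong [OF cat] x by simp
qed

lemma loop_label_H: "p \<in> loops_at X None \<Longrightarrow> map col (loop_label p) \<in> H_words"
  using path_label_H [of p None None] unfolding loops_at_iff by simp

lemma K_words_project: assumes "l \<in> K_words" shows "map col l \<in> H_words"
proof -
  obtain L where L: "L \<subseteq> loops_at X None"
    "K = generate (racg \<Delta>) (racg_word \<Delta> ` loop_label ` L)" using generators by metis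
  have "\<exists>m\<in>lists (pverts \<Delta>). k = racg_word \<Delta> m \<and> map col m \<in> H_words" if "k \<in> K" for k
    using that unfolding L(2)
  proof (induction rule: generate.induct)
    case one
    then show ?case using H_words_Nil \<Delta>.rw_one by (intro bexI [of _ "[]"]) auto
  next
    case (incl h)
    then show ?case using loop_label_lists loop_label_H L(1) by blast
  next
    case (inv h)
    then obtain q where q: "q \<in> loops_at X None" "h = racg_word \<Delta> (loop_label q)" using L(1) by blast
    have "map col (rev (loop_label q)) \<in> H_words" using H_words_rev [OF loop_label_H [OF q(1)]] by (simp add: rev_map)
    then show ?case using \<Delta>.rw_inv [OF loop_label_lists [OF q(1)]] q(2) \<Delta>.rev_lists [OF loop_label_lists [OF q(1)]] by blast
  next
    case (eng h1 h2)
    then obtain m1 m2 where m: "m1 \<in> lists (pverts \<Delta>)" "h1 = racg_word \<Delta> m1" "map col m1 \<in> H_words"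
      "m2 \<in> lists (pverts \<Delta>)" "h2 = racg_word \<Delta> m2" "map col m2 \<in> H_words" by blast
    then show ?case using \<Delta>.rw_mult [OF m(1,4)] H_words_append [OF m(3,6)]
      by (intro bexI [of _ "m1 @ m2"]) auto
  qed
  then obtain m where m: "m \<in> lists (pverts \<Delta>)" "racg_word \<Delta> l = racg_word \<Delta> m" "map col m \<in> H_words"
    using assms unfolding K_words_def by blast
  have l: "l \<in> lists (pverts \<Delta>)" using assms unfolding K_words_def by blast
  then have "\<Delta>.weq m l" using \<Delta>.rw_eq_iff m by metis
  then show ?thesis by (intro H_words_cong [OF m(3) map_col_lists [OF l]] map_col_weq)
qed

definition lifts_in_K :: "'a list \<Rightarrow> bool" where
  "lifts_in_K w \<longleftrightarrow> (\<forall>l\<in>lists (pverts \<Delta>). map col l = w \<longrightarrow> l \<in> K_words)"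

lemma lifts_in_K_T: assumes "w \<in> T" shows "lifts_in_K w"
  unfolding lifts_in_K_def
proof (intro ballI impI)
  fix l assume l: "l \<in> lists (pverts \<Delta>)" "map col l = w"
  have "l ! k \<in> A (w ! k)" if "k < length w" for k
  proof -
    have "w ! k \<in> pverts \<Gamma>" using that assms T by auto
    then show ?thesis using A_iff l that by auto
  qed
  then obtain p where "p \<in> loops_at X None" "loop_label p = l"
    using petal_loop [of w T l A] assms l(2) by (metis length_map)
  then show "l \<in> K_words" using loop_label_K l(1) unfolding K_words_def by blast
qed

lemma lifts_in_K_append: assumes "lifts_in_K u" "lifts_in_K v" shows "lifts_in_K (u @ v)"
  unfolding lifts_in_K_def
proof (intro ballI impI)
  fix l assume l: "l \<in> lists (pverts \<Delta>)" "map col l = u @ v"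
  then obtain l1 l2 where "l = l1 @ l2" "map col l1 = u" "map col l2 = v" by (auto simp: map_eq_append_conv)
  then show "l \<in> K_words" using assms l(1) K_words_append unfolding lifts_in_K_def by simp
qed

lemma lifts_in_K_rev: assumes "lifts_in_K u" shows "lifts_in_K (rev u)"
  unfolding lifts_in_K_def
proof (intro ballI impI)
  fix l assume l: "l \<in> lists (pverts \<Delta>)" "map col l = rev u"
  then have "map col (rev l) = u" by (simp add: rev_map [symmetric])
  then have "rev l \<in> K_words" using assms l(1) unfolding lifts_in_K_def by auto
  then show "l \<in> K_words" using K_words_rev by fastforce
qed

lemma lifts_in_K_Nil: "lifts_in_K []"
  unfolding lifts_in_K_def K_words_def using subgroup.one_closed [OF subgroup_K] \<Delta>.rw_one by simp

lemma H_liftable: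
  assumes "h \<in> H" shows "\<exists>w\<in>lists (pverts \<Gamma>). h = racg_word \<Gamma> w \<and> lifts_in_K w"
  using assms unfolding H [symmetric]
proof (induction rule: generate.induct)
  case one
  then show ?case using lifts_in_K_Nil \<Gamma>.rw_one by (intro bexI [of _ "[]"]) auto
next
  case (incl h)
  then show ?case using lifts_in_K_T T by blast
next
  case (inv h)
  then obtain w where w: "w \<in> T" "h = racg_word \<Gamma> w" by blast
  then have "w \<in> lists (pverts \<Gamma>)" using T by blast
  then show ?case using \<Gamma>.rw_inv \<Gamma>.rev_lists lifts_in_K_rev [OF lifts_in_K_T [OF w(1)]] w(2) by blast
next
  case (eng h1 h2)
  then obtain w1 w2 where w: "w1 \<in> lists (pverts \<Gamma>)" "h1 = racg_word \<Gamma> w1" "lifts_in_K w1"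
    "w2 \<in> lists (pverts \<Gamma>)" "h2 = racg_word \<Gamma> w2" "lifts_in_K w2" by blast
  then show ?case using \<Gamma>.rw_mult [OF w(1,4)] lifts_in_K_append [OF w(3,6)]
    by (intro bexI [of _ "w1 @ w2"]) auto
qed

text \<open>
  A lift of the shorter word can be extended by inserting the same letter twice.
\<close>

lemma lifts_in_K_delete:
  assumes "lifts_in_K (u @ [s, s] @ v)" "s \<in> pverts \<Gamma>" shows "lifts_in_K (u @ v)"
  unfolding lifts_in_K_def
proof (intro ballI impI)
  fix l assume l: "l \<in> lists (pverts \<Delta>)" "map col l = u @ v"
  then obtain l1 l2 where l12: "l = l1 @ l2" "map col l1 = u" "map col l2 = v" by (auto simp: map_eq_append_conv)
  obtain a where a: "a \<in> pverts \<Delta>" "col a = s" using assms(2) by (rule ex_colour)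
  have "l1 @ [a, a] @ l2 \<in> K_words" using assms(1) l(1) l12 a unfolding lifts_in_K_def by simp
  moreover have "\<Delta>.weq (l1 @ [a, a] @ l2) (l1 @ l2)" using \<Delta>.app_left [OF \<Delta>.square_Cons] by simp
  ultimately show "l \<in> K_words" using K_words_cong l(1) l12(1) by blast
qed

text \<open>
  For \<open>x\<close>, \<open>y\<close> and \<open>t\<^sub>0\<close> fixed let \<open>Y\<close> be the set of those \<open>a\<close> of colour \<open>s\<close> for which \<open>x t\<^sub>0 a y\<close> is
  in \<open>K\<close>. It contains the neighbours of \<open>t\<^sub>0\<close>, since there the two letters commute. If \<open>a\<close> and \<open>a'\<close>
  have a common neighbour \<open>b\<close> then \<open>x b a y\<close> and \<open>x b a' y\<close> are in \<open>K\<close> for the same reason, and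
  \<open>(x t\<^sub>0 a y) (x b a y)\<^sup>-\<^sup>1 (x b a' y) = x t\<^sub>0 a' y\<close>. So \<open>Y\<close> is everything by connectedness.
\<close>

lemma lifts_in_K_swap:
  assumes good: "lifts_in_K (u @ [s, t] @ v)" and st: "(s, t) \<in> parcs \<Gamma>"
  shows "lifts_in_K (u @ [t, s] @ v)"
  unfolding lifts_in_K_def
proof (intro ballI impI)
  fix l assume l: "l \<in> lists (pverts \<Delta>)" "map col l = u @ [t, s] @ v"
  then obtain x t0 s0 y where xy: "l = x @ [t0, s0] @ y" "map col x = u" "col t0 = t" "col s0 = s" "map col y = v"
    by (auto simp: map_eq_append_conv map_eq_Cons_conv)
  have sv: "s \<in> pverts \<Gamma>" "t \<in> pverts \<Gamma>" using \<Gamma>.arcD [OF st] by auto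
  have in_l: "x \<in> lists (pverts \<Delta>)" "y \<in> lists (pverts \<Delta>)" "t0 \<in> A t" "s0 \<in> A s"
    using l xy A_iff sv by auto
  have word: "x @ [a, b] @ y \<in> lists (pverts \<Delta>)" if "a \<in> A i" "b \<in> A j" "i \<in> pverts \<Gamma>" "j \<in> pverts \<Gamma>" for a b i j
    using that in_l A_iff by auto
  have adjacent: "x @ [b, a] @ y \<in> K_words" if "a \<in> A s" "b \<in> A t" "(a, b) \<in> parcs \<Delta>" for a b
  proof -
    have "x @ [a, b] @ y \<in> K_words"
      using good word [OF that(1,2) sv] that xy A_iff sv unfolding lifts_in_K_def by simp
    moreover have "\<Delta>.weq (x @ [a, b] @ y) (x @ [b, a] @ y)"
      by (intro \<Delta>.app_left \<Delta>.app_right \<Delta>.comm that(3))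
    ultimately show ?thesis using K_words_cong word [OF that(2,1) sv(2,1)] by blast
  qed
  define Y where "Y = {a \<in> A s. x @ [t0, a] @ y \<in> K_words}"
  have "Y = A s"
  proof (rule part_connected [OF st])
    show "Y \<subseteq> A s" by (auto simp: Y_def)
    show "Y \<noteq> {}" using neighbour [OF st in_l(3)] adjacent in_l(3) unfolding Y_def by blast
    fix a a' b assume *: "a \<in> Y" "a' \<in> A s" "b \<in> A t" "(a, b) \<in> parcs \<Delta>" "(a', b) \<in> parcs \<Delta>"
    have a: "a \<in> A s" "x @ [t0, a] @ y \<in> K_words" using *(1) by (auto simp: Y_def)
    have 2: "x @ [b, a] @ y \<in> K_words" and 3: "x @ [b, a'] @ y \<in> K_words"
      using adjacent * a by blast+
    have cat: "(x @ [t0, a] @ y) @ rev (x @ [b, a] @ y) @ (x @ [b, a'] @ y) \<in> K_words"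
      by (intro K_words_append K_words_rev a 2 3)
    have "\<Delta>.weq ((x @ [t0, a]) @ y @ rev y @ [a, b] @ rev x @ x @ [b, a'] @ y)
       ((x @ [t0, a]) @ [a, b] @ rev x @ x @ [b, a'] @ y)"
      by (rule \<Delta>.app_left [OF \<Delta>.cancel_rev])
    also have "\<Delta>.weq ((x @ [t0, a]) @ [a, b] @ rev x @ x @ [b, a'] @ y) ((x @ [t0, a, a, b]) @ [b, a'] @ y)"
      using \<Delta>.app_left [OF \<Delta>.rev_cancel, of "x @ [t0, a, a, b]" x "[b, a'] @ y"] by simp
    also have "\<Delta>.weq ((x @ [t0, a, a, b]) @ [b, a'] @ y) ((x @ [t0]) @ [a, a, a'] @ y)"
      using \<Delta>.app_left [OF \<Delta>.square_Cons, of "x @ [t0, a, a]" b "a' # y"] by simp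
    also have "\<Delta>.weq ((x @ [t0]) @ [a, a, a'] @ y) (x @ [t0, a'] @ y)"
      using \<Delta>.app_left [OF \<Delta>.square_Cons, of "x @ [t0]" a "a' # y"] by simp
    finally have "\<Delta>.weq ((x @ [t0, a] @ y) @ rev (x @ [b, a] @ y) @ (x @ [b, a'] @ y)) (x @ [t0, a'] @ y)"
      by simp
    then have "x @ [t0, a'] @ y \<in> K_words"
      using K_words_cong [OF cat] word [OF in_l(3) *(2) sv(2,1)] by blast
    then show "a' \<in> Y" using *(2) by (simp add: Y_def)
  qed
  then show "l \<in> K_words" using in_l(4) xy(1) by (auto simp: Y_def)
qed

lemma lifts_in_K_rsteps:
  assumes "\<Gamma>.shortening_step\<^sup>*\<^sup>* w w'" "w \<in> lists (pverts \<Gamma>)" "lifts_in_K w"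
  shows "w' \<in> lists (pverts \<Gamma>) \<and> lifts_in_K w'"
  using assms
proof (induction rule: rtranclp_induct)
  case (step y z)
  then have "y \<in> lists (pverts \<Gamma>)" "lifts_in_K y" by auto
  with step.hyps(2) show ?case
  proof (cases rule: \<Gamma>.shortening_step.cases)
    case (swap s t u v)
    then show ?thesis using \<open>y \<in> lists (pverts \<Gamma>)\<close> \<open>lifts_in_K y\<close> lifts_in_K_swap by auto
  next
    case (delete u s v)
    then have "s \<in> pverts \<Gamma>" using \<open>y \<in> lists (pverts \<Gamma>)\<close> by simp
    then show ?thesis using delete \<open>y \<in> lists (pverts \<Gamma>)\<close> \<open>lifts_in_K y\<close> lifts_in_K_delete by auto
  qed
qed simp

text \<open>
  An element of \<open>H\<close> is a product of petals, of which all lifts are in \<open>K\<close>, and from this product the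
  reduced word is reached by swaps and deletions. An insertion would destroy the property, because
  it could be lifted to two different letters; this is why the word has to be reduced.
\<close>

lemma reduced_lifts_in_K:
  assumes "w \<in> H_words" "\<Gamma>.reduced w" shows "lifts_in_K w"
proof -
  have w: "w \<in> lists (pverts \<Gamma>)" "racg_word \<Gamma> w \<in> H" using assms(1) by (auto simp: H_words_def)
  obtain u where u: "u \<in> lists (pverts \<Gamma>)" "racg_word \<Gamma> w = racg_word \<Gamma> u" "lifts_in_K u"
    using H_liftable w(2) by blast
  then have "\<Gamma>.weq u w" using \<Gamma>.rw_eq_iff w(1) by metis
  then have "\<Gamma>.shortening_step\<^sup>*\<^sup>* u w" using assms(2) by (rule \<Gamma>.shortening_steps_reduced)
  then show ?thesis using lifts_in_K_rsteps u by blast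
qed

text \<open>
  A geodesic with endpoints in \<open>H\<close> can be translated to start at \<open>1\<close>; its reduced word then lifts to a reduced
  word of an element of \<open>K\<close>. The lifted geodesic stays close to \<open>K\<close>, and the projection, which
  maps \<open>K\<close> into \<open>H\<close>, does not increase distances.
\<close>

theorem quasiconvex_descends:
  assumes "quasiconvex (racg \<Delta>) (racg_gens \<Delta>) K"
  shows "quasiconvex (racg \<Gamma>) (racg_gens \<Gamma>) H"
proof -
  obtain r where r: "\<And>u v p x. u \<in> K \<Longrightarrow> v \<in> K \<Longrightarrow> geodesic_between \<Delta>.C u p v \<Longrightarrow> x \<in> set p \<Longrightarrow>
      \<exists>h\<in>K. path_dist \<Delta>.C x h \<le> r"
    using assms unfolding quasiconvex_def by blast
  have "\<exists>h\<in>H. path_dist \<Gamma>.C x h \<le> r"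
    if g: "g \<in> H" "g' \<in> H" "geodesic_between \<Gamma>.C g p g'" "x \<in> set p" for g g' p x
  proof -
    have "g \<in> carrier (racg \<Gamma>)" using g(1) subgroup.mem_carrier [OF subgroup_H] by blast
    then obtain u where u: "g = racg_word \<Gamma> u" "u \<in> lists (pverts \<Gamma>)" by (rule \<Gamma>.carrierE)
    then obtain w where w: "w \<in> lists (pverts \<Gamma>)" "\<Gamma>.reduced w" "p = \<Gamma>.word_path u w" "g' = racg_word \<Gamma> (u @ w)"
      using \<Gamma>.geodesic_obtain_word g(3) by blast
    have uH: "u \<in> H_words" "u @ w \<in> H_words" using g u w by (auto simp: H_words_def)
    have "w \<in> H_words"
      by (rule H_words_cong [OF H_words_append [OF H_words_rev [OF uH(1)] uH(2)] w(1) \<Gamma>.rev_cancel])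
    then have lifts: "lifts_in_K w" using w(2) by (rule reduced_lifts_in_K)
    obtain y z where yz: "w = y @ z" "x = racg_word \<Gamma> (u @ y)" using g(4) w(3) \<Gamma>.set_word_path by blast
    have yl: "y \<in> lists (pverts \<Gamma>)" "z \<in> lists (pverts \<Gamma>)" using w(1) yz(1) by auto
    obtain y' where y': "y' \<in> lists (pverts \<Delta>)" "map col y' = y" using ex_lift yl by blast
    obtain z' where z': "z' \<in> lists (pverts \<Delta>)" "map col z' = z" using ex_lift yl by blast
    have l: "y' @ z' \<in> lists (pverts \<Delta>)" "map col (y' @ z') = w" using y' z' yz by auto
    then have lK: "y' @ z' \<in> K_words" using lifts unfolding lifts_in_K_def by blast
    have "\<Delta>.reduced (y' @ z')" using lift_reduced [of "y' @ z'"] l(2) w(2) by simp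
    then have "geodesic_between \<Delta>.C (racg_word \<Delta> []) (\<Delta>.word_path [] (y' @ z')) (racg_word \<Delta> (y' @ z'))"
      using \<Delta>.geodesic_word_path [of "[]" "y' @ z'"] l(1) by simp
    moreover have "racg_word \<Delta> [] \<in> K" "racg_word \<Delta> (y' @ z') \<in> K"
      using subgroup.one_closed [OF subgroup_K] \<Delta>.rw_one lK by (simp_all add: K_words_def)
    moreover have "racg_word \<Delta> y' \<in> set (\<Delta>.word_path [] (y' @ z'))"
      unfolding \<Delta>.set_word_path by auto
    ultimately obtain k where k: "k \<in> K" "path_dist \<Delta>.C (racg_word \<Delta> y') k \<le> r" using r by blast
    have "k \<in> carrier (racg \<Delta>)" using k(1) subgroup.mem_carrier [OF subgroup_K] by blast
    then obtain m where m: "k = racg_word \<Delta> m" "m \<in> lists (pverts \<Delta>)" by (rule \<Delta>.carrierE)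
    then have "map col m \<in> H_words" using k(1) K_words_project [of m] by (simp add: K_words_def)
    then have um: "u @ map col m \<in> H_words" using H_words_append uH(1) by blast
    have "\<Gamma>.weq (rev y @ rev u @ u @ map col m) (rev y @ map col m)"
      by (rule \<Gamma>.app_left [OF \<Gamma>.rev_cancel])
    then have "\<Gamma>.wdist (u @ y) (u @ map col m) = \<Gamma>.wlen (map col (rev y' @ m))"
      unfolding \<Gamma>.wdist_def using y'(2) \<Gamma>.wlen_cong by (simp add: rev_map [symmetric])
    also have "\<dots> \<le> \<Delta>.wdist y' m" unfolding \<Delta>.wdist_def by (rule wlen_map_col_le)
    also have "\<dots> \<le> r" using k(2) m y'(1) \<Delta>.path_dist_words by simp
    finally have "path_dist \<Gamma>.C x (racg_word \<Gamma> (u @ map col m)) \<le> r"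
      using \<Gamma>.path_dist_words [of "u @ y" "u @ map col m"] um u(2) yl yz(2) by (simp add: H_words_def)
    then show ?thesis using um by (auto simp: H_words_def)
  qed
  then show ?thesis unfolding quasiconvex_def by blast
qed

theorem torsion_free_lifts:
  assumes "torsion_free (racg \<Gamma>) H" shows "torsion_free (racg \<Delta>) K"
  unfolding torsion_free_def
proof (intro ballI allI impI)
  fix x and n :: nat assume x: "x \<in> K" "n > 0" "x [^]\<^bsub>racg \<Delta>\<^esub> n = \<one>\<^bsub>racg \<Delta>\<^esub>"
  have "x \<in> carrier (racg \<Delta>)" using x(1) subgroup.mem_carrier [OF subgroup_K] by blast
  then obtain l where l: "x = racg_word \<Delta> l" "l \<in> lists (pverts \<Delta>)" by (rule \<Delta>.carrierE)
  then have h: "map col l \<in> H_words" using x(1) K_words_project by (simp add: K_words_def)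
  have pow: "\<Delta>.weq (\<Delta>.wpow l n) []"
    using x(3) \<Delta>.rw_pow [OF l(2)] \<Delta>.rw_eq_iff \<Delta>.wpow_lists l \<Delta>.rw_one by simp
  have "map col (\<Delta>.wpow l n) = \<Gamma>.wpow (map col l) n" by (induction n) auto
  then have "\<Gamma>.weq (\<Gamma>.wpow (map col l) n) []" using map_col_weq [OF pow] by simp
  then have "racg_word \<Gamma> (map col l) [^]\<^bsub>racg \<Gamma>\<^esub> n = \<one>\<^bsub>racg \<Gamma>\<^esub>"
    using \<Gamma>.rw_pow \<Gamma>.rw_eq_iff \<Gamma>.wpow_lists map_col_lists l(2) \<Gamma>.rw_one by simp
  then have "racg_word \<Gamma> (map col l) = \<one>\<^bsub>racg \<Gamma>\<^esub>"
    using assms h x(2) unfolding torsion_free_def H_words_def by blast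
  then have "\<Gamma>.weq (map col l) []" using \<Gamma>.rw_eq_iff map_col_lists l(2) \<Gamma>.rw_one by simp
  then have "\<Delta>.weq l []" using kernel_torsion_free pow x(2) by blast
  then show "x = \<one>\<^bsub>racg \<Delta>\<^esub>" using \<Delta>.rw_eq_iff l \<Delta>.rw_one by simp
qed

theorem normal_descends:
  assumes "K \<lhd> racg \<Delta>" shows "H \<lhd> racg \<Gamma>"
  unfolding \<Gamma>.racg.normal_inv_iff
proof (intro conjI ballI)
  show "subgroup H (racg \<Gamma>)" by (rule subgroup_H)
  fix g h assume g: "g \<in> carrier (racg \<Gamma>)" and h: "h \<in> H"
  obtain u where u: "g = racg_word \<Gamma> u" "u \<in> lists (pverts \<Gamma>)" using g by (rule \<Gamma>.carrierE)
  obtain w where w: "w \<in> lists (pverts \<Gamma>)" "h = racg_word \<Gamma> w" "lifts_in_K w" using H_liftable h by blast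
  obtain u' where u': "u' \<in> lists (pverts \<Delta>)" "map col u' = u" using ex_lift u by blast
  obtain w' where w': "w' \<in> lists (pverts \<Delta>)" "map col w' = w" using ex_lift w by blast
  have "racg_word \<Delta> w' \<in> K" using w' w(3) by (auto simp: lifts_in_K_def K_words_def)
  then have "racg_word \<Delta> u' \<otimes>\<^bsub>racg \<Delta>\<^esub> racg_word \<Delta> w' \<otimes>\<^bsub>racg \<Delta>\<^esub> inv\<^bsub>racg \<Delta>\<^esub> (racg_word \<Delta> u') \<in> K"
    using assms \<Delta>.rw_closed [OF u'(1)] unfolding \<Delta>.racg.normal_inv_iff by blast
  then have "u' @ w' @ rev u' \<in> K_words"
    using \<Delta>.rw_conj [OF u'(1) w'(1)] u'(1) w'(1) by (auto simp: K_words_def)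
  then have "map col (u' @ w' @ rev u') \<in> H_words" by (rule K_words_project)
  then have "u @ w @ rev u \<in> H_words" using u'(2) w'(2) by (simp add: rev_map [symmetric])
  then show "g \<otimes>\<^bsub>racg \<Gamma>\<^esub> h \<otimes>\<^bsub>racg \<Gamma>\<^esub> inv\<^bsub>racg \<Gamma>\<^esub> g \<in> H"
    using \<Gamma>.rw_conj [OF u(2) w(1)] u w(1,2) by (auto simp: H_words_def)
qed

end

section \<open>Partite graphs without short cycles\<close>

lemma base5_digits_zero:
  fixes k :: "nat \<Rightarrow> int"
  assumes "\<And>m. \<bar>k m\<bar> < 5" "(\<Sum>m<M. k m * 5 ^ m) = 0" "m < M"
  shows "k m = 0"
  using assms
proof (induction M arbitrary: k m)
  case (Suc M)
  have eq: "k 0 + 5 * (\<Sum>m<M. k (Suc m) * 5 ^ m) = 0"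
    using Suc.prems(2) unfolding sum.lessThan_Suc_shift sum_distrib_left by (simp add: mult_ac)
  then have "5 dvd k 0" by presburger
  then have k0: "k 0 = 0" using Suc.prems(1) [of 0] dvd_imp_le_int [of "k 0" 5] by fastforce
  then have "(\<Sum>m<M. k (Suc m) * 5 ^ m) = 0" using eq by simp
  then have "k (Suc j) = 0" if "j < M" for j
    using Suc.IH [of "\<lambda>m. k (Suc m)"] Suc.prems(1) that by blast
  then show ?case using k0 Suc.prems(3) by (cases m) auto
qed simp

text \<open>
  Uniqueness of base five digits: in a vanishing sum of four signed powers, the coefficient of each
  power vanishes, since it is less than five in absolute value.
\<close>

lemma four_signed_powers:
  fixes e1 e2 e3 e4 :: int
  assumes "\<bar>e1\<bar> \<le> 1" "\<bar>e2\<bar> \<le> 1" "\<bar>e3\<bar> \<le> 1" "\<bar>e4\<bar> \<le> 1"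
    and "e1 * 5 ^ a + e2 * 5 ^ b + e3 * 5 ^ c + e4 * 5 ^ d = 0"
  shows "e1 + (if b = a then e2 else 0) + (if c = a then e3 else 0) + (if d = a then e4 else 0) = 0"
proof -
  define k where "k m = (if m = a then e1 else 0) + (if m = b then e2 else 0)
      + (if m = c then e3 else 0) + (if m = d then e4 else 0)" for m
  define M where "M = Suc (a + b + c + d)"
  have M: "a < M" "b < M" "c < M" "d < M" unfolding M_def by auto
  have single: "(\<Sum>m<M. (if m = i then e else 0) * 5 ^ m) = e * 5 ^ i" if "i < M" for i and e :: int
  proof -
    have "(\<Sum>m<M. (if m = i then e else 0) * 5 ^ m) = (\<Sum>m<M. if m = i then e * 5 ^ m else 0)"
      by (rule sum.cong) auto
    also have "\<dots> = e * 5 ^ i" using that sum.delta [of "{..<M}" i] by auto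
    finally show ?thesis .
  qed
  have "(\<Sum>m<M. k m * 5 ^ m) = e1 * 5 ^ a + e2 * 5 ^ b + e3 * 5 ^ c + e4 * 5 ^ d"
    unfolding k_def distrib_right sum.distrib single [OF M(1)] single [OF M(2)] single [OF M(3)] single [OF M(4)] ..
  then have sum: "(\<Sum>m<M. k m * 5 ^ m) = 0" using assms(5) by (simp only:)
  have small: "\<bar>k m\<bar> < 5" for m
  proof -
    have "\<bar>if P then e else 0\<bar> \<le> 1" if "\<bar>e\<bar> \<le> 1" for P and e :: int using that by simp
    from this [OF assms(1), of "m = a"] this [OF assms(2), of "m = b"]
      this [OF assms(3), of "m = c"] this [OF assms(4), of "m = d"]
    show ?thesis unfolding k_def by linarith
  qed
  have "k a = 0" by (rule base5_digits_zero [OF small sum M(1)])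
  then show ?thesis unfolding k_def by (simp only: eq_commute [of a] simp_thms if_True)
qed

text \<open>
  Part \<open>i\<close> will be a copy of the integers modulo \<open>N\<close>, and the two edges from one of its vertices to part \<open>j\<close>
  shift by \<open>gap i j 0\<close> and \<open>gap i j 1\<close>. The shifts for different unordered pairs of parts
  are different powers of five; the sign encodes the direction in which an edge is traversed.
\<close>

definition gap :: "nat \<Rightarrow> nat \<Rightarrow> nat \<Rightarrow> int" where
  "gap i j b = (if i < j then 1 else -1) * 5 ^ (2 * prod_encode (min i j, max i j) + b)"

lemma gap_swap: "i \<noteq> j \<Longrightarrow> gap j i b = - gap i j b"
  by (auto simp: gap_def min_def max_def)

lemma gap_exponent_eq:
  assumes "2 * prod_encode (min i j, max i j) + b = 2 * prod_encode (min k l, max k l) + c"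
    "b < 2" "c < 2"
  shows "i = k \<and> j = l \<or> i = l \<and> j = k" "b = c"
proof -
  have "b = c \<and> prod_encode (min i j, max i j) = prod_encode (min k l, max k l)"
    using assms by presburger
  then show "i = k \<and> j = l \<or> i = l \<and> j = k" "b = c"
    by (auto simp: min_def max_def split: if_splits)
qed

text \<open>
  Large \<open>N\<close> makes congruences between short sums of shifts equalities. As \<open>N\<close> is coprime to ten, the
  difference \<open>4 \<cdot> 5\<^sup>m\<close> of the two shifts between a pair of parts generates the integers modulo \<open>N\<close>, so
  that the edges between the two parts form a single cycle.
\<close>

locale shift_graph = racg_graph \<Gamma> for \<Gamma> :: "'a pair_pre_digraph" +
  fixes idx :: "'a \<Rightarrow> nat" and N B :: nat
  assumes inj: "inj_on idx (pverts \<Gamma>)"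
    and bound: "\<And>s t. s \<in> pverts \<Gamma> \<Longrightarrow> t \<in> pverts \<Gamma> \<Longrightarrow>
        2 * prod_encode (min (idx s) (idx t), max (idx s) (idx t)) + 1 \<le> B"
    and large: "4 * 5 ^ B < N" and coprime: "coprime 10 N"
begin

definition part :: "'a \<Rightarrow> nat set" where
  "part s = {prod_encode (idx s, x) | x. x < N}"

definition joined :: "'a \<Rightarrow> nat \<Rightarrow> 'a \<Rightarrow> nat \<Rightarrow> bool" where
  "joined s x t y \<longleftrightarrow> (s, t) \<in> parcs \<Gamma> \<and> x < N \<and> y < N \<and>
     (\<exists>b<2. [int y - int x = gap (idx s) (idx t) b] (mod int N))"

definition shift :: "nat pair_pre_digraph" where
  "shift = \<lparr> pverts = (\<Union>s\<in>pverts \<Gamma>. part s),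
     parcs = {(prod_encode (idx s, x), prod_encode (idx t, y)) | s x t y. joined s x t y} \<rparr>"

lemma N_pos: "N > 0" using large by simp

lemma idx_neq: "(s, t) \<in> parcs \<Gamma> \<Longrightarrow> idx s \<noteq> idx t"
  using arcD inj by (metis inj_onD)

lemma joined_sym: "joined s x t y \<Longrightarrow> joined t y s x"
proof -
  assume j: "joined s x t y"
  then obtain b where b: "b < 2" "[int y - int x = gap (idx s) (idx t) b] (mod int N)"
    unfolding joined_def by blast
  have "idx s \<noteq> idx t" using j idx_neq unfolding joined_def by blast
  moreover have "[- (int y - int x) = - gap (idx s) (idx t) b] (mod int N)"
    using b(2) cong_minus_minus_iff by blast
  ultimately have "[int x - int y = gap (idx t) (idx s) b] (mod int N)"
    using gap_swap [of "idx s" "idx t" b] by simp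
  then show ?thesis using j b(1) arcD unfolding joined_def by blast
qed

lemma cong_less_eq: "x < N \<Longrightarrow> y < N \<Longrightarrow> [int x = int y] (mod int N) \<Longrightarrow> x = y"
  using cong_less_modulus_unique_nat cong_int_iff by blast

lemma shift_arc_iff:
  assumes "s \<in> pverts \<Gamma>" "t \<in> pverts \<Gamma>"
  shows "(prod_encode (idx s, x), prod_encode (idx t, y)) \<in> parcs shift \<longleftrightarrow> joined s x t y"
proof
  assume "(prod_encode (idx s, x), prod_encode (idx t, y)) \<in> parcs shift"
  then obtain s' t' where "idx s = idx s'" "idx t = idx t'" "joined s' x t' y"
    unfolding shift_def by auto
  then show "joined s x t y" using assms arcD inj_onD [OF inj] unfolding joined_def by metis
qed (auto simp: shift_def)

lemma shift_arcE:
  assumes "(u, v) \<in> parcs shift"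
  obtains s x t y where "u = prod_encode (idx s, x)" "v = prod_encode (idx t, y)" "joined s x t y"
    "s \<in> pverts \<Gamma>" "t \<in> pverts \<Gamma>"
proof -
  obtain s x t y where "u = prod_encode (idx s, x)" "v = prod_encode (idx t, y)" "joined s x t y"
    using assms unfolding shift_def by auto
  then show ?thesis using that arcD unfolding joined_def by blast
qed

lemma joinedE:
  assumes "joined s x t y"
  obtains e m b where "e = 1 \<or> e = -1" "e = 1 \<longleftrightarrow> idx s < idx t" 
    "m = 2 * prod_encode (min (idx s) (idx t), max (idx s) (idx t)) + b" "b < 2"
    "m \<le> B" "[int y - int x = e * 5 ^ m] (mod int N)"
proof -
  obtain b where b: "b < 2" "[int y - int x = gap (idx s) (idx t) b] (mod int N)"
    using assms unfolding joined_def by blast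
  have "2 * prod_encode (min (idx s) (idx t), max (idx s) (idx t)) + 1 \<le> B"
    using bound arcD assms unfolding joined_def by blast
  then show ?thesis
    using that [of "if idx s < idx t then 1 else -1" _ b] b unfolding gap_def by simp
qed

lemma small_sum_zero:
  assumes "[e1 * 5 ^ a + e2 * 5 ^ b + e3 * 5 ^ c + e4 * 5 ^ d = 0] (mod int N)"
    and e: "\<bar>e1\<bar> \<le> 1" "\<bar>e2\<bar> \<le> 1" "\<bar>e3\<bar> \<le> 1" "\<bar>e4\<bar> \<le> 1"
    and m: "a \<le> B" "b \<le> B" "c \<le> B" "d \<le> B"
  shows "e1 * 5 ^ a + e2 * 5 ^ b + e3 * 5 ^ c + e4 * 5 ^ d = 0"
proof -
  have t: "\<bar>x * 5 ^ k\<bar> \<le> 5 ^ B" if "\<bar>x\<bar> \<le> 1" "k \<le> B" for x :: int and k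
  proof -
    have "\<bar>x * 5 ^ k\<bar> = \<bar>x\<bar> * 5 ^ k" by (simp add: abs_mult)
    also have "\<dots> \<le> 1 * 5 ^ k" using that by (intro mult_right_mono) auto
    also have "\<dots> \<le> 5 ^ B" using that by simp
    finally show ?thesis .
  qed
  have "int (4 * 5 ^ B) < int N" using large by (simp only: of_nat_less_iff)
  then have "4 * 5 ^ B < int N" by simp
  then have "\<bar>e1 * 5 ^ a + e2 * 5 ^ b + e3 * 5 ^ c + e4 * 5 ^ d\<bar> < int N"
    using t [OF e(1) m(1)] t [OF e(2) m(2)] t [OF e(3) m(3)] t [OF e(4) m(4)] by linarith
  moreover have "int N dvd e1 * 5 ^ a + e2 * 5 ^ b + e3 * 5 ^ c + e4 * 5 ^ d"
    using assms(1) by (simp only: cong_0_iff)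
  moreover have "x = 0" if "\<bar>x\<bar> < int N" "int N dvd x" for x
    using that zdvd_not_zless [of "\<bar>x\<bar>" "int N"] by (cases "x = 0") auto
  ultimately show ?thesis by blast
qed

lemma shift_no_triangle:
  assumes "(u, v) \<in> parcs shift" "(v, w) \<in> parcs shift" "(w, u) \<in> parcs shift" shows False
proof -
  obtain i x j y where 1: "u = prod_encode (idx i, x)" "v = prod_encode (idx j, y)" "joined i x j y"
    "i \<in> pverts \<Gamma>" "j \<in> pverts \<Gamma>" using assms(1) by (rule shift_arcE)
  obtain j' y' k z where 2: "v = prod_encode (idx j', y')" "w = prod_encode (idx k, z)"
    "joined j' y' k z" "j' \<in> pverts \<Gamma>" "k \<in> pverts \<Gamma>" using assms(2) by (rule shift_arcE)
  have [simp]: "j' = j" "y' = y" using 1 2 inj_onD [OF inj] by auto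
  have 3: "joined k z i x" using assms(3) shift_arc_iff 1 2 by metis
  obtain e1 a b1 where e1: "e1 = 1 \<or> e1 = -1" "e1 = 1 \<longleftrightarrow> idx i < idx j" 
    "a = 2 * prod_encode (min (idx i) (idx j), max (idx i) (idx j)) + b1" "b1 < 2"
    "a \<le> B" "[int y - int x = e1 * 5 ^ a] (mod int N)" using 1(3) by (rule joinedE)
  obtain e2 b b2 where e2: "e2 = 1 \<or> e2 = -1" "e2 = 1 \<longleftrightarrow> idx j < idx k" 
    "b = 2 * prod_encode (min (idx j) (idx k), max (idx j) (idx k)) + b2" "b2 < 2"
    "b \<le> B" "[int z - int y = e2 * 5 ^ b] (mod int N)" using 2(3) by (auto elim: joinedE)
  obtain e3 c b3 where e3: "e3 = 1 \<or> e3 = -1" "e3 = 1 \<longleftrightarrow> idx k < idx i" 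
    "c = 2 * prod_encode (min (idx k) (idx i), max (idx k) (idx i)) + b3" "b3 < 2"
    "c \<le> B" "[int x - int z = e3 * 5 ^ c] (mod int N)" using 3 by (rule joinedE)
  have ne: "idx i \<noteq> idx j" "idx j \<noteq> idx k" "idx k \<noteq> idx i"
    using 1 2 3 idx_neq unfolding joined_def by auto
  have ab: "\<bar>e1\<bar> \<le> 1" "\<bar>e2\<bar> \<le> 1" "\<bar>e3\<bar> \<le> 1"
    using e1(1) e2(1) e3(1) by auto
  have "[(int y - int x) + (int z - int y) + (int x - int z) = e1 * 5 ^ a + e2 * 5 ^ b + e3 * 5 ^ c] (mod int N)"
    using e1(6) e2(6) e3(6) by (intro cong_add)
  then have "[e1 * 5 ^ a + e2 * 5 ^ b + e3 * 5 ^ c + 0 * 5 ^ 0 = 0] (mod int N)"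
    using cong_sym by simp
  then have z: "e1 * 5 ^ a + e2 * 5 ^ b + e3 * 5 ^ c + 0 * 5 ^ 0 = 0"
    by (rule small_sum_zero) (use e1(5) e2(5) e3(5) ab in simp_all)
  have "e1 + (if b = a then e2 else 0) + (if c = a then e3 else 0) + (if (0::nat) = a then 0 else 0) = 0"
    by (rule four_signed_powers) (use z ab in simp_all)
  moreover have "b \<noteq> a" using gap_exponent_eq(1) [of "idx j" "idx k" b2 "idx i" "idx j" b1] e1(3,4) e2(3,4) ne by auto
  moreover have "c \<noteq> a" using gap_exponent_eq(1) [of "idx k" "idx i" b3 "idx i" "idx j" b1] e1(3,4) e3(3,4) ne by auto
  ultimately show False using e1(1) by auto
qed

text \<open>
  The four shifts along the closed path add up to zero, so the first of them is cancelled by another one. If that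
  one belongs to a neighbouring edge, this edge is traversed back immediately. If it belongs to
  the opposite edge, then that edge runs between the same two parts in the opposite direction,
  and the second edge would join two vertices of one part.
\<close>

lemma shift_no_square:
  assumes "(u, v) \<in> parcs shift" "(v, w) \<in> parcs shift" "(w, r) \<in> parcs shift" "(r, u) \<in> parcs shift"
  shows "u = w \<or> v = r"
proof -
  obtain i x j y where 1: "u = prod_encode (idx i, x)" "v = prod_encode (idx j, y)" "joined i x j y"
    "i \<in> pverts \<Gamma>" "j \<in> pverts \<Gamma>" using assms(1) by (rule shift_arcE)
  obtain k z l o' where 2: "w = prod_encode (idx k, z)" "r = prod_encode (idx l, o')"
    "joined k z l o'" "k \<in> pverts \<Gamma>" "l \<in> pverts \<Gamma>" using assms(3) by (rule shift_arcE)
  have 3: "joined j y k z" using assms(2) shift_arc_iff 1 2 by metis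
  have 4: "joined l o' i x" using assms(4) shift_arc_iff 1 2 by metis
  have lt: "x < N" "y < N" "z < N" "o' < N" using 1 2 unfolding joined_def by auto
  obtain e1 a b1 where e1: "e1 = 1 \<or> e1 = -1" "e1 = 1 \<longleftrightarrow> idx i < idx j" 
    "a = 2 * prod_encode (min (idx i) (idx j), max (idx i) (idx j)) + b1" "b1 < 2"
    "a \<le> B" "[int y - int x = e1 * 5 ^ a] (mod int N)" using 1(3) by (rule joinedE)
  obtain e2 b b2 where e2: "e2 = 1 \<or> e2 = -1" "e2 = 1 \<longleftrightarrow> idx j < idx k" 
    "b = 2 * prod_encode (min (idx j) (idx k), max (idx j) (idx k)) + b2" "b2 < 2"
    "b \<le> B" "[int z - int y = e2 * 5 ^ b] (mod int N)" using 3 by (rule joinedE)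
  obtain e3 c b3 where e3: "e3 = 1 \<or> e3 = -1" "e3 = 1 \<longleftrightarrow> idx k < idx l" 
    "c = 2 * prod_encode (min (idx k) (idx l), max (idx k) (idx l)) + b3" "b3 < 2"
    "c \<le> B" "[int o' - int z = e3 * 5 ^ c] (mod int N)" using 2(3) by (rule joinedE)
  obtain e4 d b4 where e4: "e4 = 1 \<or> e4 = -1" "e4 = 1 \<longleftrightarrow> idx l < idx i" 
    "d = 2 * prod_encode (min (idx l) (idx i), max (idx l) (idx i)) + b4" "b4 < 2"
    "d \<le> B" "[int x - int o' = e4 * 5 ^ d] (mod int N)" using 4 by (rule joinedE)
  have ne: "idx i \<noteq> idx j" "idx j \<noteq> idx k" "idx k \<noteq> idx l" "idx l \<noteq> idx i"
    using 1 2 3 4 idx_neq unfolding joined_def by auto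
  have ab: "\<bar>e1\<bar> \<le> 1" "\<bar>e2\<bar> \<le> 1" "\<bar>e3\<bar> \<le> 1" "\<bar>e4\<bar> \<le> 1"
    using e1(1) e2(1) e3(1) e4(1) by auto
  have "[(int y - int x) + (int z - int y) + (int o' - int z) + (int x - int o')
      = e1 * 5 ^ a + e2 * 5 ^ b + e3 * 5 ^ c + e4 * 5 ^ d] (mod int N)"
    using e1(6) e2(6) e3(6) e4(6) by (intro cong_add)
  then have "[e1 * 5 ^ a + e2 * 5 ^ b + e3 * 5 ^ c + e4 * 5 ^ d = 0] (mod int N)"
    using cong_sym by simp
  then have zz: "e1 * 5 ^ a + e2 * 5 ^ b + e3 * 5 ^ c + e4 * 5 ^ d = 0"
    by (rule small_sum_zero) (use e1(5) e2(5) e3(5) e4(5) ab in simp_all)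
  have "e1 + (if b = a then e2 else 0) + (if c = a then e3 else 0) + (if d = a then e4 else 0) = 0"
    by (rule four_signed_powers) (use zz ab in simp_all)
  then have "b = a \<and> e2 = - e1 \<or> c = a \<and> e3 = - e1 \<or> d = a \<and> e4 = - e1"
    using e1(1) e2(1) e3(1) e4(1) by (auto split: if_splits)
  then show ?thesis
  proof (elim disjE conjE)
    assume A: "b = a" "e2 = - e1"
    then have "idx i = idx k"
      using gap_exponent_eq(1) [of "idx j" "idx k" b2 "idx i" "idx j" b1] e1(3,4) e2(3,4) ne by auto
    moreover have "[(int y - int x) + (int z - int y) = e1 * 5 ^ a + e2 * 5 ^ b] (mod int N)"
      using e1(6) e2(6) by (intro cong_add)
    then have "[int z - int x = 0] (mod int N)" using A by simp
    then have "z = x" using lt cong_less_eq cong_diff_iff_cong_0 by blast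
    ultimately show ?thesis using 1 2 by simp
  next
    assume A: "d = a" "e4 = - e1"
    then have "idx j = idx l"
      using gap_exponent_eq(1) [of "idx l" "idx i" b4 "idx i" "idx j" b1] e1(3,4) e4(3,4) ne by auto
    moreover have "[(int y - int x) + (int x - int o') = e1 * 5 ^ a + e4 * 5 ^ d] (mod int N)"
      using e1(6) e4(6) by (intro cong_add)
    then have "[int y - int o' = 0] (mod int N)" using A by simp
    then have "y = o'" using lt cong_less_eq cong_diff_iff_cong_0 by blast
    ultimately show ?thesis using 1 2 by simp
  next
    assume A: "c = a" "e3 = - e1"
    then have "idx k = idx i \<and> idx l = idx j \<or> idx k = idx j \<and> idx l = idx i"
      using gap_exponent_eq(1) [of "idx k" "idx l" b3 "idx i" "idx j" b1] e1(3,4) e3(3,4) A(1) by auto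
    then show ?thesis using e1(1,2) e3(1,2) A(2) ne by auto
  qed
qed

text \<open>
  Two vertices of a part have a common neighbour if they differ by the difference of the two shifts,
  which is invertible modulo \<open>N\<close>.
\<close>

lemma part_connected:
  assumes st: "(s, t) \<in> parcs \<Gamma>" and X: "X \<subseteq> part s" "X \<noteq> {}"
    and closed: "\<And>a a' b. a \<in> X \<Longrightarrow> a' \<in> part s \<Longrightarrow> b \<in> part t \<Longrightarrow>
      (a, b) \<in> parcs shift \<Longrightarrow> (a', b) \<in> parcs shift \<Longrightarrow> a' \<in> X"
  shows "X = part s"
proof -
  define \<delta> where "\<delta> = gap (idx s) (idx t) 1 - gap (idx s) (idx t) 0"
  have \<delta>: "\<delta> = (if idx s < idx t then 4 else -4) * 5 ^ (2 * prod_encode (min (idx s) (idx t), max (idx s) (idx t)))"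
    by (simp add: \<delta>_def gap_def)
  have "coprime (int 10) (int N)" using coprime by (simp only: coprime_int_iff)
  then have "coprime (2 * 5) (int N)" by simp
  then have "coprime 2 (int N)" "coprime 5 (int N)" using coprime_mult_left_iff by blast+
  moreover from this have "coprime (2 * 2) (int N)" by (simp only: coprime_mult_left_iff)
  ultimately have "coprime 4 (int N)" "coprime (-4) (int N)" "\<And>k. coprime (5 ^ k) (int N)" by simp_all
  then have "coprime \<delta> (int N)" unfolding \<delta> coprime_mult_left_iff by auto
  then obtain q where q: "[\<delta> * q = 1] (mod int N)" using cong_solve_coprime_int by blast
  define place where "place x = nat (x mod int N)" for x :: int
  have place: "place x < N" "[int (place x) = x] (mod int N)" for x
    using N_pos by (simp_all add: place_def nat_less_iff cong_def)
  have sv: "s \<in> pverts \<Gamma>" "t \<in> pverts \<Gamma>" using arcD st by auto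
  have step: "prod_encode (idx s, place (x + \<delta>)) \<in> X" if "prod_encode (idx s, place x) \<in> X" for x
  proof (rule closed [OF that])
    let ?y = "place (x + gap (idx s) (idx t) 1)"
    show "prod_encode (idx s, place (x + \<delta>)) \<in> part s" "prod_encode (idx t, ?y) \<in> part t"
      using place unfolding part_def by blast+
    have "[int ?y - int (place x) = (x + gap (idx s) (idx t) 1) - x] (mod int N)"
      using place by (intro cong_diff)
    then have "joined s (place x) t ?y"
      unfolding joined_def using place st by (intro conjI exI [of _ 1]) auto
    then show "(prod_encode (idx s, place x), prod_encode (idx t, ?y)) \<in> parcs shift"
      using shift_arc_iff sv by blast
    have "[int ?y - int (place (x + \<delta>)) = (x + gap (idx s) (idx t) 1) - (x + \<delta>)] (mod int N)"
      using place by (intro cong_diff)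
    then have "joined s (place (x + \<delta>)) t ?y"
      unfolding joined_def using place st by (intro conjI exI [of _ 0]) (auto simp: \<delta>_def)
    then show "(prod_encode (idx s, place (x + \<delta>)), prod_encode (idx t, ?y)) \<in> parcs shift"
      using shift_arc_iff sv by blast
  qed
  obtain x0 where x0: "x0 < N" "prod_encode (idx s, x0) \<in> X" using X unfolding part_def by blast
  have p0: "place (int x0) = x0" using x0(1) by (simp add: place_def)
  have many: "prod_encode (idx s, place (int x0 + int n * \<delta>)) \<in> X" for n
  proof (induction n)
    case 0
    then show ?case using x0 p0 by simp
  next
    case (Suc n)
    have "int x0 + int (Suc n) * \<delta> = (int x0 + int n * \<delta>) + \<delta>" by (simp add: algebra_simps)
    then show ?case using step [OF Suc] by metis
  qed
  have "prod_encode (idx s, x) \<in> X" if "x < N" for x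
  proof -
    define n where "n = place (q * (int x - int x0))"
    have "[int n * \<delta> = (q * (int x - int x0)) * \<delta>] (mod int N)"
      unfolding n_def by (intro cong_mult place cong_refl)
    also have "(q * (int x - int x0)) * \<delta> = (\<delta> * q) * (int x - int x0)" by simp
    also have "[\<dots> = 1 * (int x - int x0)] (mod int N)" by (intro cong_mult q cong_refl)
    finally have "[int n * \<delta> = int x - int x0] (mod int N)" by simp
    then have "[int x0 + int n * \<delta> = int x0 + (int x - int x0)] (mod int N)"
      by (intro cong_add cong_refl)
    then have "[int (place (int x0 + int n * \<delta>)) = int x] (mod int N)"
      using place(2) cong_trans by fastforce
    then have "place (int x0 + int n * \<delta>) = x" using cong_less_eq place(1) that by blast
    then show ?thesis using many by metis
  qed
  then show ?thesis using X(1) unfolding part_def by blast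
qed

lemma part_neighbour:
  assumes st: "(s, t) \<in> parcs \<Gamma>" and "a \<in> part s"
  obtains b where "b \<in> part t" "(a, b) \<in> parcs shift" "(b, a) \<in> parcs shift"
proof -
  obtain x where x: "a = prod_encode (idx s, x)" "x < N" using assms(2) unfolding part_def by blast
  define y where "y = nat ((int x + gap (idx s) (idx t) 0) mod int N)"
  have y: "y < N" "[int y = int x + gap (idx s) (idx t) 0] (mod int N)"
    using N_pos by (simp_all add: y_def nat_less_iff cong_def)
  have "[int y - int x = int x + gap (idx s) (idx t) 0 - int x] (mod int N)"
    using y(2) by (intro cong_diff cong_refl)
  then have j: "joined s x t y" unfolding joined_def using st x y by (intro conjI exI [of _ 0]) auto
  show ?thesis
    by (rule that [of "prod_encode (idx t, y)"])
      (use j joined_sym [OF j] arcD [OF st] shift_arc_iff x y in \<open>auto simp: part_def\<close>)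
qed

lemma finite_part: "finite (part s)" "card (part s) = N" "part s \<noteq> {}"
proof -
  have "part s = (\<lambda>x. prod_encode (idx s, x)) ` {..<N}" unfolding part_def by auto
  moreover have "inj_on (\<lambda>x. prod_encode (idx s, x)) {..<N}" by (auto intro: inj_onI)
  ultimately show "finite (part s)" "card (part s) = N" by (simp_all add: card_image)
  then show "part s \<noteq> {}" using N_pos by auto
qed

lemma part_disjoint: "s \<in> pverts \<Gamma> \<Longrightarrow> t \<in> pverts \<Gamma> \<Longrightarrow> s \<noteq> t \<Longrightarrow> part s \<inter> part t = {}"
  unfolding part_def using inj by (auto dest: inj_onD)

lemma card_shift: "card (pverts shift) = card (pverts \<Gamma>) * N"
proof -
  interpret pair_graph \<Gamma> by (rule graph)
  have "card (pverts shift) = (\<Sum>s\<in>pverts \<Gamma>. card (part s))"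
    unfolding shift_def using pair_finite_verts finite_part part_disjoint
    by (simp add: card_UN_disjoint)
  then show ?thesis by (simp add: finite_part)
qed

lemma pair_graph_shift: "pair_graph shift"
proof -
  interpret pair_graph \<Gamma> by (rule graph)
  have fin: "finite (pverts shift)" unfolding shift_def using pair_finite_verts finite_part by simp
  have sub: "parcs shift \<subseteq> pverts shift \<times> pverts shift"
    unfolding shift_def part_def using arcD by (fastforce simp: joined_def)
  have symm: "(v, u) \<in> parcs shift" if "(u, v) \<in> parcs shift" for u v
    using that joined_sym unfolding shift_def by (auto, blast)
  have loop: "fst e \<noteq> snd e" if "e \<in> parcs shift" for e
    using that idx_neq unfolding shift_def joined_def by auto
  show ?thesis
    by unfold_locales
      (use fin sub symm loop finite_subset [OF sub] in \<open>auto simp: symmetric_def sym_def\<close>)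
qed

lemma part_arcD:
  assumes "(a, b) \<in> parcs shift" "a \<in> part s" "b \<in> part t" "s \<in> pverts \<Gamma>" "t \<in> pverts \<Gamma>"
  shows "(s, t) \<in> parcs \<Gamma>"
proof -
  obtain x y where "a = prod_encode (idx s, x)" "b = prod_encode (idx t, y)"
    using assms unfolding part_def by blast
  then show ?thesis using assms shift_arc_iff unfolding joined_def by blast
qed

lemma part_pair_connected:
  assumes st: "(s, t) \<in> parcs \<Gamma>"
  shows "Digraph_Component.connected (with_proj shift \<restriction> (part s \<union> part t))"
proof -
  define P where "P = with_proj (mk_symmetric (with_proj shift \<restriction> (part s \<union> part t)))"
  have vP: "verts P = part s \<union> part t" unfolding P_def by (simp add: mk_symmetric_def)
  have aP: "(a, b) \<in> arcs_ends P" if "(a, b) \<in> parcs shift" "a \<in> part s \<union> part t" "b \<in> part s \<union> part t" for a b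
    unfolding P_def using that by (force simp: mk_symmetric_def)
  have step: "u \<rightarrow>\<^sup>*\<^bsub>P\<^esub> b" if "u \<rightarrow>\<^sup>*\<^bsub>P\<^esub> a" "(a, b) \<in> parcs shift" "b \<in> part s \<union> part t" for u a b
  proof -
    have a: "a \<in> part s \<union> part t" using reachable_in_vertsE that(1) vP by metis
    show ?thesis using that(1) aP [OF that(2) a that(3)] that(3) unfolding reachable_def vP
      by (rule rtrancl_on_into_rtrancl_on)
  qed
  have all: "u \<rightarrow>\<^sup>*\<^bsub>P\<^esub> v" if "u \<rightarrow>\<^sup>*\<^bsub>P\<^esub> a" "a \<in> part s" "v \<in> part s" for u a v
  proof -
    have "{v \<in> part s. u \<rightarrow>\<^sup>*\<^bsub>P\<^esub> v} = part s"
    proof (rule part_connected [OF st])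
      fix a a' b assume *: "a \<in> {v \<in> part s. u \<rightarrow>\<^sup>*\<^bsub>P\<^esub> v}" "a' \<in> part s" "b \<in> part t"
        "(a, b) \<in> parcs shift" "(a', b) \<in> parcs shift"
      have "(b, a') \<in> parcs shift" using *(5) joined_sym unfolding shift_def by (auto, blast)
      then show "a' \<in> {v \<in> part s. u \<rightarrow>\<^sup>*\<^bsub>P\<^esub> v}" using * step by blast
    qed (use that in auto)
    then show ?thesis using that by blast
  qed
  have "u \<rightarrow>\<^sup>*\<^bsub>P\<^esub> v" if u: "u \<in> part s \<union> part t" and v: "v \<in> part s \<union> part t" for u v
  proof -
    have uu: "u \<rightarrow>\<^sup>*\<^bsub>P\<^esub> u" unfolding reachable_def vP using u by (rule rtrancl_on_refl)
    obtain a where a: "u \<rightarrow>\<^sup>*\<^bsub>P\<^esub> a" "a \<in> part s"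
    proof (cases "u \<in> part s")
      case False
      then have "u \<in> part t" using u by blast
      moreover have "(t, s) \<in> parcs \<Gamma>" using st arcD by blast
      ultimately obtain b where "b \<in> part s" "(u, b) \<in> parcs shift" using part_neighbour by blast
      then show ?thesis using step [OF uu] that by blast
    qed (use uu that in blast)
    show ?thesis
    proof (cases "v \<in> part s")
      case False
      then have "v \<in> part t" using v by blast
      moreover have "(t, s) \<in> parcs \<Gamma>" using st arcD by blast
      ultimately obtain b where "b \<in> part s" "(b, v) \<in> parcs shift" using part_neighbour by blast
      then show ?thesis using step all [OF a] v by blast
    qed (use all [OF a] in blast)
  qed
  then show ?thesis
    unfolding Digraph_Component.connected_def strongly_connected_def P_def [symmetric] vP
    using finite_part(3) by blast
qed

lemma partite_shift: "partite \<Gamma> shift part"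
  unfolding partite_def
proof (intro conjI ballI impI)
  show "(\<Union>s\<in>pverts \<Gamma>. part s) = pverts shift" by (simp add: shift_def)
  show "part s \<noteq> {}" for s by (rule finite_part)
  show "part s \<inter> part t = {}" if "s \<in> pverts \<Gamma>" "t \<in> pverts \<Gamma>" "s \<noteq> t" for s t
    using part_disjoint that by blast
  show noloop: "(a, b) \<notin> parcs shift" if "s \<in> pverts \<Gamma>" "a \<in> part s" "b \<in> part s" for s a b
    using part_arcD that arcD by blast
  show "if (s, t) \<in> parcs \<Gamma> then Digraph_Component.connected (with_proj shift \<restriction> (part s \<union> part t))
         else arcs (with_proj shift \<restriction> (part s \<union> part t)) = {}"
    if st: "s \<in> pverts \<Gamma>" "t \<in> pverts \<Gamma>" "s \<noteq> t" for s t
  proof (cases "(s, t) \<in> parcs \<Gamma>")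
    case False
    have "(t, s) \<notin> parcs \<Gamma>" using False arcD by blast
    then have "(a, b) \<notin> parcs shift" if "a \<in> part s \<union> part t" "b \<in> part s \<union> part t" for a b
      using that st False noloop part_arcD by blast
    then show ?thesis using False by (auto simp: induce_subgraph_def)
  qed (simp add: part_pair_connected)
qed

definition colour :: "nat \<Rightarrow> 'a" where
  "colour v = the_inv_into (pverts \<Gamma>) idx (fst (prod_decode v))"

lemma colour: "s \<in> pverts \<Gamma> \<Longrightarrow> a \<in> part s \<Longrightarrow> colour a = s"
  unfolding colour_def part_def using the_inv_into_f_f [OF inj] by auto

lemma coloured_racg_shift: "coloured_racg \<Gamma> shift part colour"
proof (intro coloured_racg.intro coloured_racg_axioms.intro racg_graph.intro)
  show "pair_graph \<Gamma>" by (rule graph)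
  show "pair_graph shift" by (rule pair_graph_shift)
  show "(\<Union>s\<in>pverts \<Gamma>. part s) = pverts shift" by (simp add: shift_def)
  show "part s \<noteq> {}" for s by (rule finite_part)
  show "colour a = s" if "s \<in> pverts \<Gamma>" "a \<in> part s" for s a by (rule colour [OF that])
  show "(colour a, colour b) \<in> parcs \<Gamma>" if ab: "(a, b) \<in> parcs shift" for a b
  proof -
    obtain s x t y where e: "a = prod_encode (idx s, x)" "b = prod_encode (idx t, y)" "joined s x t y"
      "s \<in> pverts \<Gamma>" "t \<in> pverts \<Gamma>" using ab by (rule shift_arcE)
    then have "a \<in> part s" "b \<in> part t" by (auto simp: part_def joined_def)
    then show ?thesis using colour e(3-5) by (simp add: joined_def)
  qed
  show "\<exists>a\<in>part s. (a, b) \<in> parcs shift" if "(s, t) \<in> parcs \<Gamma>" "b \<in> part t" for s t b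
    using part_neighbour [of t s b] arcD [OF that(1)] that(2) by blast
  show "X = part s" if "(s, t) \<in> parcs \<Gamma>" "X \<subseteq> part s" "X \<noteq> {}"
    "\<And>a a' b. a \<in> X \<Longrightarrow> a' \<in> part s \<Longrightarrow> b \<in> part t \<Longrightarrow>
        (a, b) \<in> parcs shift \<Longrightarrow> (a', b) \<in> parcs shift \<Longrightarrow> a' \<in> X" for s t X
    using that by (rule part_connected)
qed

end

text \<open>
  Different \<open>N\<close> give graphs with different numbers of vertices, because there is at least one part.
\<close>

lemma infinitely_many_shift_graphs:
  fixes \<Gamma> :: "'a pair_pre_digraph"
  assumes "pair_graph \<Gamma>" "pverts \<Gamma> \<noteq> {}"
  obtains \<D> :: "nat pair_pre_digraph set" where "infinite \<D>"
    "\<And>\<Delta> \<Delta>'. \<Delta> \<in> \<D> \<Longrightarrow> \<Delta>' \<in> \<D> \<Longrightarrow> \<Delta> \<noteq> \<Delta>' \<Longrightarrow> card (pverts \<Delta>) \<noteq> card (pverts \<Delta>')"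
    "\<And>\<Delta>. \<Delta> \<in> \<D> \<Longrightarrow> \<exists>idx N B. shift_graph \<Gamma> idx N B \<and> \<Delta> = shift_graph.shift \<Gamma> idx N"
proof -
  interpret pair_graph \<Gamma> by (rule assms)
  obtain idx :: "'a \<Rightarrow> nat" where idx: "inj_on idx (pverts \<Gamma>)"
    using finite_imp_inj_to_nat_seg [OF pair_finite_verts] by auto
  define E where "E = (\<lambda>(s, t). 2 * prod_encode (min (idx s) (idx t), max (idx s) (idx t)) + 1) ` (pverts \<Gamma> \<times> pverts \<Gamma>)"
  define B where "B = Max E"
  have "finite E" unfolding E_def using pair_finite_verts by simp
  then have B: "2 * prod_encode (min (idx s) (idx t), max (idx s) (idx t)) + 1 \<le> B"
    if "s \<in> pverts \<Gamma>" "t \<in> pverts \<Gamma>" for s t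
    unfolding B_def by (rule Max_ge) (use that in \<open>auto simp: E_def\<close>)
  \<comment> \<open>large and coprime to ten\<close>
  define N where "N k = 10 * (4 * 5 ^ B + k) + 1" for k :: nat
  have sg: "shift_graph \<Gamma> idx (N k) B" for k
  proof
    show "4 * 5 ^ B < N k" by (simp add: N_def)
    show "coprime 10 (N k)"
    proof (rule coprimeI)
      fix d assume "d dvd 10" "d dvd N k"
      then have "d dvd 10 * (4 * 5 ^ B + k)" by (rule_tac dvd_mult2)
      then show "is_unit d" using \<open>d dvd N k\<close> unfolding N_def by (meson dvd_add_right_iff)
    qed
  qed (use assms idx B in auto)
  define D where "D k = shift_graph.shift \<Gamma> idx (N k)" for k
  have card: "card (pverts (D k)) = card (pverts \<Gamma>) * N k" for k
    unfolding D_def by (rule shift_graph.card_shift [OF sg])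
  have pos: "card (pverts \<Gamma>) \<noteq> 0" using assms(2) pair_finite_verts by simp
  have ne: "card (pverts (D k)) \<noteq> card (pverts (D l))" if "k \<noteq> l" for k l
  proof -
    have "N k \<noteq> N l" using that by (simp add: N_def)
    then show ?thesis unfolding card by (simp only: mult_cancel_left pos simp_thms)
  qed
  then have "inj D" by (metis injI)
  then have inf: "infinite (range D)" using range_inj_infinite by blast
  show ?thesis
  proof (rule that [OF inf])
    show "card (pverts \<Delta>) \<noteq> card (pverts \<Delta>')"
      if "\<Delta> \<in> range D" "\<Delta>' \<in> range D" "\<Delta> \<noteq> \<Delta>'" for \<Delta> \<Delta>'
      using that ne by (metis imageE)
    show "\<exists>idx N B. shift_graph \<Gamma> idx N B \<and> \<Delta> = shift_graph.shift \<Gamma> idx N" if "\<Delta> \<in> range D" for \<Delta>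
      using that sg unfolding D_def by blast
  qed
qed

section \<open>The theorem\<close>

lemma digraph_iso_card_verts:
  assumes "digraph_iso G H" shows "card (verts G) = card (verts H)"
proof -
  obtain f where "pre_digraph.digraph_isomorphism G f" "H = app_iso f G"
    using assms unfolding digraph_iso_def by blast
  then show ?thesis by (simp add: pre_digraph.digraph_isomorphism_def card_image)
qed

lemma (in racg_graph) empty_quasiconvex:
  assumes "pverts \<Gamma> = {}" "subgroup H (racg \<Gamma>)"
  shows "quasiconvex (racg \<Gamma>) (racg_gens \<Gamma>) H"
  unfolding quasiconvex_def
proof (intro exI [of _ 0] ballI allI impI)
  fix u v p x assume "geodesic_between (cayley_graph (racg \<Gamma>) (racg_gens \<Gamma>)) u p v" "x \<in> set p"
  then have "x \<in> carrier (racg \<Gamma>)"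
    unfolding geodesic_between_def vwalk_between_def vwalk_def using pverts_cayley by auto
  then have x: "x = racg_word \<Gamma> []" unfolding carrier_racg assms(1) by simp
  then have "x \<in> H" using subgroup.one_closed [OF assms(2)] rw_one by simp
  moreover have "path_dist (cayley_graph (racg \<Gamma>) (racg_gens \<Gamma>)) x x = 0"
    unfolding x using path_dist_words [of "[]" "[]"] wlen_le [of "[]"] by (simp add: wdist_def)
  ultimately show "\<exists>h\<in>H. path_dist (cayley_graph (racg \<Gamma>) (racg_gens \<Gamma>)) x h \<le> 0"
    by (intro bexI [of _ x]) simp_all
qed

theorem mainTheorem1:
  fixes \<Gamma> :: "'a pair_pre_digraph" and H :: "'a gword set set"
  assumes "pair_graph \<Gamma>"
    and "subgroup H (racg \<Gamma>)"
    and "finitely_generated (racg \<Gamma>) H"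
    and "\<not> quasiconvex (racg \<Gamma>) (racg_gens \<Gamma>) H"
  shows "\<exists>\<D> :: nat pair_pre_digraph set.
    infinite \<D> \<and>
    (\<forall>\<Delta>\<in>\<D>. \<forall>\<Delta>'\<in>\<D>. \<Delta> \<noteq> \<Delta>' \<longrightarrow> \<not> digraph_iso (with_proj \<Delta>) (with_proj \<Delta>')) \<and>
    (\<forall>\<Delta>\<in>\<D>. pair_graph \<Delta> \<and> hyperbolic_group (racg \<Delta>) \<and> racg_2_dimensional \<Delta> \<and>
      (\<exists>A. partite \<Gamma> \<Delta> A \<and>
        (\<forall>T K. finite T \<longrightarrow> T \<subseteq> lists (pverts \<Gamma>) \<longrightarrow>
          generate (racg \<Gamma>) (racg_word \<Gamma> ` T) = H \<longrightarrow>
          is_generalization \<Delta> A T K \<longrightarrow>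
            subgroup K (racg \<Delta>) \<and>
            finitely_generated (racg \<Delta>) K \<and>
            \<not> quasiconvex (racg \<Delta>) (racg_gens \<Delta>) K \<and>
            (torsion_free (racg \<Gamma>) H \<longrightarrow> torsion_free (racg \<Delta>) K) \<and>
            (\<not> H \<lhd> racg \<Gamma> \<longrightarrow> \<not> K \<lhd> racg \<Delta>))))"
proof -
  interpret \<Gamma>: racg_graph \<Gamma> by (rule racg_graph.intro) (rule assms(1))
  have nonempty: "pverts \<Gamma> \<noteq> {}" using \<Gamma>.empty_quasiconvex assms(2,4) by blast
  obtain \<D> :: "nat pair_pre_digraph set" where \<D>: "infinite \<D>"
    "\<And>\<Delta> \<Delta>'. \<Delta> \<in> \<D> \<Longrightarrow> \<Delta>' \<in> \<D> \<Longrightarrow> \<Delta> \<noteq> \<Delta>' \<Longrightarrow> card (pverts \<Delta>) \<noteq> card (pverts \<Delta>')"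
    "\<And>\<Delta>. \<Delta> \<in> \<D> \<Longrightarrow> \<exists>idx N B. shift_graph \<Gamma> idx N B \<and> \<Delta> = shift_graph.shift \<Gamma> idx N"
    using infinitely_many_shift_graphs [OF assms(1) nonempty] by blast
  show ?thesis
  proof (intro exI [of _ \<D>] conjI ballI impI)
    show "infinite \<D>" by (rule \<D>(1))
    fix \<Delta> assume \<Delta>: "\<Delta> \<in> \<D>"
    show "\<not> digraph_iso (with_proj \<Delta>) (with_proj \<Delta>')" if "\<Delta>' \<in> \<D>" "\<Delta> \<noteq> \<Delta>'" for \<Delta>'
      using digraph_iso_card_verts [of "with_proj \<Delta>" "with_proj \<Delta>'"] \<D>(2) [OF \<Delta> that] by auto
    obtain idx N B where sg: "shift_graph \<Gamma> idx N B" and \<Delta>_def: "\<Delta> = shift_graph.shift \<Gamma> idx N"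
      using \<D>(3) [OF \<Delta>] by blast
    interpret shift_graph \<Gamma> idx N B by (rule sg)
    interpret coloured_racg \<Gamma> \<Delta> part colour unfolding \<Delta>_def by (rule coloured_racg_shift)
    show "pair_graph \<Delta>" unfolding \<Delta>_def by (rule pair_graph_shift)
    show dim: "racg_2_dimensional \<Delta>"
      unfolding racg_2_dimensional_def \<Delta>_def using shift_no_triangle by blast
    show "hyperbolic_group (racg \<Delta>)"
      using dim shift_no_square unfolding \<Delta>_def [symmetric] by (rule \<Delta>.hyperbolic_racg)
    show "\<exists>A. partite \<Gamma> \<Delta> A \<and>
        (\<forall>T K. finite T \<longrightarrow> T \<subseteq> lists (pverts \<Gamma>) \<longrightarrow>
          generate (racg \<Gamma>) (racg_word \<Gamma> ` T) = H \<longrightarrow>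
          is_generalization \<Delta> A T K \<longrightarrow>
            subgroup K (racg \<Delta>) \<and>
            finitely_generated (racg \<Delta>) K \<and>
            \<not> quasiconvex (racg \<Delta>) (racg_gens \<Delta>) K \<and>
            (torsion_free (racg \<Gamma>) H \<longrightarrow> torsion_free (racg \<Delta>) K) \<and>
            (\<not> H \<lhd> racg \<Gamma> \<longrightarrow> \<not> K \<lhd> racg \<Delta>))"
    proof (intro exI [of _ part] conjI allI impI)
      show "partite \<Gamma> \<Delta> part" unfolding \<Delta>_def by (rule partite_shift)
      fix T K assume "finite T" and T: "T \<subseteq> lists (pverts \<Gamma>)"
        and H: "generate (racg \<Gamma>) (racg_word \<Gamma> ` T) = H" and K: "is_generalization \<Delta> part T K"
      interpret generalization \<Gamma> \<Delta> part colour T H K by unfold_locales (rule T H K)+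
      show "subgroup K (racg \<Delta>)" by (rule subgroup_K)
      show "finitely_generated (racg \<Delta>) K" by (rule finitely_generated_K)
      show "\<not> quasiconvex (racg \<Delta>) (racg_gens \<Delta>) K" using quasiconvex_descends assms(4) by blast
      show "torsion_free (racg \<Delta>) K" if "torsion_free (racg \<Gamma>) H"
        using that by (rule torsion_free_lifts)
      show "\<not> K \<lhd> racg \<Delta>" if "\<not> H \<lhd> racg \<Gamma>" using that normal_descends by blast
    qed
  qed
qed

end
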